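(* Let $G$ be a coherent group, and let $\mathcal{P}=(G,X)$ be a group pair satisfying the Cohen--Lyndon property, such that for every $x\in X$ the stabiliser $G_x$ is infinite cyclic. Then every subgroup of the quotient group $G/\langle G_x : x\in X\rangle$ that is of type $\mathtt{FP}_2(\mathbb{Q})$ is finitely presented.
   Context: A group is coherent if all its finitely generated subgroups are finitely presented. A group pair $(G,X)$ is a group $G$ together with a non-empty left $G$-set $X$; $G_x$ is the stabiliser of $x$. For a group pair $\mathcal{P}=(G,X)$ let $\mathrm{St}_{\mathcal{P}}=\{G_x: x\in X\}$, regarded as a set of subgroups of $G$ (not a multiset), on which $G$ acts by conjugation, and let $N_{\mathcal{P}}=\langle G_x: x\in X\rangle$, which is a normal subgroup of $G$. The pair $\mathcal{P}$ satisfies the Cohen--Lyndon property if there exists a complete set $T\subset\mathrm{St}_{\mathcal{P}}$ of representatives of the $N_{\mathcal{P}}$-orbits in $\mathrm{St}_{\mathcal P}$ (under conjugation) such that $N_{\mathcal{P}}$ is the (internal) free product $\ast_{K\in T}K$. A group $H$ is of type $\mathtt{FP}_2(\mathbb{Q})$ if the trivial $\mathbb{Q}H$-module $\mathbb{Q}$ admits an exact sequence $P_2\to P_1\to P_0\to\mathbb{Q}\to0$ with each $P_i$ a finitely generated projective $\mathbb{Q}H$-module. *)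

theory Defs
  imports Complex_Main "HOL-Algebra.Group_Action" "HOL-Algebra.Elementary_Groups" "HOL-Algebra.AbelCoset"
    "HOL-Algebra.Module" "HOL-Library.Poly_Mapping"
begin

section \<open>Free products and free groups\<close>

text \<open>
  The free product is the group of reduced words: finite sequences of non-trivial letters
  \<open>(i, a)\<close> with \<open>a\<close> in the \<open>i\<close>-th factor, no two neighbouring letters lying in the same factor.
  Multiplication concatenates and reduces.
\<close>

definition reduced_words :: "'i set \<Rightarrow> ('i \<Rightarrow> ('a, 'm) monoid_scheme) \<Rightarrow> ('i \<times> 'a) list set" where
  "reduced_words I G =
     {w. (\<forall>(i, a) \<in> set w. i \<in> I \<and> a \<in> carrier (G i) \<and> a \<noteq> \<one>\<^bsub>G i\<^esub>) \<and> distinct_adj (map fst w)}"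

fun letter_mult ::
    "('i \<Rightarrow> ('a, 'm) monoid_scheme) \<Rightarrow> 'i \<times> 'a \<Rightarrow> ('i \<times> 'a) list \<Rightarrow> ('i \<times> 'a) list" where
  "letter_mult G (i, a) [] = (if a = \<one>\<^bsub>G i\<^esub> then [] else [(i, a)])"
| "letter_mult G (i, a) ((j, b) # w) =
     (if a = \<one>\<^bsub>G i\<^esub> then (j, b) # w
      else if i \<noteq> j then (i, a) # (j, b) # w
      else if a \<otimes>\<^bsub>G i\<^esub> b = \<one>\<^bsub>G i\<^esub> then w
      else (i, a \<otimes>\<^bsub>G i\<^esub> b) # w)"

definition free_product ::
    "'i set \<Rightarrow> ('i \<Rightarrow> ('a, 'm) monoid_scheme) \<Rightarrow> ('i \<times> 'a) list monoid" where
  "free_product I G =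
     \<lparr>carrier = reduced_words I G, monoid.mult = (\<lambda>u v. foldr (letter_mult G) u v), one = []\<rparr>"

text \<open>
  \<open>N\<close> is the internal free product of the set \<open>T\<close> of subgroups of \<open>G\<close> if the canonical map from the
  (external) free product, which multiplies out a word in \<open>G\<close>, is an isomorphism onto \<open>N\<close>.
\<close>

definition internal_free_product ::
    "('a, 'm) monoid_scheme \<Rightarrow> 'a set set \<Rightarrow> 'a set \<Rightarrow> bool" where
  "internal_free_product G T N \<longleftrightarrow>
     (\<forall>K \<in> T. subgroup K G) \<and> subgroup N G \<and>
     (\<lambda>w. foldr (\<lambda>(K, a) b. a \<otimes>\<^bsub>G\<^esub> b) w \<one>\<^bsub>G\<^esub>)
       \<in> iso (free_product T (\<lambda>K. G\<lparr>carrier := K\<rparr>)) (G\<lparr>carrier := N\<rparr>)"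

text \<open>The free group on \<open>S\<close>, as the free product of copies of the integers indexed by \<open>S\<close>;
  the letter \<open>(s, n)\<close> is the power \<open>s\<^sup>n\<close>.\<close>

definition free_group :: "'s set \<Rightarrow> ('s \<times> int) list monoid" where
  "free_group S = free_product S (\<lambda>_. integer_group)"


section \<open>Finiteness properties and coherence\<close>

definition finitely_generated_group :: "('a, 'm) monoid_scheme \<Rightarrow> bool" where
  "finitely_generated_group G \<longleftrightarrow>
     group G \<and> (\<exists>S. finite S \<and> S \<subseteq> carrier G \<and> generate G S = carrier G)"

definition normal_closure :: "('a, 'm) monoid_scheme \<Rightarrow> 'a set \<Rightarrow> 'a set" where
  "normal_closure G R = \<Inter>{N. N \<lhd> G \<and> R \<subseteq> N}"

text \<open>Naming the generators by natural numbers is no restriction, as there are finitely many.\<close>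

definition finitely_presented_group :: "('a, 'm) monoid_scheme \<Rightarrow> bool" where
  "finitely_presented_group G \<longleftrightarrow>
     group G \<and>
     (\<exists>(S :: nat set) R. finite S \<and> finite R \<and> R \<subseteq> carrier (free_group S) \<and>
        G \<cong> free_group S Mod normal_closure (free_group S) R)"

definition coherent_group :: "('a, 'm) monoid_scheme \<Rightarrow> bool" where
  "coherent_group G \<longleftrightarrow>
     group G \<and>
     (\<forall>H. subgroup H G \<longrightarrow> finitely_generated_group (G\<lparr>carrier := H\<rparr>) \<longrightarrow>
        finitely_presented_group (G\<lparr>carrier := H\<rparr>))"

definition infinite_cyclic_group :: "('a, 'm) monoid_scheme \<Rightarrow> bool" where
  "infinite_cyclic_group G \<longleftrightarrow> group G \<and> cyclic_group G \<and> infinite (carrier G)"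


section \<open>Group pairs and the Cohen--Lyndon property\<close>

definition group_pair ::
    "('a, 'm) monoid_scheme \<Rightarrow> 'x set \<Rightarrow> ('a \<Rightarrow> 'x \<Rightarrow> 'x) \<Rightarrow> bool" where
  "group_pair G E \<phi> \<longleftrightarrow> group_action G E \<phi> \<and> E \<noteq> {}"

definition stabilizers ::
    "('a, 'm) monoid_scheme \<Rightarrow> 'x set \<Rightarrow> ('a \<Rightarrow> 'x \<Rightarrow> 'x) \<Rightarrow> 'a set set" where
  "stabilizers G E \<phi> = {stabilizer G \<phi> x | x. x \<in> E}"

definition stabilizers_span ::
    "('a, 'm) monoid_scheme \<Rightarrow> 'x set \<Rightarrow> ('a \<Rightarrow> 'x \<Rightarrow> 'x) \<Rightarrow> 'a set" where
  "stabilizers_span G E \<phi> = generate G (\<Union>x\<in>E. stabilizer G \<phi> x)"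

definition conjugate_set :: "('a, 'm) monoid_scheme \<Rightarrow> 'a \<Rightarrow> 'a set \<Rightarrow> 'a set" where
  "conjugate_set G g K = g <#\<^bsub>G\<^esub> K #>\<^bsub>G\<^esub> (inv\<^bsub>G\<^esub> g)"

definition cohen_lyndon ::
    "('a, 'm) monoid_scheme \<Rightarrow> 'x set \<Rightarrow> ('a \<Rightarrow> 'x \<Rightarrow> 'x) \<Rightarrow> bool" where
  "cohen_lyndon G E \<phi> \<longleftrightarrow>
     (\<exists>T \<subseteq> stabilizers G E \<phi>.
        (\<forall>C \<in> orbits (G\<lparr>carrier := stabilizers_span G E \<phi>\<rparr>) (stabilizers G E \<phi>) (conjugate_set G).
           \<exists>!K. K \<in> T \<and> K \<in> C) \<and>
        internal_free_product G T (stabilizers_span G E \<phi>))"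


section \<open>Modules over possibly non-commutative rings\<close>

text \<open>The library's \<^locale>\<open>module\<close> demands a commutative base ring.\<close>

locale left_module = R?: ring R + M?: abelian_group M
  for R (structure) and M :: "('r, 'a, 'n) module_scheme" (structure) +
  assumes smult_closed:
      "\<lbrakk>a \<in> carrier R; x \<in> carrier M\<rbrakk> \<Longrightarrow> a \<odot>\<^bsub>M\<^esub> x \<in> carrier M"
    and smult_l_distr:
      "\<lbrakk>a \<in> carrier R; b \<in> carrier R; x \<in> carrier M\<rbrakk> \<Longrightarrow>
       (a \<oplus>\<^bsub>R\<^esub> b) \<odot>\<^bsub>M\<^esub> x = a \<odot>\<^bsub>M\<^esub> x \<oplus>\<^bsub>M\<^esub> b \<odot>\<^bsub>M\<^esub> x"
    and smult_r_distr:
      "\<lbrakk>a \<in> carrier R; x \<in> carrier M; y \<in> carrier M\<rbrakk> \<Longrightarrow>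
       a \<odot>\<^bsub>M\<^esub> (x \<oplus>\<^bsub>M\<^esub> y) = a \<odot>\<^bsub>M\<^esub> x \<oplus>\<^bsub>M\<^esub> a \<odot>\<^bsub>M\<^esub> y"
    and smult_assoc:
      "\<lbrakk>a \<in> carrier R; b \<in> carrier R; x \<in> carrier M\<rbrakk> \<Longrightarrow>
       (a \<otimes>\<^bsub>R\<^esub> b) \<odot>\<^bsub>M\<^esub> x = a \<odot>\<^bsub>M\<^esub> (b \<odot>\<^bsub>M\<^esub> x)"
    and smult_one:
      "x \<in> carrier M \<Longrightarrow> \<one>\<^bsub>R\<^esub> \<odot>\<^bsub>M\<^esub> x = x"

definition left_module_hom ::
    "('r, 'm) ring_scheme \<Rightarrow> ('r, 'a, 'n) module_scheme \<Rightarrow> ('r, 'b, 'k) module_scheme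
      \<Rightarrow> ('a \<Rightarrow> 'b) set" where
  "left_module_hom R M N =
     {f \<in> carrier M \<rightarrow> carrier N.
        (\<forall>x \<in> carrier M. \<forall>y \<in> carrier M. f (x \<oplus>\<^bsub>M\<^esub> y) = f x \<oplus>\<^bsub>N\<^esub> f y) \<and>
        (\<forall>a \<in> carrier R. \<forall>x \<in> carrier M. f (a \<odot>\<^bsub>M\<^esub> x) = a \<odot>\<^bsub>N\<^esub> f x)}"

definition finitely_generated_module ::
    "('r, 'm) ring_scheme \<Rightarrow> ('r, 'a, 'n) module_scheme \<Rightarrow> bool" where
  "finitely_generated_module R M \<longleftrightarrow>
     (\<exists>S. finite S \<and> S \<subseteq> carrier M \<and>
        (\<forall>N. submodule N R M \<longrightarrow> S \<subseteq> N \<longrightarrow> N = carrier M))"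

text \<open>
  The free module on \<open>I\<close>: finitely supported families \<open>I \<rightarrow> R\<close>, extended by zero.
  The two multiplicative fields of the record play no role.
\<close>

definition free_module :: "('r, 'm) ring_scheme \<Rightarrow> 'i set \<Rightarrow> ('r, 'i \<Rightarrow> 'r) module" where
  "free_module R I =
     \<lparr>carrier = {f. (\<forall>i. f i \<in> carrier R) \<and> (\<forall>i. i \<notin> I \<longrightarrow> f i = \<zero>\<^bsub>R\<^esub>) \<and> finite {i. f i \<noteq> \<zero>\<^bsub>R\<^esub>}},
      monoid.mult = undefined, one = undefined,
      zero = (\<lambda>_. \<zero>\<^bsub>R\<^esub>), add = (\<lambda>f g i. f i \<oplus>\<^bsub>R\<^esub> g i),
      smult = (\<lambda>a f i. a \<otimes>\<^bsub>R\<^esub> f i)\<rparr>"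

text \<open>
  A module is projective if it is isomorphic to a direct summand of a free module.
  Every module is a quotient of the free module on its own elements, and a projective module is
  a direct summand of it; so index sets in the element type of \<open>P\<close> suffice.
\<close>

definition projective_module ::
    "('r, 'm) ring_scheme \<Rightarrow> ('r, 'a, 'n) module_scheme \<Rightarrow> bool" where
  "projective_module R P \<longleftrightarrow>
     left_module R P \<and>
     (\<exists>(I :: 'a set) A B f.
        submodule A R (free_module R I) \<and> submodule B R (free_module R I) \<and>
        A \<inter> B = {\<zero>\<^bsub>free_module R I\<^esub>} \<and>
        A <+>\<^bsub>free_module R I\<^esub> B = carrier (free_module R I) \<and>
        f \<in> left_module_hom R P ((free_module R I)\<lparr>carrier := A\<rparr>) \<and>
        bij_betw f (carrier P) A)"


section \<open>Group rings and type \<open>FP\<^sub>2(\<rat>)\<close>\<close>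

definition group_ring :: "('g, 'm) monoid_scheme \<Rightarrow> ('g \<Rightarrow>\<^sub>0 'k::comm_ring_1) ring" where
  "group_ring H =
     \<lparr>carrier = {u. Poly_Mapping.keys u \<subseteq> carrier H},
      monoid.mult = (\<lambda>u v. \<Sum>g\<in>Poly_Mapping.keys u. \<Sum>h\<in>Poly_Mapping.keys v.
                Poly_Mapping.single (g \<otimes>\<^bsub>H\<^esub> h) (Poly_Mapping.lookup u g * Poly_Mapping.lookup v h)),
      one = Poly_Mapping.single \<one>\<^bsub>H\<^esub> 1,
      zero = 0, add = (+)\<rparr>"

text \<open>The coefficient ring with trivial \<open>H\<close>-action: the group ring acts through augmentation.\<close>

definition trivial_module :: "('g \<Rightarrow>\<^sub>0 'k, 'k::comm_ring_1) module" where
  "trivial_module =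
     \<lparr>carrier = UNIV, monoid.mult = (*), one = 1, zero = 0, add = (+),
      smult = (\<lambda>u q. (\<Sum>g\<in>Poly_Mapping.keys u. Poly_Mapping.lookup u g) * q)\<rparr>"

text \<open>
  A finitely generated projective module over \<open>R\<close> is isomorphic to a direct summand of some
  \<open>R\<^sup>n\<close>, hence to a module whose elements are functions \<open>nat \<Rightarrow> R\<close>; so it is no restriction
  to take the terms of the resolution in that type.
\<close>

definition type_FP2_rat :: "('g, 'm) monoid_scheme \<Rightarrow> bool" where
  "type_FP2_rat H \<longleftrightarrow>
     (\<exists>(P\<^sub>0 :: ('g \<Rightarrow>\<^sub>0 rat, nat \<Rightarrow> 'g \<Rightarrow>\<^sub>0 rat) module)
       (P\<^sub>1 :: ('g \<Rightarrow>\<^sub>0 rat, nat \<Rightarrow> 'g \<Rightarrow>\<^sub>0 rat) module)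
       (P\<^sub>2 :: ('g \<Rightarrow>\<^sub>0 rat, nat \<Rightarrow> 'g \<Rightarrow>\<^sub>0 rat) module) d\<^sub>2 d\<^sub>1 \<epsilon>.
        (\<forall>P \<in> {P\<^sub>0, P\<^sub>1, P\<^sub>2}.
           projective_module (group_ring H) P \<and> finitely_generated_module (group_ring H) P) \<and>
        d\<^sub>2 \<in> left_module_hom (group_ring H) P\<^sub>2 P\<^sub>1 \<and>
        d\<^sub>1 \<in> left_module_hom (group_ring H) P\<^sub>1 P\<^sub>0 \<and>
        \<epsilon> \<in> left_module_hom (group_ring H) P\<^sub>0 trivial_module \<and>
        d\<^sub>2 ` carrier P\<^sub>2 = a_kernel P\<^sub>1 P\<^sub>0 d\<^sub>1 \<and>
        d\<^sub>1 ` carrier P\<^sub>1 = a_kernel P\<^sub>0 (trivial_module :: ('g \<Rightarrow>\<^sub>0 rat, rat) module) \<epsilon> \<and>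
        \<epsilon> ` carrier P\<^sub>0 = carrier (trivial_module :: ('g \<Rightarrow>\<^sub>0 rat, rat) module))"


section \<open>The constructions are groups, rings and modules\<close>

lemma reduced_words_Nil: "[] \<in> reduced_words I G" by (simp add: reduced_words_def)

lemma reduced_words_Cons:
  "(i, a) # w \<in> reduced_words I G \<longleftrightarrow>
     i \<in> I \<and> a \<in> carrier (G i) \<and> a \<noteq> \<one>\<^bsub>G i\<^esub> \<and> w \<in> reduced_words I G \<and> (w = [] \<or> fst (hd w) \<noteq> i)"
  by (cases w) (auto simp: reduced_words_def)

context
  fixes I :: "'i set" and G :: "'i \<Rightarrow> ('a, 'm) monoid_scheme"
  assumes groups: "\<And>i. i \<in> I \<Longrightarrow> group (G i)"
begin

lemma letter_mult_closed:
  assumes "i \<in> I" "a \<in> carrier (G i)" "w \<in> reduced_words I G"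
  shows "letter_mult G (i, a) w \<in> reduced_words I G"
proof (cases w)
  case Nil
  then show ?thesis using assms by (auto simp: reduced_words_Cons reduced_words_Nil)
next
  case (Cons l v)
  obtain j b where l: "l = (j, b)" by fastforce
  interpret Gi: group "G i" using groups assms by simp
  have "j = i \<Longrightarrow> a \<otimes>\<^bsub>G i\<^esub> b \<in> carrier (G i)"
    using assms Cons l by (auto simp: reduced_words_Cons)
  then show ?thesis using assms Cons l by (auto simp: reduced_words_Cons)
qed

lemma letter_mult_one: "letter_mult G (i, \<one>\<^bsub>G i\<^esub>) w = w"
  by (cases w) auto

lemma letter_mult_letter_mult:
  assumes i: "i \<in> I" and a: "a \<in> carrier (G i)" and b: "b \<in> carrier (G i)" and w: "w \<in> reduced_words I G"
  shows "letter_mult G (i, a) (letter_mult G (i, b) w) = letter_mult G (i, a \<otimes>\<^bsub>G i\<^esub> b) w"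
proof -
  interpret Gi: group "G i" using groups assms by simp
  show ?thesis
  proof (cases w)
    case Nil
    then show ?thesis using a b by auto
  next
    case (Cons l v)
    obtain j c where l: "l = (j, c)" by fastforce
    show ?thesis
    proof (cases "j = i")
      case False
      then show ?thesis using a b Cons l by auto
    next
      case True
      have c: "c \<in> carrier (G i)" "c \<noteq> \<one>\<^bsub>G i\<^esub>" and v: "v = [] \<or> fst (hd v) \<noteq> i"
        using w Cons l True by (auto simp: reduced_words_Cons)
      have 1: "letter_mult G (i, a) v = (if a = \<one>\<^bsub>G i\<^esub> then v else (i, a) # v)"
        using v by (cases v) auto
      have 2: "a \<otimes>\<^bsub>G i\<^esub> b \<otimes>\<^bsub>G i\<^esub> c = a" if "b \<otimes>\<^bsub>G i\<^esub> c = \<one>\<^bsub>G i\<^esub>"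
        using that a b c by (simp add: Gi.m_assoc)
      have 3: "a \<otimes>\<^bsub>G i\<^esub> (b \<otimes>\<^bsub>G i\<^esub> c) = c" if "a \<otimes>\<^bsub>G i\<^esub> b = \<one>\<^bsub>G i\<^esub>"
        using that a b c by (simp add: Gi.m_assoc[symmetric])
      have 4: "b \<otimes>\<^bsub>G i\<^esub> c = \<one>\<^bsub>G i\<^esub> \<Longrightarrow> a \<otimes>\<^bsub>G i\<^esub> b = \<one>\<^bsub>G i\<^esub> \<Longrightarrow> a = c"
        using 2 3 a b c by simp
      show ?thesis using a b c Cons l True 1 2 3 4
        by (auto simp: Gi.m_assoc)
    qed
  qed
qed

abbreviation word_mult :: "('i \<times> 'a) list \<Rightarrow> ('i \<times> 'a) list \<Rightarrow> ('i \<times> 'a) list" where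
  "word_mult u v \<equiv> foldr (letter_mult G) u v"

lemma word_mult_closed:
  "\<lbrakk>set u \<subseteq> (SIGMA i:I. carrier (G i)); v \<in> reduced_words I G\<rbrakk> \<Longrightarrow> word_mult u v \<in> reduced_words I G"
  by (induction u) (auto intro: letter_mult_closed)

lemma reduced_letters: "u \<in> reduced_words I G \<Longrightarrow> set u \<subseteq> (SIGMA i:I. carrier (G i))"
  by (auto simp: reduced_words_def)

lemma word_mult_letter_mult:
  assumes i: "i \<in> I" "a \<in> carrier (G i)" and v: "v \<in> reduced_words I G" and w: "w \<in> reduced_words I G"
  shows "word_mult (letter_mult G (i, a) v) w = letter_mult G (i, a) (word_mult v w)"
proof (cases v)
  case Nil
  then show ?thesis by (auto simp: letter_mult_one)
next
  case (Cons l v')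
  obtain j b where l: "l = (j, b)" by fastforce
  have b: "j \<in> I" "b \<in> carrier (G j)" "v' \<in> reduced_words I G"
    using v Cons l by (auto simp: reduced_words_Cons)
  have "word_mult v' w \<in> reduced_words I G"
    using b w reduced_letters by (intro word_mult_closed) auto
  then have "letter_mult G (i, a) (letter_mult G (i, b) (word_mult v' w))
      = letter_mult G (i, a \<otimes>\<^bsub>G i\<^esub> b) (word_mult v' w)" if "i = j"
    using that i b by (intro letter_mult_letter_mult) auto
  then show ?thesis using Cons l by (auto simp: letter_mult_one)
qed

lemma word_mult_assoc:
  "\<lbrakk>set u \<subseteq> (SIGMA i:I. carrier (G i)); v \<in> reduced_words I G; w \<in> reduced_words I G\<rbrakk>
    \<Longrightarrow> word_mult (word_mult u v) w = word_mult u (word_mult v w)"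
  by (induction u) (auto simp: word_mult_letter_mult word_mult_closed)

lemma word_mult_inv: "w \<in> reduced_words I G \<Longrightarrow> word_mult (rev (map (\<lambda>(i, a). (i, inv\<^bsub>G i\<^esub> a)) w)) w = []"
proof (induction w)
  case (Cons l w)
  obtain i a where l: "l = (i, a)" by fastforce
  have ia: "i \<in> I" "a \<in> carrier (G i)" "w \<in> reduced_words I G" "a \<noteq> \<one>\<^bsub>G i\<^esub>"
    using Cons l by (auto simp: reduced_words_Cons)
  interpret Gi: group "G i" using groups ia by simp
  show ?case using ia Cons l by (auto simp: Gi.inv_eq_1_iff)
qed simp

lemma group_free_product: "group (free_product I G)"
proof (rule groupI)
  fix x y z
  assume *: "x \<in> carrier (free_product I G)" "y \<in> carrier (free_product I G)"
  show "x \<otimes>\<^bsub>free_product I G\<^esub> y \<in> carrier (free_product I G)"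
    using * by (auto simp: free_product_def intro: word_mult_closed reduced_letters[THEN subsetD])
  assume "z \<in> carrier (free_product I G)"
  then show "x \<otimes>\<^bsub>free_product I G\<^esub> y \<otimes>\<^bsub>free_product I G\<^esub> z =
       x \<otimes>\<^bsub>free_product I G\<^esub> (y \<otimes>\<^bsub>free_product I G\<^esub> z)"
    using * unfolding free_product_def by (simp add: word_mult_assoc reduced_letters)
next
  fix x assume *: "x \<in> carrier (free_product I G)"
  let ?y = "rev (map (\<lambda>(i, a). (i, inv\<^bsub>G i\<^esub> a)) x)"
  have r: "x \<in> reduced_words I G" using * by (simp add: free_product_def)
  have "set ?y \<subseteq> (SIGMA i:I. carrier (G i))"
  proof
    fix p assume "p \<in> set ?y"
    then obtain i a where ia: "(i, a) \<in> set x" and p: "p = (i, inv\<^bsub>G i\<^esub> a)" by auto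
    then have "i \<in> I" "a \<in> carrier (G i)" using r reduced_letters by blast+
    then show "p \<in> (SIGMA i:I. carrier (G i))" using groups p by (simp add: group.inv_closed)
  qed
  then have s: "set ?y \<subseteq> (SIGMA i:I. carrier (G i))" .
  have "word_mult (word_mult ?y []) x = []"
    using word_mult_assoc[OF s reduced_words_Nil r] word_mult_inv[OF r] by simp
  moreover have "word_mult ?y [] \<in> reduced_words I G"
    using s reduced_words_Nil by (rule word_mult_closed)
  ultimately show "\<exists>y\<in>carrier (free_product I G). y \<otimes>\<^bsub>free_product I G\<^esub> x = \<one>\<^bsub>free_product I G\<^esub>"
    by (auto simp: free_product_def)
qed (auto simp: free_product_def reduced_words_Nil)

end

lemma group_ring_mult_superset:
  fixes u v :: "'g \<Rightarrow>\<^sub>0 'k::comm_ring_1"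
  assumes "finite A" "Poly_Mapping.keys u \<subseteq> A" "finite B" "Poly_Mapping.keys v \<subseteq> B"
  shows "u \<otimes>\<^bsub>group_ring H\<^esub> v = (\<Sum>g\<in>A. \<Sum>h\<in>B. Poly_Mapping.single (g \<otimes>\<^bsub>H\<^esub> h)
           (Poly_Mapping.lookup u g * Poly_Mapping.lookup v h))"
proof -
  have "u \<otimes>\<^bsub>group_ring H\<^esub> v = (\<Sum>g\<in>Poly_Mapping.keys u. \<Sum>h\<in>B. Poly_Mapping.single (g \<otimes>\<^bsub>H\<^esub> h)
           (Poly_Mapping.lookup u g * Poly_Mapping.lookup v h))"
    unfolding group_ring_def using assms
    by (auto intro!: sum.cong[OF refl] sum.mono_neutral_left simp: not_in_keys_iff_lookup_eq_zero)
  also have "\<dots> = (\<Sum>g\<in>A. \<Sum>h\<in>B. Poly_Mapping.single (g \<otimes>\<^bsub>H\<^esub> h)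
           (Poly_Mapping.lookup u g * Poly_Mapping.lookup v h))"
    using assms by (auto intro!: sum.mono_neutral_left simp: in_keys_iff)
  finally show ?thesis .
qed

lemma group_ring_distl:
  fixes u v w :: "'g \<Rightarrow>\<^sub>0 'k::comm_ring_1"
  shows "(u + v) \<otimes>\<^bsub>group_ring H\<^esub> w = u \<otimes>\<^bsub>group_ring H\<^esub> w + v \<otimes>\<^bsub>group_ring H\<^esub> w"
  using keys_add[of u v]
  by (simp add: group_ring_mult_superset[where A="Poly_Mapping.keys u \<union> Poly_Mapping.keys v" and B="Poly_Mapping.keys w"]
       lookup_add distrib_right single_add sum.distrib)

lemma group_ring_distr:
  fixes u v w :: "'g \<Rightarrow>\<^sub>0 'k::comm_ring_1"
  shows "w \<otimes>\<^bsub>group_ring H\<^esub> (u + v) = w \<otimes>\<^bsub>group_ring H\<^esub> u + w \<otimes>\<^bsub>group_ring H\<^esub> v"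
  using keys_add[of u v]
  by (simp add: group_ring_mult_superset[where B="Poly_Mapping.keys u \<union> Poly_Mapping.keys v" and A="Poly_Mapping.keys w"]
       lookup_add distrib_left single_add sum.distrib)

lemma group_ring_single:
  "Poly_Mapping.single g a \<otimes>\<^bsub>group_ring H\<^esub> Poly_Mapping.single h b
    = Poly_Mapping.single (g \<otimes>\<^bsub>H\<^esub> h) (a * b :: 'k::comm_ring_1)"
  by (subst group_ring_mult_superset[where A="{g}" and B="{h}"]) auto

lemma group_ring_zero: "(0 :: 'g \<Rightarrow>\<^sub>0 'k::comm_ring_1) \<otimes>\<^bsub>group_ring H\<^esub> u = 0"
   "u \<otimes>\<^bsub>group_ring H\<^esub> (0 :: 'g \<Rightarrow>\<^sub>0 'k::comm_ring_1) = 0"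
  by (simp_all add: group_ring_def)

lemma poly_mapping_sum:
  "(\<Sum>g\<in>Poly_Mapping.keys u. Poly_Mapping.single g (Poly_Mapping.lookup u g)) = (u :: 'g \<Rightarrow>\<^sub>0 'k::comm_monoid_add)"
  by (rule poly_mapping_eqI)
    (auto simp: lookup_sum lookup_single when_def if_distrib not_in_keys_iff_lookup_eq_zero sum.delta)

lemma group_ring_induct [consumes 1, case_names zero single add]:
  fixes u :: "'g \<Rightarrow>\<^sub>0 'k::comm_ring_1"
  assumes "Poly_Mapping.keys u \<subseteq> C" "P 0" "\<And>g a. g \<in> C \<Longrightarrow> P (Poly_Mapping.single g a)"
     "\<And>u v. P u \<Longrightarrow> P v \<Longrightarrow> P (u + v)"
  shows "P u"
proof -
  have "P (\<Sum>g\<in>F. Poly_Mapping.single g (Poly_Mapping.lookup u g))" if "finite F" "F \<subseteq> C" for F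
    using that by (induction F rule: finite_induct) (auto intro: assms)
  from this[of "Poly_Mapping.keys u"] assms(1) show ?thesis
    by (simp add: poly_mapping_sum)
qed

lemma ring_group_ring:
  assumes "group H"
  shows "ring (group_ring H :: ('g \<Rightarrow>\<^sub>0 'k::comm_ring_1) ring)"
proof -
  interpret group H by fact
  let ?R = "group_ring H :: ('g \<Rightarrow>\<^sub>0 'k) ring"
  have c: "carrier ?R = {u. Poly_Mapping.keys u \<subseteq> carrier H}" by (simp add: group_ring_def)
  show ?thesis
  proof (rule ringI)
    show "abelian_group ?R"
    proof (rule abelian_groupI)
      fix x assume "x \<in> carrier ?R"
      then show "\<exists>y\<in>carrier ?R. y \<oplus>\<^bsub>?R\<^esub> x = \<zero>\<^bsub>?R\<^esub>"
        by (intro bexI[of _ "-x"]) (auto simp: group_ring_def)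
    next
      fix x y assume "x \<in> carrier ?R" "y \<in> carrier ?R"
      then show "x \<oplus>\<^bsub>?R\<^esub> y \<in> carrier ?R"
        using keys_add[of x y] by (auto simp: group_ring_def)
    qed (auto simp: group_ring_def algebra_simps)
    have cl: "x \<otimes>\<^bsub>?R\<^esub> y \<in> carrier ?R" if "x \<in> carrier ?R" "y \<in> carrier ?R" for x y
    proof -
      have "Poly_Mapping.keys x \<subseteq> carrier H" using that c by auto
      then show ?thesis
      proof (induction x rule: group_ring_induct)
        case (single g a)
        have "Poly_Mapping.keys y \<subseteq> carrier H" using that c by auto
        then show ?case
        proof (induction y rule: group_ring_induct)
          case (single h b) then show ?case using \<open>g \<in> carrier H\<close> by (auto simp: group_ring_single c)
        next
          case (add p q) then show ?case
            using keys_add[of "Poly_Mapping.single g a \<otimes>\<^bsub>?R\<^esub> p" "Poly_Mapping.single g a \<otimes>\<^bsub>?R\<^esub> q"] by (auto simp: group_ring_distr c)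
        qed (simp add: c group_ring_zero)
      next
        case (add p q) then show ?case
            using keys_add[of "p \<otimes>\<^bsub>?R\<^esub> y" "q \<otimes>\<^bsub>?R\<^esub> y"] by (auto simp: group_ring_distl c)
      qed (simp add: c group_ring_zero)
    qed
    have as: "x \<otimes>\<^bsub>?R\<^esub> y \<otimes>\<^bsub>?R\<^esub> z = x \<otimes>\<^bsub>?R\<^esub> (y \<otimes>\<^bsub>?R\<^esub> z)"
      if "x \<in> carrier ?R" "y \<in> carrier ?R" "z \<in> carrier ?R" for x y z
    proof -
      have k: "Poly_Mapping.keys x \<subseteq> carrier H" "Poly_Mapping.keys y \<subseteq> carrier H" "Poly_Mapping.keys z \<subseteq> carrier H"
        using that c by auto
      show ?thesis using k(1)
      proof (induction x rule: group_ring_induct)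
        case (single g a) note g = this
        show ?case using k(2)
        proof (induction y rule: group_ring_induct)
          case (single h b) note h = this
          show ?case using k(3)
          proof (induction z rule: group_ring_induct)
            case (single l d) then show ?case using g h by (simp add: group_ring_single m_assoc mult.assoc)
          qed (simp_all add: group_ring_distr group_ring_zero)
        qed (simp_all add: group_ring_distr group_ring_distl group_ring_zero)
      qed (simp_all add: group_ring_distl group_ring_zero)
    qed
    have on: "\<one>\<^bsub>?R\<^esub> \<otimes>\<^bsub>?R\<^esub> x = x \<and> x \<otimes>\<^bsub>?R\<^esub> \<one>\<^bsub>?R\<^esub> = x" if "x \<in> carrier ?R" for x
    proof -
      have o: "\<one>\<^bsub>?R\<^esub> = Poly_Mapping.single \<one>\<^bsub>H\<^esub> 1" by (simp add: group_ring_def)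
      have "Poly_Mapping.keys x \<subseteq> carrier H" using that c by auto
      then show ?thesis
        by (induction x rule: group_ring_induct) (simp_all add: o group_ring_single group_ring_zero group_ring_distl group_ring_distr)
    qed
    show "Group.monoid ?R"
      by (rule monoidI) (use cl as on in \<open>auto simp: c group_ring_def\<close>)
  qed (simp_all add: group_ring_distl group_ring_distr group_ring_def[THEN arg_cong[where f=add]])
qed

abbreviation "augmentation u \<equiv> (\<Sum>g\<in>Poly_Mapping.keys u. Poly_Mapping.lookup u g)"

lemma augmentation_superset: "finite A \<Longrightarrow> Poly_Mapping.keys u \<subseteq> A \<Longrightarrow> augmentation u = (\<Sum>g\<in>A. Poly_Mapping.lookup u g)"
  by (auto intro!: sum.mono_neutral_left simp: not_in_keys_iff_lookup_eq_zero)

lemma augmentation_add: "augmentation (u + v) = augmentation u + augmentation (v :: 'g \<Rightarrow>\<^sub>0 'k::comm_ring_1)"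
proof -
  let ?A = "Poly_Mapping.keys u \<union> Poly_Mapping.keys v"
  have "augmentation (u + v) = (\<Sum>g\<in>?A. Poly_Mapping.lookup (u + v) g)"
    using keys_add[of u v] by (intro augmentation_superset) auto
  moreover have "augmentation u = (\<Sum>g\<in>?A. Poly_Mapping.lookup u g)" by (intro augmentation_superset) auto
  moreover have "augmentation v = (\<Sum>g\<in>?A. Poly_Mapping.lookup v g)" by (intro augmentation_superset) auto
  ultimately show ?thesis by (simp add: lookup_add sum.distrib)
qed

lemma augmentation_single: "augmentation (Poly_Mapping.single g a) = a" by simp

lemma augmentation_mult: "augmentation (u \<otimes>\<^bsub>group_ring H\<^esub> v) = augmentation u * augmentation (v :: 'g \<Rightarrow>\<^sub>0 'k::comm_ring_1)"
proof -
  have "Poly_Mapping.keys u \<subseteq> UNIV" by simp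
  then show ?thesis
  proof (induction u rule: group_ring_induct)
    case (single g a)
    have "Poly_Mapping.keys v \<subseteq> UNIV" by simp
    then show ?case
      by (induction v rule: group_ring_induct) (simp_all only: group_ring_single group_ring_zero group_ring_distr augmentation_add augmentation_single keys_zero sum.empty mult_zero_right distrib_left)
  qed (simp_all only: group_ring_distl group_ring_zero augmentation_add keys_zero sum.empty mult_zero_left distrib_right)
qed

lemma left_module_trivial_module:
  assumes "group H"
  shows "left_module (group_ring H) (trivial_module :: ('g \<Rightarrow>\<^sub>0 'k::comm_ring_1, 'k) module)"
proof -
  interpret ring "group_ring H :: ('g \<Rightarrow>\<^sub>0 'k) ring" by (rule ring_group_ring) fact
  let ?M = "trivial_module :: ('g \<Rightarrow>\<^sub>0 'k, 'k) module"
  have sm: "u \<odot>\<^bsub>?M\<^esub> x = augmentation u * x" for u x by (simp add: trivial_module_def)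
  have ad: "u \<oplus>\<^bsub>?M\<^esub> x = u + x" for u x by (simp add: trivial_module_def)
  have ad2: "u \<oplus>\<^bsub>group_ring H\<^esub> x = u + x" for u x :: "'g \<Rightarrow>\<^sub>0 'k" by (simp add: group_ring_def)
  show ?thesis
  proof (rule left_module.intro)
    show "abelian_group ?M"
    proof (rule abelian_groupI)
      fix x
      show "\<exists>y\<in>carrier ?M. y \<oplus>\<^bsub>?M\<^esub> x = \<zero>\<^bsub>?M\<^esub>"
        by (intro bexI[of _ "-x"]) (auto simp: trivial_module_def)
    qed (auto simp: trivial_module_def algebra_simps)
    show "left_module_axioms (group_ring H) ?M"
      unfolding left_module_axioms_def sm ad ad2 augmentation_mult augmentation_add
      by (auto simp: trivial_module_def algebra_simps group_ring_def)
  qed (rule ring_axioms)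
qed

lemma left_module_free_module:
  fixes R :: "('a, 'm) ring_scheme" and I :: "'i set"
  assumes "ring R"
  shows "left_module R (free_module R I)"
proof -
  interpret R: ring R by fact
  have fin: "finite {i. f i \<noteq> \<zero>\<^bsub>R\<^esub>} \<Longrightarrow> finite {i. g i \<noteq> \<zero>\<^bsub>R\<^esub>} \<Longrightarrow> finite {i. f i \<oplus>\<^bsub>R\<^esub> g i \<noteq> \<zero>\<^bsub>R\<^esub>}" for f g :: "'i \<Rightarrow> 'a"
    by (rule finite_subset[of _ "{i. f i \<noteq> \<zero>\<^bsub>R\<^esub>} \<union> {i. g i \<noteq> \<zero>\<^bsub>R\<^esub>}"]) auto
  have fin2: "finite {i. f i \<noteq> \<zero>\<^bsub>R\<^esub>} \<Longrightarrow> a \<in> carrier R \<Longrightarrow> finite {i. a \<otimes>\<^bsub>R\<^esub> f i \<noteq> \<zero>\<^bsub>R\<^esub>}" for f  :: "'i \<Rightarrow> 'a" and a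
    by (rule finite_subset[of _ "{i. f i \<noteq> \<zero>\<^bsub>R\<^esub>}"]) auto
  show ?thesis
  proof (rule left_module.intro)
    show "abelian_group (free_module R I)"
    proof (rule abelian_groupI)
      fix x assume x: "x \<in> carrier (free_module R I)"
      have "finite {i. \<ominus>\<^bsub>R\<^esub> x i \<noteq> \<zero>\<^bsub>R\<^esub>}" 
        by (rule finite_subset[of _ "{i. x i \<noteq> \<zero>\<^bsub>R\<^esub>}"]) (use x in \<open>auto simp: free_module_def\<close>)
      then show "\<exists>y\<in>carrier (free_module R I). y \<oplus>\<^bsub>free_module R I\<^esub> x = \<zero>\<^bsub>free_module R I\<^esub>"
        using x
        by (intro bexI[of _ "\<lambda>i. \<ominus>\<^bsub>R\<^esub> x i"]) (auto simp: free_module_def R.l_neg)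
    qed (auto simp: free_module_def fin R.a_ac)
    show "left_module_axioms R (free_module R I)"
      unfolding left_module_axioms_def by (auto simp: free_module_def fin2 R.l_distr R.r_distr R.m_assoc)
  qed (rule R.ring_axioms)
qed

end

theory Submission
  imports Defs
begin

text \<open>
  Let \<open>N\<close> be the subgroup spanned by the stabilisers. If \<open>H \<le> G\<close> is finitely generated and maps onto \<open>Q\<close>,
  then \<open>H\<close> is finitely presented by coherence, so \<open>Q\<close> is finitely presented as soon as the kernel
  \<open>H \<inter> N\<close> is normally generated in \<open>H\<close> by finitely many elements
  (\<open>finitely_presented_quotient\<close>). The work lies in finding such an \<open>H\<close>.

  As \<open>Q\<close> is of type \<open>FP\<^sub>2(\<rat>)\<close>, it is finitely generated, so some finitely generated \<open>H\<^sub>1 \<le> G\<close> maps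
  onto it; and comparing the given resolution with the one that comes from the generators of \<open>H\<^sub>1\<close>
  shows that the first rational homology of \<open>H\<^sub>1 \<inter> N\<close> is a finitely generated module. In elementary
  terms, there is a finite \<open>Z \<subseteq> H\<^sub>1 \<inter> N\<close> such that a homomorphism \<open>H\<^sub>1 \<inter> N \<rightarrow> \<rat>\<close> vanishes if it kills
  all \<open>H\<^sub>1\<close>-conjugates of \<open>Z\<close> (\<open>finitely_many_rational_relations\<close>).

  By the Cohen--Lyndon property, \<open>N\<close> is free on generators \<open>t\<^sub>K\<close> of the stabilisers \<open>K \<in> T\<close>. The finite
  set \<open>Z\<close> involves only finitely many of the \<open>t\<^sub>K\<close>; adjoining these to \<open>H\<^sub>1\<close> gives a finitely generated
  group \<open>H\<^sub>2\<close>. Put \<open>M = H\<^sub>2 \<inter> N\<close>, and let \<open>\<Lambda> \<le> M\<close> be generated by the \<open>H\<^sub>2\<close>-conjugates of the adjoined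
  \<open>t\<^sub>K\<close>. Then \<open>M = (H\<^sub>1 \<inter> N)\<Lambda>\<close> and \<open>Z \<subseteq> \<Lambda>\<close>, so every homomorphism \<open>M \<rightarrow> \<int>\<close> that kills \<open>\<Lambda>\<close> is zero.

  It remains to pass from homology back to groups. The subgroup \<open>M\<close> of the free group \<open>N\<close> is the
  fundamental group of its Schreier graph. The group \<open>G\<close> permutes the stabilisers, so each generator of
  \<open>\<Lambda>\<close> is conjugate in \<open>N\<close> to some \<open>t\<^sub>K\<close> or its inverse, which means that it runs along a path, around a
  loop edge, and back along the same path. Deleting loop edges from a graph leaves a graph,
  hence \<open>M/\<Lambda>\<close> is free; a free group without non-zero homomorphisms to \<open>\<int>\<close> is trivial. So \<open>M = \<Lambda>\<close>
  (\<open>subgroup_eq_if_homs_vanish\<close>), and \<open>M\<close> is normally generated in \<open>H\<^sub>2\<close> by finitely many \<open>t\<^sub>K\<close>.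
\<close>

section \<open>Quotients of finitely presented groups\<close>

lemma normal_closure_normal:
  assumes "group G" "R \<subseteq> carrier G"
  shows "normal_closure G R \<lhd> G" and "R \<subseteq> normal_closure G R"
proof -
  interpret group G by fact
  have c: "carrier G \<lhd> G" by (simp add: normal_inv_iff subgroup_self)
  have "subgroup (normal_closure G R) G"
    unfolding normal_closure_def using c assms(2)
    by (intro subgroups_Inter) (auto dest: normal_imp_subgroup)
  then show "normal_closure G R \<lhd> G"
    unfolding normal_inv_iff by (auto simp: normal_closure_def normal_inv_iff)
qed (auto simp: normal_closure_def)

lemma normal_closure_least: "N \<lhd> G \<Longrightarrow> R \<subseteq> N \<Longrightarrow> normal_closure G R \<subseteq> N"
  by (auto simp: normal_closure_def)

lemma group_free_group: "group (free_group S)"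
  unfolding free_group_def by (rule group_free_product) simp

text \<open>
  If \<open>F\<close> is free with a surjection \<open>p\<close> onto \<open>H\<close>, then the kernel of \<open>f \<circ> p\<close> is the preimage of the kernel
  of \<open>f\<close>. It is normally generated by the relators of \<open>H\<close> together with lifts of \<open>Z\<close>, since the image
  under the surjection \<open>p\<close> of a normal subgroup is normal.
\<close>

lemma finitely_presented_quotient:
  assumes H: "finitely_presented_group H" and Q: "group Q"
    and f: "f \<in> hom H Q" "f ` carrier H = carrier Q"
    and Z: "finite Z" "Z \<subseteq> carrier H" "kernel H Q f = normal_closure H Z"
  shows "finitely_presented_group Q"
proof -
  obtain S :: "nat set" and R where S: "finite S" "finite R" "R \<subseteq> carrier (free_group S)"
    and iso: "H \<cong> free_group S Mod normal_closure (free_group S) R" and "group H"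
    using H by (auto simp: finitely_presented_group_def)
  define F where "F = free_group S"
  interpret F: group F unfolding F_def by (rule group_free_group)
  interpret H: group H by fact
  define C where "C = normal_closure F R"
  have R: "R \<subseteq> carrier F" using S by (simp add: F_def)
  have C: "C \<lhd> F" "R \<subseteq> C" unfolding C_def using normal_closure_normal[OF F.group_axioms R] by auto
  interpret C: normal C F by fact
  have "F Mod C \<cong> H"
    using H.iso_sym iso by (simp add: C_def F_def)
  then obtain \<theta> where \<theta>: "\<theta> \<in> iso (F Mod C) H" by (auto simp: is_iso_def)
  define p where "p = (\<lambda>x. \<theta> (C #>\<^bsub>F\<^esub> x))"
  have p: "p \<in> hom F H"
    using hom_compose[OF C.r_coset_hom_Mod, of \<theta> H] \<theta> by (simp add: p_def iso_def comp_def)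
  have psurj: "p ` carrier F = carrier H"
  proof -
    have "(\<lambda>x. C #>\<^bsub>F\<^esub> x) ` carrier F = carrier (F Mod C)"
      by (auto simp: FactGroup_def RCOSETS_def)
    then show ?thesis using \<theta> by (simp add: p_def iso_def bij_betw_def flip: image_image)
  qed
  have pker: "x \<in> C" if x: "x \<in> carrier F" and "p x = \<one>\<^bsub>H\<^esub>" for x
  proof -
    interpret FM: group "F Mod C" by (rule C.factorgroup_is_group)
    have "\<theta> C = \<one>\<^bsub>H\<^esub>"
      using hom_one[OF _ FM.group_axioms H.group_axioms, of \<theta>] \<theta> by (simp add: iso_def)
    moreover have "C #>\<^bsub>F\<^esub> x \<in> carrier (F Mod C)" "C \<in> carrier (F Mod C)"
      using x FM.one_closed by (auto simp: FactGroup_def RCOSETS_def)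
    ultimately have "C #>\<^bsub>F\<^esub> x = C"
      using that(2) \<theta> by (auto simp: p_def iso_def bij_betw_def inj_on_def)
    then show ?thesis using x C.subgroup_axioms F.coset_join1 by blast
  qed
  obtain R' where R': "R' \<subseteq> carrier F" "finite R'" "p ` R' = Z"
    using finite_subset_image[OF Z(1)] Z(2) psurj by metis
  interpret p: group_hom F H p by (simp add: group_hom_def group_hom_axioms_def p F.group_axioms H.group_axioms)
  define q where "q = f \<circ> p"
  interpret q: group_hom F Q q
    using hom_compose[OF p f(1)] by (simp add: group_hom_def group_hom_axioms_def q_def Q F.group_axioms)
  interpret f: group_hom H Q f using f by (simp add: group_hom_def group_hom_axioms_def Q H.group_axioms)
  have fin: "finite (R \<union> R')" "R \<union> R' \<subseteq> carrier F" using S R' R by auto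
  define D where "D = normal_closure F (R \<union> R')"
  have D: "D \<lhd> F" "R \<union> R' \<subseteq> D" unfolding D_def using normal_closure_normal[OF F.group_axioms fin(2)] by auto
  have D': "subgroup D F" using D(1) by (rule normal_imp_subgroup)
  have "kernel F Q q = D"
  proof
    have "R \<subseteq> kernel F Q q"
    proof
      fix r assume r: "r \<in> R"
      then have "C #>\<^bsub>F\<^esub> r = C #>\<^bsub>F\<^esub> \<one>\<^bsub>F\<^esub>"
        using C(2) R C.subgroup_axioms F.coset_join2 by (metis C.subset F.coset_mult_one subsetD)
      then have "p r = \<one>\<^bsub>H\<^esub>" using p.hom_one by (simp add: p_def)
      then show "r \<in> kernel F Q q" using r R by (auto simp: kernel_def q_def)
    qed
    moreover have "R' \<subseteq> kernel F Q q"
      using R' Z(3) normal_closure_normal(2)[OF H.group_axioms Z(2)] by (auto simp: kernel_def q_def)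
    ultimately show "D \<subseteq> kernel F Q q"
      unfolding D_def by (intro normal_closure_least q.normal_kernel) auto
  next
    have "p ` D \<lhd> H"
      unfolding H.normal_inv_iff
    proof (intro conjI ballI)
      show "subgroup (p ` D) H" using D' by (rule p.subgroup_img_is_subgroup)
    next
      fix x y assume "x \<in> carrier H" "y \<in> p ` D"
      then obtain g d where "g \<in> carrier F" "x = p g" "d \<in> D" "y = p d" using psurj by blast
      moreover from this have "g \<otimes>\<^bsub>F\<^esub> d \<otimes>\<^bsub>F\<^esub> inv\<^bsub>F\<^esub> g \<in> D" "d \<in> carrier F"
        using D(1) D' by (auto simp: F.normal_inv_iff dest: subgroup.mem_carrier)
      ultimately show "x \<otimes>\<^bsub>H\<^esub> y \<otimes>\<^bsub>H\<^esub> inv\<^bsub>H\<^esub> x \<in> p ` D"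
        by (intro image_eqI[where x="g \<otimes>\<^bsub>F\<^esub> d \<otimes>\<^bsub>F\<^esub> inv\<^bsub>F\<^esub> g"]) auto
    qed
    moreover have "Z \<subseteq> p ` D" using R' D(2) by blast
    ultimately have k: "kernel H Q f \<subseteq> p ` D" using Z(3) normal_closure_least by metis
    show "kernel F Q q \<subseteq> D"
    proof
      fix x assume "x \<in> kernel F Q q"
      then have x: "x \<in> carrier F" "p x \<in> kernel H Q f" by (auto simp: kernel_def q_def)
      then obtain d where d: "d \<in> D" "p x = p d" using k by blast
      have dF: "d \<in> carrier F" using d D' by (auto dest: subgroup.subset)
      have "p (x \<otimes>\<^bsub>F\<^esub> inv\<^bsub>F\<^esub> d) = \<one>\<^bsub>H\<^esub>" using d x dF by simp
      then have "x \<otimes>\<^bsub>F\<^esub> inv\<^bsub>F\<^esub> d \<in> C" using pker x dF by simp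
      moreover have "C \<subseteq> D" unfolding C_def using D by (intro normal_closure_least) auto
      ultimately have "(x \<otimes>\<^bsub>F\<^esub> inv\<^bsub>F\<^esub> d) \<otimes>\<^bsub>F\<^esub> d \<in> D" using d D' by (auto intro: subgroup.m_closed)
      then show "x \<in> D" using x dF by (simp add: F.m_assoc)
    qed
  qed
  moreover have "q ` carrier F = carrier Q" using psurj f(2) by (simp add: q_def flip: image_image image_comp)
  ultimately have "F Mod D \<cong> Q" using q.FactGroup_iso by simp
  then have "Q \<cong> F Mod D" using D(1) group.iso_sym normal.factorgroup_is_group by blast
  then show ?thesis
    unfolding finitely_presented_group_def using Q S(1) fin unfolding D_def F_def by blast
qed

section \<open>Universal property of free products\<close>

text \<open>
  The universal property of the free product. Evaluation in \<open>X\<close> turns the reduction rules for a letter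
  that meets a letter of the same factor into the homomorphism property of \<open>f\<close> on that factor.
\<close>

lemma free_product_lift_hom:
  assumes G: "\<And>i. i \<in> I \<Longrightarrow> group (G i)" and X: "group X"
    and f: "\<And>i. i \<in> I \<Longrightarrow> f i \<in> hom (G i) X"
  shows "(\<lambda>w. foldr (\<lambda>(i, a) b. f i a \<otimes>\<^bsub>X\<^esub> b) w \<one>\<^bsub>X\<^esub>) \<in> hom (free_product I G) X"
proof -
  interpret X: group X by fact
  let ?ev = "\<lambda>w. foldr (\<lambda>(i, a) b. f i a \<otimes>\<^bsub>X\<^esub> b) w \<one>\<^bsub>X\<^esub>"
  have rl: "set w \<subseteq> (SIGMA i:I. carrier (G i))" if "w \<in> reduced_words I G" for w
    using that by (auto simp: reduced_words_def)
  have fc: "f i a \<in> carrier X" if "i \<in> I" "a \<in> carrier (G i)" for i a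
    using f that by (auto simp: hom_def)
  have f1: "f i \<one>\<^bsub>G i\<^esub> = \<one>\<^bsub>X\<^esub>" if "i \<in> I" for i
    using hom_one[OF f G X] that by simp
  have cl: "?ev w \<in> carrier X" if "set w \<subseteq> (SIGMA i:I. carrier (G i))" for w
    using that by (induction w) (auto simp: fc)
  have letter: "?ev (letter_mult G (i, a) w) = f i a \<otimes>\<^bsub>X\<^esub> ?ev w"
    if ia: "i \<in> I" "a \<in> carrier (G i)" and w: "set w \<subseteq> (SIGMA i:I. carrier (G i))" for i a w
  proof (cases w)
    case Nil
    then show ?thesis using ia by (auto simp: f1 fc)
  next
    case (Cons l v)
    obtain j b where l: "l = (j, b)" by fastforce
    have jb: "j \<in> I" "b \<in> carrier (G j)" and v: "?ev v \<in> carrier X" using w Cons l cl by auto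
    have "f i (a \<otimes>\<^bsub>G i\<^esub> b) = f i a \<otimes>\<^bsub>X\<^esub> f i b" if "i = j"
      using f[OF ia(1)] ia jb that by (auto simp: hom_def)
    then have "f i a \<otimes>\<^bsub>X\<^esub> (f i b \<otimes>\<^bsub>X\<^esub> ?ev v) = f i (a \<otimes>\<^bsub>G i\<^esub> b) \<otimes>\<^bsub>X\<^esub> ?ev v" if "i = j"
      using that ia jb v by (simp add: X.m_assoc fc)
    then show ?thesis using ia jb v Cons l by (auto simp: f1 fc)
  qed
  have wd: "?ev (foldr (letter_mult G) u v) = ?ev u \<otimes>\<^bsub>X\<^esub> ?ev v"
    if "set u \<subseteq> (SIGMA i:I. carrier (G i))" "v \<in> reduced_words I G" for u v
    using that(1)
  proof (induction u)
    case Nil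
    then show ?case using cl rl[OF that(2)] by simp
  next
    case (Cons l u)
    obtain i a where l: "l = (i, a)" by fastforce
    have "foldr (letter_mult G) u v \<in> reduced_words I G"
      by (rule word_mult_closed[OF G _ that(2)]) (use Cons.prems in auto)
    then have "set (foldr (letter_mult G) u v) \<subseteq> (SIGMA i:I. carrier (G i))" by (rule rl)
    then show ?case using Cons l cl rl[OF that(2)] by (simp add: letter X.m_assoc fc)
  qed
  show ?thesis
    using cl wd rl by (auto simp: hom_def free_product_def Pi_def)
qed

lemma internal_free_product_extend:
  assumes G: "group G" and N: "internal_free_product G T N" and X: "group X"
    and f: "\<And>K. K \<in> T \<Longrightarrow> f K \<in> hom (G\<lparr>carrier := K\<rparr>) X"
  obtains \<rho> where "\<rho> \<in> hom (G\<lparr>carrier := N\<rparr>) X"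
    and "\<And>K a. K \<in> T \<Longrightarrow> a \<in> K \<Longrightarrow> \<rho> a = f K a"
proof -
  interpret G: group G by fact
  interpret X: group X by fact
  let ?P = "free_product T (\<lambda>K. G\<lparr>carrier := K\<rparr>)"
  let ?\<Theta> = "\<lambda>w. foldr (\<lambda>(K, a) b. a \<otimes>\<^bsub>G\<^esub> b) w \<one>\<^bsub>G\<^esub>"
  let ?ev = "\<lambda>w. foldr (\<lambda>(K, a) b. f K a \<otimes>\<^bsub>X\<^esub> b) w \<one>\<^bsub>X\<^esub>"
  have K: "\<And>K. K \<in> T \<Longrightarrow> subgroup K G" and iso: "?\<Theta> \<in> iso ?P (G\<lparr>carrier := N\<rparr>)"
    using N by (auto simp: internal_free_product_def)
  have gK: "\<And>K. K \<in> T \<Longrightarrow> group (G\<lparr>carrier := K\<rparr>)" using K G.subgroup_imp_group by blast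
  interpret P: group ?P by (rule group_free_product) (rule gK)
  have ev: "?ev \<in> hom ?P X" by (rule free_product_lift_hom[OF gK X f])
  define \<rho> where "\<rho> = ?ev \<circ> inv_into (carrier ?P) ?\<Theta>"
  have "\<rho> \<in> hom (G\<lparr>carrier := N\<rparr>) X"
    unfolding \<rho>_def using P.iso_set_sym[OF iso] ev by (intro hom_compose) (auto simp: iso_def)
  moreover have "\<rho> a = f K a" if KT: "K \<in> T" and a: "a \<in> K" for K a
  proof -
    define w where "w = (if a = \<one>\<^bsub>G\<^esub> then [] else [(K, a)])"
    have w: "w \<in> carrier ?P"
      using that by (auto simp: w_def free_product_def reduced_words_Cons reduced_words_Nil)
    have "?\<Theta> w = a" using subgroup.mem_carrier[OF K[OF KT] a] by (auto simp: w_def)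
    then have "inv_into (carrier ?P) ?\<Theta> a = w"
      using inv_into_f_f[of ?\<Theta> "carrier ?P" w] w iso by (auto simp: iso_def bij_betw_def)
    moreover have "?ev w = f K a"
    proof (cases "a = \<one>\<^bsub>G\<^esub>")
      case True
      then show ?thesis using hom_one[OF f[OF KT] gK[OF KT] X] by (simp add: w_def)
    next
      case False
      have "f K a \<in> carrier X" using f[OF KT] a by (auto simp: hom_def)
      then show ?thesis using False by (simp add: w_def)
    qed
    ultimately show ?thesis by (simp add: \<rho>_def)
  qed
  ultimately show thesis by (rule that)
qed

lemma internal_free_product_generated:
  assumes "group G" and N: "internal_free_product G T N"
  shows "N = generate G (\<Union>T)" and "\<Union>T \<subseteq> N"
proof -
  interpret group G by fact
  let ?P = "free_product T (\<lambda>K. G\<lparr>carrier := K\<rparr>)"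
  let ?\<Theta> = "\<lambda>w. foldr (\<lambda>(K, a) b. a \<otimes>\<^bsub>G\<^esub> b) w \<one>\<^bsub>G\<^esub>"
  have K: "\<And>K. K \<in> T \<Longrightarrow> subgroup K G" and sN: "subgroup N G" and im: "?\<Theta> ` carrier ?P = N"
    using N by (auto simp: internal_free_product_def iso_def bij_betw_def)
  show TN: "\<Union>T \<subseteq> N"
  proof
    fix a assume "a \<in> \<Union>T"
    then obtain K where KT: "K \<in> T" "a \<in> K" by blast
    have "a \<in> carrier G" using subgroup.mem_carrier[OF K] KT by blast
    define w where "w = (if a = \<one>\<^bsub>G\<^esub> then [] else [(K, a)])"
    have "?\<Theta> w = a" using \<open>a \<in> carrier G\<close> by (simp add: w_def)
    moreover have "w \<in> carrier ?P"
      using KT by (auto simp: w_def free_product_def reduced_words_Cons reduced_words_Nil)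
    then have "?\<Theta> w \<in> N" unfolding im[symmetric] by (rule imageI)
    ultimately show "a \<in> N" by simp
  qed
  have "?\<Theta> w \<in> generate G (\<Union>T)" if "set w \<subseteq> (SIGMA K:T. K)" for w
    using that by (induction w) (auto intro: generate.intros)
  moreover have "set w \<subseteq> (SIGMA K:T. K)" if "w \<in> carrier ?P" for w
    using that by (auto simp: free_product_def reduced_words_def)
  ultimately have "?\<Theta> ` carrier ?P \<subseteq> generate G (\<Union>T)" by (intro image_subsetI) simp
  then have "N \<subseteq> generate G (\<Union>T)" by (simp only: im)
  then show "N = generate G (\<Union>T)" using generate_subgroup_incl[OF TN sN] by blast
qed

section \<open>Groups that are free on generators of cyclic factors\<close>

text \<open>
  If two different exponents gave the same power, then the powers would be periodic in the exponent and
  hence finite in number.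
\<close>

lemma (in group) infinite_cyclic_powers_inject:
  assumes "x \<in> carrier G" "infinite (range (\<lambda>n::int. x [^] n))" "x [^] i = x [^] (j::int)"
  shows "i = j"
proof (rule ccontr)
  assume "i \<noteq> j"
  define d where "d = \<bar>i - j\<bar>"
  have d: "d > 0" using \<open>i \<noteq> j\<close> by (simp add: d_def)
  have "x [^] (i - j) = \<one>" "x [^] (j - i) = \<one>"
    using assms by (simp_all add: int_pow_diff)
  then have xd: "x [^] d = \<one>" by (cases "i \<ge> j") (auto simp: d_def)
  have "x [^] n \<in> (\<lambda>n. x [^] n) ` {0..<d}" for n :: int
  proof -
    have "x [^] n = x [^] (d * (n div d) + n mod d)" by simp
    also have "\<dots> = x [^] (d * (n div d)) \<otimes> x [^] (n mod d)" using assms by (subst int_pow_mult) auto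
    also have "x [^] (d * (n div d)) = \<one>" using assms xd by (simp flip: int_pow_pow)
    finally have "x [^] n = x [^] (n mod d)" using assms by simp
    then show ?thesis using d by auto
  qed
  then have "range (\<lambda>n::int. x [^] n) \<subseteq> (\<lambda>n. x [^] n) ` {0..<d}" by auto
  then show False using assms(2) finite_subset by blast
qed

lemma BijGroup_UNIV:
  "carrier (BijGroup UNIV) = {f. bij f}" "\<one>\<^bsub>BijGroup UNIV\<^esub> = id"
  "bij f \<Longrightarrow> bij g \<Longrightarrow> f \<otimes>\<^bsub>BijGroup UNIV\<^esub> g = f \<circ> g"
  by (auto simp: BijGroup_def Bij_def compose_def fun_eq_iff)

text \<open>
  The group \<open>N\<close> is free on the elements \<open>t K\<close>; the basis is indexed by the infinite cyclic free factors
  that its members generate.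
\<close>

locale free_on_generators = group G for G (structure) +
  fixes T :: "'a set set" and N :: "'a set" and t :: "'a set \<Rightarrow> 'a"
  assumes internal: "internal_free_product G T N"
    and powers: "\<And>K. K \<in> T \<Longrightarrow> range (\<lambda>n::int. t K [^] n) = K"
    and infinite_factors: "\<And>K. K \<in> T \<Longrightarrow> infinite K"
    and gen_carrier: "\<And>K. K \<in> T \<Longrightarrow> t K \<in> carrier G"
begin

lemma subgroup_factor: "K \<in> T \<Longrightarrow> subgroup K G" and subgroup_N: "subgroup N G"
  using internal by (auto simp: internal_free_product_def)

lemma gen_factor: "K \<in> T \<Longrightarrow> t K \<in> K"
  using rangeI[of "\<lambda>n::int. t K [^] n" 1] powers[of K] gen_carrier[of K] by simp

lemma factor_power: assumes "K \<in> T" "a \<in> K" obtains i :: int where "a = t K [^] i"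
proof -
  have "a \<in> range (\<lambda>n::int. t K [^] n)" using assms powers by simp
  then show thesis using that by blast
qed

lemma gen_N: "K \<in> T \<Longrightarrow> t K \<in> N"
  using gen_factor internal_free_product_generated(2)[OF group_axioms internal] by blast

lemma N_carrier: "x \<in> N \<Longrightarrow> x \<in> carrier G"
  using subgroup.mem_carrier[OF subgroup_N] .

lemma N_closed [simp]: "x \<in> N \<Longrightarrow> y \<in> N \<Longrightarrow> x \<otimes> y \<in> N" "x \<in> N \<Longrightarrow> inv x \<in> N" "\<one> \<in> N"
  using subgroup_N by (auto simp: subgroup_def)

lemma subset_if_gens:
  assumes S: "subgroup S G" and "\<And>K. K \<in> T \<Longrightarrow> t K \<in> S"
  shows "N \<subseteq> S"
proof -
  have "K \<subseteq> S" if "K \<in> T" for K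
  proof
    fix a assume "a \<in> K"
    then obtain i :: int where "a = t K [^] i" using factor_power \<open>K \<in> T\<close> by blast
    then show "a \<in> S" using assms(2)[OF that] subgroup_int_pow_closed[OF S] by simp
  qed
  then have "generate G (\<Union>T) \<subseteq> S" using S by (intro generate_subgroup_incl) auto
  then show ?thesis using internal_free_product_generated(1)[OF group_axioms internal] by simp
qed

lemma hom_extend:
  assumes X: "group X" and g: "\<And>K. K \<in> T \<Longrightarrow> g K \<in> carrier X"
  obtains \<rho> where "\<rho> \<in> hom (G\<lparr>carrier := N\<rparr>) X" and "\<And>K. K \<in> T \<Longrightarrow> \<rho> (t K) = g K"
proof -
  interpret X: group X by fact
  define e where "e K a = (THE j. t K [^] (j::int) = a)" for K a
  have e: "e K (t K [^] j) = j" if "K \<in> T" for K j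
  proof -
    have "infinite (range (\<lambda>n::int. t K [^] n))" using powers infinite_factors that by simp
    then show ?thesis
      unfolding e_def using infinite_cyclic_powers_inject[OF gen_carrier[OF that]] by blast
  qed
  have "(\<lambda>a. g K [^]\<^bsub>X\<^esub> e K a) \<in> hom (G\<lparr>carrier := K\<rparr>) X" if K: "K \<in> T" for K
  proof (rule homI)
    fix a c assume "a \<in> carrier (G\<lparr>carrier := K\<rparr>)" "c \<in> carrier (G\<lparr>carrier := K\<rparr>)"
    then have "a \<in> K" "c \<in> K" by simp_all
    then obtain i j :: int where ij: "a = t K [^] i" "c = t K [^] j"
      using factor_power[OF K, of a thesis] factor_power[OF K, of c thesis] by blast
    have "a \<otimes> c = t K [^] (i + j)" using ij gen_carrier[OF K] by (simp add: int_pow_mult)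
    then show "g K [^]\<^bsub>X\<^esub> e K (a \<otimes>\<^bsub>G\<lparr>carrier := K\<rparr>\<^esub> c) = g K [^]\<^bsub>X\<^esub> e K a \<otimes>\<^bsub>X\<^esub> g K [^]\<^bsub>X\<^esub> e K c"
      using e[OF K] g[OF K] ij by (simp add: X.int_pow_mult)
  qed (use g[OF K] in auto)
  then obtain \<rho> where \<rho>: "\<rho> \<in> hom (G\<lparr>carrier := N\<rparr>) X"
    and "\<And>K a. K \<in> T \<Longrightarrow> a \<in> K \<Longrightarrow> \<rho> a = g K [^]\<^bsub>X\<^esub> e K a"
    using internal_free_product_extend[OF group_axioms internal X, where f="\<lambda>K a. g K [^]\<^bsub>X\<^esub> e K a"] by blast
  then have "\<rho> (t K) = g K" if "K \<in> T" for K
    using that e[OF that, of 1] g[OF that] gen_carrier[OF that] gen_factor[OF that] by simp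
  with \<rho> show thesis by (rule that)
qed

text \<open>
  A derivation \<open>b\<close> of the free group \<open>N\<close> with values in the integer functions on \<open>N\<close> (an integral Fox
  derivative) may be given arbitrary values on the basis. Derivations correspond to actions of \<open>N\<close> on
  \<open>\<int> \<times> N\<close> that commute with the shifts of \<open>\<int>\<close> and cover the translation action on \<open>N\<close>, and an action of
  a free group is prescribed by bijections \<open>\<beta>\<close>, one for each basis element.
\<close>

lemma crossed_hom_exists:
  fixes e :: "'a set \<Rightarrow> 'a \<Rightarrow> int"
  obtains b :: "'a \<Rightarrow> 'a \<Rightarrow> int"
  where "\<And>x n n'. x \<in> N \<Longrightarrow> n \<in> N \<Longrightarrow> n' \<in> N \<Longrightarrow> b x (n \<otimes> n') = b x n + b (x \<otimes> n) n'"
    and "\<And>x K. x \<in> N \<Longrightarrow> K \<in> T \<Longrightarrow> b x (t K) = e K x"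
proof -
  (* The group acts from the left, so n translates N by inv n on the right, and b x n is read off
     the action of inv n. Points outside of N are fixed, which makes these maps bijections of the whole type. *)
  define \<beta> where "\<beta> K = (\<lambda>(k::int, x). if x \<in> N then (k - e K (x \<otimes> inv t K), x \<otimes> inv t K) else (k, x))" for K
  define \<gamma> where "\<gamma> K = (\<lambda>(k::int, x). if x \<in> N then (k + e K x, x \<otimes> t K) else (k, x))" for K
  have bij: "bij (\<beta> K)" if K: "K \<in> T" for K
  proof (rule o_bij)
    show "\<gamma> K \<circ> \<beta> K = id" "\<beta> K \<circ> \<gamma> K = id"
      using gen_N[OF K] by (auto simp: \<beta>_def \<gamma>_def fun_eq_iff m_assoc N_carrier)
  qed
  obtain \<rho> where \<rho>: "\<rho> \<in> hom (G\<lparr>carrier := N\<rparr>) (BijGroup UNIV)" and \<rho>t: "\<And>K. K \<in> T \<Longrightarrow> \<rho> (t K) = \<beta> K"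
    by (rule hom_extend[OF group_BijGroup, of \<beta>]) (use bij in \<open>auto simp: BijGroup_UNIV\<close>)
  interpret NN: group "G\<lparr>carrier := N\<rparr>" using subgroup_N by (rule subgroup_imp_group)
  have bij\<rho>: "bij (\<rho> n)" if "n \<in> N" for n
    using \<rho> that by (auto simp: hom_def BijGroup_UNIV)
  have mult: "\<rho> (n \<otimes> n') p = \<rho> n (\<rho> n' p)" if "n \<in> N" "n' \<in> N" for n n' p
    using \<rho> that by (simp add: hom_def BijGroup_UNIV bij\<rho>)
  have one: "\<rho> \<one> = id"
    using hom_one[OF \<rho> NN.group_axioms group_BijGroup] by (simp add: BijGroup_UNIV)
  define shift where "shift n c \<longleftrightarrow> (\<forall>k. \<forall>x\<in>N. \<rho> n (k, x) = (k + c x, x \<otimes> inv n))" for n and c :: "'a \<Rightarrow> int"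
  have shift_inv: "shift (inv n) (\<lambda>x. - c (x \<otimes> n))" if n: "n \<in> N" and c: "shift n c" for n c
    unfolding shift_def
  proof (intro allI ballI)
    fix k x assume x: "x \<in> N"
    have "\<rho> n (k - c (x \<otimes> n), x \<otimes> n) = (k, x)"
      using c x n by (simp add: shift_def m_assoc N_carrier)
    then have "\<rho> (inv n) (k, x) = \<rho> (inv n) (\<rho> n (k - c (x \<otimes> n), x \<otimes> n))" by simp
    also have "\<dots> = (k - c (x \<otimes> n), x \<otimes> n)"
      using n by (simp flip: mult add: N_carrier one)
    finally show "\<rho> (inv n) (k, x) = (k + - c (x \<otimes> n), x \<otimes> inv (inv n))"
      using n by (simp add: N_carrier)
  qed
  have shift_gen: "shift (t K) (\<lambda>x. - e K (x \<otimes> inv t K))" if "K \<in> T" for K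
    using that by (simp add: shift_def \<rho>t \<beta>_def)
  have "subgroup {n \<in> N. \<exists>c. shift n c} G"
  proof
    show "{n \<in> N. \<exists>c. shift n c} \<subseteq> carrier G" using N_carrier by auto
    have "shift \<one> (\<lambda>_. 0)" by (simp add: shift_def one N_carrier)
    then show "\<one> \<in> {n \<in> N. \<exists>c. shift n c}" by auto
  next
    fix n n' assume "n \<in> {n \<in> N. \<exists>c. shift n c}" "n' \<in> {n \<in> N. \<exists>c. shift n c}"
    then obtain c c' where n: "n \<in> N" "n' \<in> N" and "shift n c" "shift n' c'" by auto
    then have "shift (n \<otimes> n') (\<lambda>x. c' x + c (x \<otimes> inv n'))"
      by (simp add: shift_def mult N_carrier inv_mult_group m_assoc)
    then show "n \<otimes> n' \<in> {n \<in> N. \<exists>c. shift n c}" using n by auto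
  qed (use shift_inv in auto)
  then have "N \<subseteq> {n \<in> N. \<exists>c. shift n c}"
    by (rule subset_if_gens) (use shift_gen gen_N in auto)
  then obtain c where c: "\<And>n. n \<in> N \<Longrightarrow> shift n (c n)" by (auto simp: subset_iff) metis
  define b where "b x n = c (inv n) x" for x n
  show thesis
  proof (rule that[of b])
    fix x n n' assume *: "x \<in> N" "n \<in> N" "n' \<in> N"
    then have "\<rho> (inv n' \<otimes> inv n) (0, x) = (c (inv n) x + c (inv n') (x \<otimes> n), x \<otimes> n \<otimes> n')"
      using c[of "inv n"] c[of "inv n'"] by (simp add: shift_def mult N_carrier)
    moreover have "\<rho> (inv (n \<otimes> n')) (0, x) = (c (inv (n \<otimes> n')) x, x \<otimes> (n \<otimes> n'))"
      using * c[of "inv (n \<otimes> n')"] by (simp add: shift_def N_carrier)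
    ultimately show "b x (n \<otimes> n') = b x n + b (x \<otimes> n) n'"
      using * by (simp add: b_def inv_mult_group N_carrier)
  next
    fix x K assume *: "x \<in> N" "K \<in> T"
    have "\<rho> (inv t K) (0, x) = (e K (x \<otimes> t K \<otimes> inv t K), x \<otimes> t K)"
      using shift_inv[OF gen_N[OF *(2)] shift_gen[OF *(2)]] * gen_N[OF *(2)] by (simp add: shift_def N_carrier)
    then show "b x (t K) = e K x"
      using * c[of "inv t K"] gen_N[OF *(2)] by (simp add: shift_def b_def m_assoc N_carrier)
  qed
qed

definition letters :: "'a set" where "letters = t ` T \<union> (\<lambda>K. inv t K) ` T"

lemma letters_N: "l \<in> letters \<Longrightarrow> l \<in> N"
  using gen_N by (auto simp: letters_def)

lemma letters_inv: "l \<in> letters \<Longrightarrow> inv l \<in> letters"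
  using gen_carrier by (auto simp: letters_def)

definition word :: "'a list \<Rightarrow> 'a" where "word w = foldr (\<otimes>) w \<one>"

lemma word_simps [simp]: "word [] = \<one>" "word (l # w) = l \<otimes> word w"
  by (auto simp: word_def)

lemma word_N [simp]: "w \<in> lists letters \<Longrightarrow> word w \<in> N"
  by (induction w) (auto simp: letters_N)

lemma word_append: "v \<in> lists letters \<Longrightarrow> w \<in> lists letters \<Longrightarrow> word (v @ w) = word v \<otimes> word w"
  by (induction v) (auto simp: m_assoc letters_N N_carrier)

lemma ex_word:
  assumes "n \<in> N" obtains w where "w \<in> lists letters" "n = word w"
proof -
  have inverse: "\<exists>v \<in> lists letters. word v = inv word w" if "w \<in> lists letters" for w
    using that
  proof (induction w)
    case (Cons l w)
    then obtain v where "v \<in> lists letters" "word v = inv word w" by auto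
    then show ?case using Cons.hyps
      by (intro bexI[of _ "v @ [inv l]"])
        (auto simp: word_append letters_inv inv_mult_group letters_N N_carrier)
  qed (auto intro: bexI[of _ "[]"])
  have "subgroup (word ` lists letters) G"
  proof
    show "word ` lists letters \<subseteq> carrier G" using word_N N_carrier by blast
    show "\<one> \<in> word ` lists letters" by (rule image_eqI[of _ _ "[]"]) auto
  next
    fix x y assume "x \<in> word ` lists letters" "y \<in> word ` lists letters"
    then obtain v w where "v \<in> lists letters" "w \<in> lists letters" "x = word v" "y = word w" by blast
    then show "x \<otimes> y \<in> word ` lists letters"
      by (intro image_eqI[of _ _ "v @ w"]) (simp_all add: word_append)
  next
    fix x assume "x \<in> word ` lists letters"
    then show "inv x \<in> word ` lists letters" using inverse by force
  qed
  then have "N \<subseteq> word ` lists letters"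
  proof (rule subset_if_gens)
    fix K assume "K \<in> T"
    then show "t K \<in> word ` lists letters"
      by (intro image_eqI[of _ _ "[t K]"]) (auto simp: letters_def gen_carrier)
  qed
  then show thesis using assms that by auto
qed

lemma gen_neq_inv_gen:
  assumes "K \<in> T" "K' \<in> T"
  shows "t K \<noteq> inv t K'" and "inv t K \<noteq> t K'"
proof -
  have inj: "t K [^] i = t K [^] j \<Longrightarrow> i = j" if "K \<in> T" for K and i j :: int
    using infinite_cyclic_powers_inject[OF gen_carrier[OF that]] powers[OF that] infinite_factors[OF that] by simp
  have "t K \<noteq> inv t K'" if KK: "K \<in> T" "K' \<in> T" for K K'
  proof
    assume eq: "t K = inv t K'"
    have "t K [^] i = t K' [^] (- i)" for i :: int
      using eq gen_carrier[OF KK(2)] by (simp add: int_pow_inv int_pow_neg)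
    then have "range (\<lambda>i::int. t K [^] i) \<subseteq> range (\<lambda>i::int. t K' [^] i)" by auto
    moreover have "t K' [^] i = t K [^] (- i)" for i :: int
      using eq gen_carrier[OF KK(2)] by (simp add: int_pow_inv int_pow_neg)
    then have "range (\<lambda>i::int. t K' [^] i) \<subseteq> range (\<lambda>i::int. t K [^] i)" by auto
    ultimately have "K = K'" using powers KK by auto
    then have "t K [^] (1::int) = t K [^] (-1::int)"
      using eq gen_carrier[OF KK(2)] by (simp add: int_pow_neg)
    then show False using inj[OF KK(1)] by fastforce
  qed
  then show "t K \<noteq> inv t K'" "inv t K \<noteq> t K'" using assms by metis+
qed

text \<open>
  The Schreier graph of \<open>M\<close> has the right cosets \<open>Mx\<close> as vertices, and each letter \<open>l\<close> labels an edge from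
  \<open>Mx\<close> to \<open>Mxl\<close>, whose reverse is labelled \<open>inv l\<close>. An element \<open>n\<close> spells a path from \<open>Mx\<close>, and \<open>b x n\<close>
  counts, with sign, how often this path runs through the edge with label \<open>l\<close> that starts at \<open>Mu\<close>.
  This count is additive along paths, so it is a derivation.
\<close>

lemma edge_counting:
  assumes M: "subgroup M G" "M \<subseteq> N" and l: "l \<in> letters" and u: "u \<in> N"
  obtains b :: "'a \<Rightarrow> 'a \<Rightarrow> int"
  where "\<And>x n n'. x \<in> N \<Longrightarrow> n \<in> N \<Longrightarrow> n' \<in> N \<Longrightarrow> b x (n \<otimes> n') = b x n + b (x \<otimes> n) n'"
    and "\<And>m x n. m \<in> M \<Longrightarrow> x \<in> N \<Longrightarrow> n \<in> N \<Longrightarrow> b (m \<otimes> x) n = b x n"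
    and "\<And>x l'. x \<in> N \<Longrightarrow> l' \<in> letters \<Longrightarrow> b x l' =
           of_bool (x \<otimes> inv u \<in> M \<and> l' = l) - of_bool (x \<otimes> inv (u \<otimes> l) \<in> M \<and> l' = inv l)"
proof -
  have lN: "l \<in> N" using l by (rule letters_N)
  define e :: "'a set \<Rightarrow> 'a \<Rightarrow> int" where "e K x =
    of_bool (x \<otimes> inv u \<in> M \<and> t K = l) - of_bool (x \<otimes> inv (u \<otimes> l) \<in> M \<and> t K = inv l)" for K x
  obtain b where b: "\<And>x n n'. x \<in> N \<Longrightarrow> n \<in> N \<Longrightarrow> n' \<in> N \<Longrightarrow> b x (n \<otimes> n') = b x n + b (x \<otimes> n) n'"
    and bt: "\<And>x K. x \<in> N \<Longrightarrow> K \<in> T \<Longrightarrow> b x (t K) = e K x"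
    by (rule crossed_hom_exists[of e]) blast
  have b1: "b x \<one> = 0" if "x \<in> N" for x using b[OF that, of \<one> \<one>] that by (simp add: N_carrier)
  have binv: "b x (inv n) = - b (x \<otimes> inv n) n" if "x \<in> N" "n \<in> N" for x n
    using b[OF that(1), of "inv n" n] that b1 by (simp add: N_carrier)
  have Mm: "m \<otimes> x \<otimes> y \<in> M \<longleftrightarrow> x \<otimes> y \<in> M" if "m \<in> M" "x \<in> N" "y \<in> N" for m x y
  proof -
    have "m \<in> carrier G" using subgroup.mem_carrier[OF M(1)] that by blast
    moreover have "inv m \<in> M" using M(1) that by (simp add: subgroup.m_inv_closed)
    moreover have "x \<otimes> y = inv m \<otimes> (m \<otimes> (x \<otimes> y))"
      using calculation that by (simp add: m_assoc[symmetric] N_carrier)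
    ultimately show ?thesis using that M(1) by (metis N_carrier m_assoc subgroup.m_closed)
  qed
  have bM: "b (m \<otimes> x) n = b x n" if m: "m \<in> M" and x: "x \<in> N" and n: "n \<in> N" for m x n
  proof -
    have mN: "m \<in> N" using m M by blast
    define S where "S = {n \<in> N. \<forall>x \<in> N. b (m \<otimes> x) n = b x n}"
    have "subgroup S G"
    proof
      show "S \<subseteq> carrier G" by (auto simp: S_def N_carrier)
      show "\<one> \<in> S" using mN by (simp add: S_def b1)
    next
      fix n n' assume "n \<in> S" "n' \<in> S"
      then show "n \<otimes> n' \<in> S" using mN by (simp add: S_def b m_assoc N_carrier)
    next
      fix n assume "n \<in> S"
      then show "inv n \<in> S" using mN by (simp add: S_def binv m_assoc N_carrier)
    qed
    moreover have "t K \<in> S" if "K \<in> T" for K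
      using that gen_N[OF that] mN m u lN by (simp add: S_def bt e_def Mm)
    ultimately have "N \<subseteq> S" by (rule subset_if_gens)
    then show ?thesis using x n by (auto simp: S_def)
  qed
  have "b x l' = of_bool (x \<otimes> inv u \<in> M \<and> l' = l) - of_bool (x \<otimes> inv (u \<otimes> l) \<in> M \<and> l' = inv l)"
    if x: "x \<in> N" and l': "l' \<in> letters" for x l'
  proof -
    consider K where "K \<in> T" "l' = t K" | K where "K \<in> T" "l' = inv t K"
      using l' by (auto simp: letters_def)
    then show ?thesis
    proof cases
      case 1
      then show ?thesis using x by (simp add: bt e_def)
    next
      case 2
      note tN = gen_N[OF 2(1)]
      have "inv (t K) = l \<longleftrightarrow> t K = inv l" "inv (t K) = inv l \<longleftrightarrow> t K = l"
        using tN lN by (auto simp: N_carrier)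
      moreover have "x \<otimes> l \<otimes> inv (u \<otimes> l) = x \<otimes> inv u" "x \<otimes> inv l \<otimes> inv u = x \<otimes> inv (u \<otimes> l)"
        using x lN u by (simp_all add: inv_mult_group m_assoc N_carrier)
           (simp add: m_assoc[symmetric] N_carrier)
      ultimately show ?thesis
        using x 2 tN by (auto simp: bt binv e_def)
    qed
  qed
  then show thesis using that b bM by blast
qed

end

section \<open>Subgroups generated by loops of a Schreier graph\<close>

context free_on_generators
begin

text \<open>
  Elements of \<open>M\<close> are the closed paths at the base point of the Schreier graph of \<open>M\<close>, and the elements of
  \<open>L\<close> are those that travel to a loop edge, go around it once, and return. If \<open>M\<close> were larger than
  \<open>\<Lambda>\<close>, then a shortest closed path \<open>w\<close>, at any vertex, that lies outside of \<open>\<Lambda>\<close> would be a simple cycle: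
  a proper closed subpath is shorter, so it lies in \<open>\<Lambda>\<close> and can be cut out. A simple cycle passes exactly
  once through its first edge, and this edge is not one of the loops from \<open>L\<close>. Counting passages through it
  is thus a non-zero homomorphism \<open>M \<rightarrow> \<int>\<close> that kills \<open>L\<close>.
\<close>

lemma subgroup_eq_if_homs_vanish:
  assumes M: "subgroup M G" "M \<subseteq> N"
    and \<Lambda>: "subgroup \<Lambda> G" "\<Lambda> \<subseteq> M" "\<And>m a. m \<in> M \<Longrightarrow> a \<in> \<Lambda> \<Longrightarrow> m \<otimes> a \<otimes> inv m \<in> \<Lambda>"
    and L: "\<Lambda> = generate G L" "\<And>a. a \<in> L \<Longrightarrow> \<exists>x\<in>N. \<exists>l\<in>letters. a = x \<otimes> l \<otimes> inv x"
    and vanish: "\<And>(\<chi> :: 'a \<Rightarrow> int) m. (\<And>x y. x \<in> M \<Longrightarrow> y \<in> M \<Longrightarrow> \<chi> (x \<otimes> y) = \<chi> x + \<chi> y) \<Longrightarrow>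
        (\<And>a. a \<in> L \<Longrightarrow> \<chi> a = 0) \<Longrightarrow> m \<in> M \<Longrightarrow> \<chi> m = 0"
  shows "M = \<Lambda>"
proof (rule ccontr)
  assume "M \<noteq> \<Lambda>"
  (* The vertex M u, at which the closed path w is based, varies along with w; minimality over all
     base points makes closed subpaths comparable with w. *)
  define bad where "bad u w \<longleftrightarrow> u \<in> N \<and> w \<in> lists letters \<and> u \<otimes> word w \<otimes> inv u \<in> M \<and> u \<otimes> word w \<otimes> inv u \<notin> \<Lambda>" for u w
  obtain m where m: "m \<in> M" "m \<notin> \<Lambda>" using \<open>M \<noteq> \<Lambda>\<close> \<Lambda>(2) by blast
  obtain w0 where "w0 \<in> lists letters" "m = word w0" using ex_word m M(2) by blast
  then have "bad \<one> w0" using m by (simp add: bad_def N_carrier)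
  then have "\<exists>u. bad u w0" by blast
  then obtain w where "\<exists>u. bad u w" and min: "\<And>v. \<exists>u. bad u v \<Longrightarrow> length w \<le> length v"
    using ex_has_least_nat[of "\<lambda>w. \<exists>u. bad u w" w0 length] by blast
  then obtain u where bad: "bad u w" by blast
  have short: "x \<otimes> word v \<otimes> inv x \<in> \<Lambda>"
    if "x \<in> N" "v \<in> lists letters" "x \<otimes> word v \<otimes> inv x \<in> M" "length v < length w" for x v
    using min[of v] that unfolding bad_def by (meson not_le)
  have u: "u \<in> N" and w: "w \<in> lists letters"
    and wM: "u \<otimes> word w \<otimes> inv u \<in> M" and w\<Lambda>: "u \<otimes> word w \<otimes> inv u \<notin> \<Lambda>"
    using bad by (auto simp: bad_def)
  have tw: "take j w \<in> lists letters" "drop j w \<in> lists letters" for j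
    using w by (auto dest: in_set_takeD in_set_dropD)
  define V where "V j = u \<otimes> word (take j w)" for j
  have V: "V j \<in> N" for j using u tw by (simp add: V_def)
  have \<Lambda>inv: "inv a \<in> \<Lambda>" if "a \<in> \<Lambda>" for a using \<Lambda>(1) that by (rule subgroup.m_inv_closed)
  (* The vertices of w are the cosets of V 0, V 1, ...; two of them coincide only if they are
     the first and the last one. *)
  have simple: False if ij: "i < j" "j \<le> length w" "\<not> (i = 0 \<and> j = length w)" and VV: "V j \<otimes> inv V i \<in> M" for i j
  proof -
    define v where "v = drop i (take j w)"
    have v: "v \<in> lists letters" using tw(1) by (auto simp: v_def dest: in_set_dropD)
    have "take i (take j w) = take i w" using ij by simp
    then have "take j w = take i w @ v" unfolding v_def by (metis append_take_drop_id)
    then have Vj: "V j = V i \<otimes> word v"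
      using u v tw by (simp add: V_def word_append m_assoc N_carrier)
    have "V i \<otimes> word v \<otimes> inv V i \<in> \<Lambda>"
      using VV V v ij by (intro short) (auto simp: Vj v_def)
    then have a: "V j \<otimes> inv V i \<in> \<Lambda>" by (simp add: Vj)
    define w' where "w' = take i w @ drop j w"
    have w': "w' \<in> lists letters" using tw by (simp add: w'_def)
    have "word w = word (take j w) \<otimes> word (drop j w)" using tw by (simp flip: word_append)
    then have "u \<otimes> word w \<otimes> inv u = V j \<otimes> word (drop j w) \<otimes> inv u"
      using u tw by (simp add: V_def m_assoc N_carrier)
    moreover have "u \<otimes> word w' \<otimes> inv u = V i \<otimes> word (drop j w) \<otimes> inv u"
      using u tw by (simp add: w'_def V_def word_append m_assoc N_carrier)
    moreover have "V j \<otimes> inv V i \<otimes> (V i \<otimes> word (drop j w) \<otimes> inv u) = V j \<otimes> word (drop j w) \<otimes> inv u"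
    proof -
      have "V j \<in> carrier G" "V i \<in> carrier G" "word (drop j w) \<in> carrier G" "u \<in> carrier G"
        using V u tw by (simp_all add: N_carrier)
      then show ?thesis by (simp add: m_assoc inv_solve_left')
    qed
    ultimately have eq: "u \<otimes> word w \<otimes> inv u = (V j \<otimes> inv V i) \<otimes> (u \<otimes> word w' \<otimes> inv u)" by simp
    then have "u \<otimes> word w' \<otimes> inv u = inv (V j \<otimes> inv V i) \<otimes> (u \<otimes> word w \<otimes> inv u)"
      using V u w' by (intro inv_solve_left[THEN iffD2]) (simp_all add: N_carrier)
    then have "u \<otimes> word w' \<otimes> inv u \<in> M"
      using \<Lambda>inv[OF a] \<Lambda>(2) M(1) wM by (auto intro: subgroup.m_closed)
    then have "u \<otimes> word w' \<otimes> inv u \<in> \<Lambda>" using u w' ij by (intro short) (auto simp: w'_def)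
    then show False using w\<Lambda> eq a \<Lambda>(1) by (auto intro: subgroup.m_closed)
  qed
  have "w \<noteq> []" using w\<Lambda> \<Lambda>(1) u by (auto simp: N_carrier subgroup.one_closed)
  define l where "l = w ! 0"
  have wl: "w ! j \<in> letters" if "j < length w" for j using w that nth_mem by blast
  have l: "l \<in> letters" using wl[of 0] \<open>w \<noteq> []\<close> by (simp add: l_def)
  have lN: "l \<in> N" using l by (rule letters_N)
  have V0: "V 0 = u" "V 1 = u \<otimes> l" "V (length w) = u \<otimes> word w"
    using u \<open>w \<noteq> []\<close> lN by (cases w; simp add: V_def N_carrier l_def)+
  have ll: "l \<noteq> inv l" using l gen_neq_inv_gen gen_carrier by (auto simp: letters_def)
  obtain b :: "'a \<Rightarrow> 'a \<Rightarrow> int"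
    where b: "\<And>x n n'. x \<in> N \<Longrightarrow> n \<in> N \<Longrightarrow> n' \<in> N \<Longrightarrow> b x (n \<otimes> n') = b x n + b (x \<otimes> n) n'"
      and bM: "\<And>m x n. m \<in> M \<Longrightarrow> x \<in> N \<Longrightarrow> n \<in> N \<Longrightarrow> b (m \<otimes> x) n = b x n"
      and bl: "\<And>x l'. x \<in> N \<Longrightarrow> l' \<in> letters \<Longrightarrow> b x l' =
           of_bool (x \<otimes> inv u \<in> M \<and> l' = l) - of_bool (x \<otimes> inv (u \<otimes> l) \<in> M \<and> l' = inv l)"
    using edge_counting[OF M l u] by blast
  have b1: "b x \<one> = 0" if "x \<in> N" for x using b[OF that, of \<one> \<one>] that by (simp add: N_carrier)
  have conj: "b \<one> (x \<otimes> n \<otimes> inv x) = b x n" if x: "x \<in> N" and n: "n \<in> N" and M': "x \<otimes> n \<otimes> inv x \<in> M" for x n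
  proof -
    have "x \<otimes> n = (x \<otimes> n \<otimes> inv x) \<otimes> x" using x n by (simp add: m_assoc N_carrier)
    then have "b (x \<otimes> n) (inv x) = b x (inv x)" using bM[OF M' x, of "inv x"] x by simp
    moreover have "b \<one> x + b x (inv x) = 0" using b[of \<one> x "inv x"] b1[of \<one>] x by (simp add: N_carrier)
    ultimately show ?thesis using x n by (simp add: b N_carrier)
  qed
  (* A loop in Lambda at the start would be an initial closed subpath, so it would be all of w. *)
  have not_loop: "u \<otimes> l \<otimes> inv u \<notin> \<Lambda>"
  proof
    assume a: "u \<otimes> l \<otimes> inv u \<in> \<Lambda>"
    have "length w = 1"
    proof (rule ccontr)
      assume "length w \<noteq> 1"
      moreover have "0 < length w" using \<open>w \<noteq> []\<close> by simp
      moreover have "V 1 \<otimes> inv V 0 \<in> M" using a \<Lambda>(2) V0 by auto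
      ultimately show False using simple[of 0 1] by linarith
    qed
    then have "w = [l]" by (cases w) (auto simp: l_def)
    then show False using a w\<Lambda> lN by (simp add: N_carrier)
  qed
  have cancel: "(y \<otimes> inv x) \<otimes> (x \<otimes> z \<otimes> inv x) \<otimes> inv (y \<otimes> inv x) = y \<otimes> z \<otimes> inv y"
    if "x \<in> N" "y \<in> N" "z \<in> N" for x y z
  proof -
    have "x \<in> carrier G" "y \<in> carrier G" "z \<in> carrier G" using that by (simp_all add: N_carrier)
    then have "(y \<otimes> inv x) \<otimes> (x \<otimes> z \<otimes> inv x) = y \<otimes> z \<otimes> inv x"
      by (simp add: m_assoc inv_solve_left')
    then show ?thesis using that by (simp add: inv_mult_group m_assoc N_carrier)
       (simp add: m_assoc[symmetric] N_carrier)
  qed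
  have "b \<one> (u \<otimes> word w \<otimes> inv u) = 0"
  proof (rule vanish[of "b \<one>", OF _ _ wM])
    fix x y assume xy: "x \<in> M" "y \<in> M"
    then have xyN: "x \<in> N" "y \<in> N" using M(2) by auto
    show "b \<one> (x \<otimes> y) = b \<one> x + b \<one> y" using b[of \<one> x y] bM[OF xy(1), of \<one> y] xyN by (simp add: N_carrier)
  next
    fix a assume a: "a \<in> L"
    then have a\<Lambda>: "a \<in> \<Lambda>" using L(1) generate.incl by metis
    obtain x l' where x: "x \<in> N" "l' \<in> letters" "a = x \<otimes> l' \<otimes> inv x" using L(2)[OF a] by blast
    have M1: "y \<otimes> inv x \<in> M" if "x \<otimes> inv y \<in> M" "y \<in> N" for y
      using subgroup.m_inv_closed[OF M(1) that(1)] x that by (simp add: inv_mult_group N_carrier)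
    have "\<not> (x \<otimes> inv u \<in> M \<and> l' = l)"
    proof
      assume "x \<otimes> inv u \<in> M \<and> l' = l"
      then have "(u \<otimes> inv x) \<otimes> a \<otimes> inv (u \<otimes> inv x) \<in> \<Lambda>" "l' = l" using M1 u \<Lambda>(3) a\<Lambda> by auto
      then show False using cancel[OF x(1) u lN] x(3) not_loop by simp
    qed
    moreover have "\<not> (x \<otimes> inv (u \<otimes> l) \<in> M \<and> l' = inv l)"
    proof
      assume *: "x \<otimes> inv (u \<otimes> l) \<in> M \<and> l' = inv l"
      then have "inv ((u \<otimes> l \<otimes> inv x) \<otimes> a \<otimes> inv (u \<otimes> l \<otimes> inv x)) \<in> \<Lambda>"
        using M1[of "u \<otimes> l"] u lN \<Lambda>(3) a\<Lambda> \<Lambda>inv by auto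
      moreover have "(u \<otimes> l \<otimes> inv x) \<otimes> a \<otimes> inv (u \<otimes> l \<otimes> inv x) = u \<otimes> l \<otimes> inv l \<otimes> inv (u \<otimes> l)"
        using cancel[OF x(1), of "u \<otimes> l" "inv l"] u lN x(3) * by simp
      moreover have "inv (u \<otimes> l \<otimes> inv l \<otimes> inv (u \<otimes> l)) = u \<otimes> l \<otimes> inv u"
        using u lN by (simp add: inv_mult_group m_assoc N_carrier)
      ultimately show False using not_loop by simp
    qed
    moreover have "b \<one> a = b x l'"
      using conj[OF x(1) letters_N[OF x(2)]] a\<Lambda> \<Lambda>(2) x(3) by auto
    ultimately show "b \<one> a = 0" using bl[OF x(1,2)] by (simp only: of_bool_eq diff_self)
  qed
  moreover have "b \<one> (u \<otimes> word w \<otimes> inv u) = b u (word w)"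
    using conj u w wM by simp
  moreover have "b u (word w) = b u l"
  proof -
    (* After its first letter w does not return to the first edge: along it, this would revisit the
       start; against it, w would begin with l followed by inv l. *)
    have zero: "b (V j) (w ! j) = 0" if j: "0 < j" "j < length w" for j
    proof -
      have "V j \<otimes> inv u \<notin> M" using simple[of 0 j] j V0 by auto
      moreover have "\<not> (V j \<otimes> inv (u \<otimes> l) \<in> M \<and> w ! j = inv l)"
      proof
        assume *: "V j \<otimes> inv (u \<otimes> l) \<in> M \<and> w ! j = inv l"
        then have j1: "j = 1" using simple[of 1 j] j V0 by fastforce
        have V2: "V 2 = u"
        proof -
          have "take 2 w = [w ! 0, w ! 1]"
            using j j1 by (cases w; cases "tl w") auto
          then show ?thesis using u lN * j1 by (simp add: V_def N_carrier l_def[symmetric])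
        qed
        show False
        proof (cases "length w = 2")
          case True
          then have "u \<otimes> word w \<otimes> inv u = \<one>" using V2 V0 u by (simp add: N_carrier)
          then show False using w\<Lambda> \<Lambda>(1) by (simp add: subgroup.one_closed)
        next
          case False
          then show False using simple[of 0 2] j j1 V2 V0 u M(1) by (simp add: N_carrier subgroup.one_closed)
        qed
      qed
      ultimately show ?thesis using bl[OF V wl] j by simp
    qed
    have "b u (word (take j w)) = (if j = 0 then 0 else b u l)" if "j \<le> length w" for j
      using that
    proof (induction j)
      case 0
      then show ?case using u by (simp add: b1)
    next
      case (Suc j)
      have "word (take (Suc j) w) = word (take j w) \<otimes> w ! j"
        using Suc.prems tw wl[of j] by (simp add: take_Suc_conv_app_nth word_append letters_N N_carrier)
      then have "b u (word (take (Suc j) w)) = b u (word (take j w)) + b (V j) (w ! j)"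
        using b[OF u, of "word (take j w)" "w ! j"] tw wl[of j] Suc.prems by (simp add: V_def letters_N)
      then show ?case using Suc zero[of j] V0(1) by (cases "j = 0") (auto simp: l_def)
    qed
    from this[of "length w"] show ?thesis using \<open>w \<noteq> []\<close> by simp
  qed
  moreover have "b u l = 1" 
    using bl[OF u l] ll M(1) u by (simp add: N_carrier subgroup.one_closed)
  ultimately show False by simp
qed

end

section \<open>Modules over non-commutative rings\<close>

lemma left_module_homI:
  assumes "\<And>x. x \<in> carrier M \<Longrightarrow> f x \<in> carrier N"
    and "\<And>x y. x \<in> carrier M \<Longrightarrow> y \<in> carrier M \<Longrightarrow> f (x \<oplus>\<^bsub>M\<^esub> y) = f x \<oplus>\<^bsub>N\<^esub> f y"
    and "\<And>a x. a \<in> carrier R \<Longrightarrow> x \<in> carrier M \<Longrightarrow> f (a \<odot>\<^bsub>M\<^esub> x) = a \<odot>\<^bsub>N\<^esub> f x"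
  shows "f \<in> left_module_hom R M N"
  using assms by (auto simp: left_module_hom_def)

lemma left_module_homD:
  assumes "f \<in> left_module_hom R M N"
  shows "x \<in> carrier M \<Longrightarrow> f x \<in> carrier N"
    and "x \<in> carrier M \<Longrightarrow> y \<in> carrier M \<Longrightarrow> f (x \<oplus>\<^bsub>M\<^esub> y) = f x \<oplus>\<^bsub>N\<^esub> f y"
    and "a \<in> carrier R \<Longrightarrow> x \<in> carrier M \<Longrightarrow> f (a \<odot>\<^bsub>M\<^esub> x) = a \<odot>\<^bsub>N\<^esub> f x"
  using assms by (auto simp: left_module_hom_def)

lemma left_module_hom_comp:
  "f \<in> left_module_hom R L M \<Longrightarrow> g \<in> left_module_hom R M N \<Longrightarrow> (\<lambda>x. g (f x)) \<in> left_module_hom R L N"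
  by (rule left_module_homI) (auto simp: left_module_homD)

context left_module begin

lemma smult_zero_right [simp]: assumes "a \<in> carrier R" shows "a \<odot>\<^bsub>M\<^esub> \<zero>\<^bsub>M\<^esub> = \<zero>\<^bsub>M\<^esub>"
  using smult_r_distr[OF assms, of "\<zero>\<^bsub>M\<^esub>" "\<zero>\<^bsub>M\<^esub>"] smult_closed[OF assms, of "\<zero>\<^bsub>M\<^esub>"]
  by (simp add: M.add.l_cancel_one')
lemma smult_zero_left [simp]: assumes "x \<in> carrier M" shows "\<zero>\<^bsub>R\<^esub> \<odot>\<^bsub>M\<^esub> x = \<zero>\<^bsub>M\<^esub>"
  using smult_l_distr[OF _ _ assms, of "\<zero>\<^bsub>R\<^esub>" "\<zero>\<^bsub>R\<^esub>"] smult_closed[OF _ assms, of "\<zero>\<^bsub>R\<^esub>"]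
  by (simp add: M.add.l_cancel_one')
lemma smult_a_inv: assumes "a \<in> carrier R" "x \<in> carrier M" shows "a \<odot>\<^bsub>M\<^esub> (\<ominus>\<^bsub>M\<^esub> x) = \<ominus>\<^bsub>M\<^esub> (a \<odot>\<^bsub>M\<^esub> x)"
proof -
  have "a \<odot>\<^bsub>M\<^esub> (\<ominus>\<^bsub>M\<^esub> x) \<oplus>\<^bsub>M\<^esub> a \<odot>\<^bsub>M\<^esub> x = \<zero>\<^bsub>M\<^esub>"
    using assms by (simp flip: smult_r_distr add: M.l_neg)
  then show ?thesis using assms by (simp add: M.minus_equality smult_closed)
qed

lemma smult_minus_one: assumes "x \<in> carrier M" shows "(\<ominus>\<^bsub>R\<^esub> \<one>\<^bsub>R\<^esub>) \<odot>\<^bsub>M\<^esub> x = \<ominus>\<^bsub>M\<^esub> x"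
proof -
  have "(\<ominus>\<^bsub>R\<^esub> \<one>\<^bsub>R\<^esub>) \<odot>\<^bsub>M\<^esub> x \<oplus>\<^bsub>M\<^esub> \<one>\<^bsub>R\<^esub> \<odot>\<^bsub>M\<^esub> x = \<zero>\<^bsub>M\<^esub>"
    using assms by (simp flip: smult_l_distr add: R.l_neg)
  then show ?thesis using assms by (simp add: M.minus_equality smult_closed smult_one)
qed

lemma submoduleI:
  assumes "L \<subseteq> carrier M" "\<zero>\<^bsub>M\<^esub> \<in> L" "\<And>x y. x \<in> L \<Longrightarrow> y \<in> L \<Longrightarrow> x \<oplus>\<^bsub>M\<^esub> y \<in> L"
    and sm: "\<And>a x. a \<in> carrier R \<Longrightarrow> x \<in> L \<Longrightarrow> a \<odot>\<^bsub>M\<^esub> x \<in> L"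
  shows "submodule L R M"
proof -
  have "\<ominus>\<^bsub>M\<^esub> x \<in> L" if "x \<in> L" for x
  proof -
    have "x \<in> carrier M" using that assms(1) by blast
    then show ?thesis
      using sm[OF R.a_inv_closed[OF R.one_closed] that] by (simp only: smult_minus_one)
  qed
  then show ?thesis
    by (intro submodule.intro subgroup.intro submodule_axioms.intro)
      (use assms in \<open>simp_all add: a_inv_def\<close>)
qed

end

lemma submoduleD:
  assumes "submodule L R M"
  shows "x \<in> L \<Longrightarrow> x \<in> carrier M" "\<zero>\<^bsub>M\<^esub> \<in> L" "x \<in> L \<Longrightarrow> y \<in> L \<Longrightarrow> x \<oplus>\<^bsub>M\<^esub> y \<in> L"
    and "a \<in> carrier R \<Longrightarrow> x \<in> L \<Longrightarrow> a \<odot>\<^bsub>M\<^esub> x \<in> L"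
proof -
  interpret submodule L R M by fact
  show "x \<in> L \<Longrightarrow> x \<in> carrier M" "\<zero>\<^bsub>M\<^esub> \<in> L" "x \<in> L \<Longrightarrow> y \<in> L \<Longrightarrow> x \<oplus>\<^bsub>M\<^esub> y \<in> L"
    and "a \<in> carrier R \<Longrightarrow> x \<in> L \<Longrightarrow> a \<odot>\<^bsub>M\<^esub> x \<in> L"
    using subset m_closed one_closed smult_closed by auto
qed

lemma left_module_hom_zero:
  assumes "left_module R M" "left_module R N" and f: "f \<in> left_module_hom R M N"
  shows "f \<zero>\<^bsub>M\<^esub> = \<zero>\<^bsub>N\<^esub>"
proof -
  interpret M: left_module R M by fact
  interpret N: left_module R N by fact
  have "\<zero>\<^bsub>R\<^esub> \<odot>\<^bsub>M\<^esub> \<zero>\<^bsub>M\<^esub> = \<zero>\<^bsub>M\<^esub>" by (simp add: M.smult_zero_left)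
  then show ?thesis
    using left_module_homD(1)[OF f, of "\<zero>\<^bsub>M\<^esub>"] left_module_homD(3)[OF f, of "\<zero>\<^bsub>R\<^esub>" "\<zero>\<^bsub>M\<^esub>"] by simp
qed

lemma left_module_hom_add:
  assumes "left_module R N" "f \<in> left_module_hom R M N" "g \<in> left_module_hom R M N"
  shows "(\<lambda>x. f x \<oplus>\<^bsub>N\<^esub> g x) \<in> left_module_hom R M N"
proof -
  interpret N: left_module R N by fact
  note D = left_module_homD[OF assms(2)] left_module_homD[OF assms(3)]
  show ?thesis by (rule left_module_homI) (auto simp: D N.smult_r_distr N.a_ac)
qed

lemma left_module_hom_minus:
  assumes "left_module R N" "f \<in> left_module_hom R M N" "g \<in> left_module_hom R M N"
  shows "(\<lambda>x. f x \<ominus>\<^bsub>N\<^esub> g x) \<in> left_module_hom R M N"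
proof -
  interpret N: left_module R N by fact
  note D = left_module_homD[OF assms(3)]
  have "(\<lambda>x. \<ominus>\<^bsub>N\<^esub> g x) \<in> left_module_hom R M N"
    by (rule left_module_homI) (auto simp: D N.smult_a_inv N.minus_add)
  then show ?thesis using left_module_hom_add[OF assms(1,2)] by (simp add: a_minus_def)
qed

lemma submodule_vimage:
  assumes "left_module R M" "left_module R N" "f \<in> left_module_hom R M N" "submodule L R N"
  shows "submodule {x \<in> carrier M. f x \<in> L} R M"
proof -
  interpret M: left_module R M by fact
  show ?thesis
    by (rule M.submoduleI)
      (auto simp: left_module_homD[OF assms(3)] left_module_hom_zero[OF assms(1-3)] submoduleD[OF assms(4)]
        M.smult_closed)
qed

lemma submodule_equalizer:
  assumes "left_module R M" "left_module R N" "f \<in> left_module_hom R M N" "g \<in> left_module_hom R M N"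
  shows "submodule {x \<in> carrier M. f x = g x} R M"
proof -
  interpret M: left_module R M by fact
  show ?thesis
    by (rule M.submoduleI)
      (auto simp: left_module_homD[OF assms(3)] left_module_homD[OF assms(4)] M.smult_closed
         left_module_hom_zero[OF assms(1-3)] left_module_hom_zero[OF assms(1,2,4)])
qed

definition unit_vector :: "('r, 'm) ring_scheme \<Rightarrow> 'i \<Rightarrow> 'i \<Rightarrow> 'r" where
  "unit_vector R i = (\<lambda>j. if j = i then \<one>\<^bsub>R\<^esub> else \<zero>\<^bsub>R\<^esub>)"

lemma unit_vector_closed:
  assumes "ring R" "i \<in> I" shows "unit_vector R i \<in> carrier (free_module R I)"
proof -
  interpret ring R by fact
  have "finite {j. unit_vector R i j \<noteq> \<zero>\<^bsub>R\<^esub>}"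
    by (rule finite_subset[of _ "{i}"]) (auto simp: unit_vector_def)
  then show ?thesis using assms by (auto simp: free_module_def unit_vector_def)
qed

text \<open>
  Induction on a finite set that contains the support of a vector.
\<close>

lemma submodule_free_module_eq:
  assumes "ring R" and L: "submodule L R (free_module R I)" and units: "\<And>i. i \<in> I \<Longrightarrow> unit_vector R i \<in> L"
  shows "L = carrier (free_module R I)"
proof -
  interpret ring R by fact
  have "x \<in> L" if "finite A" "x \<in> carrier (free_module R I)" "{i. x i \<noteq> \<zero>\<^bsub>R\<^esub>} \<subseteq> A" for A x
    using that
  proof (induction A arbitrary: x rule: finite_induct)
    case empty
    then have "x = \<zero>\<^bsub>free_module R I\<^esub>" by (auto simp: free_module_def)
    then show ?case using submoduleD(2)[OF L] by simp
  next
    case (insert i A)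
    define y where "y = x(i := \<zero>\<^bsub>R\<^esub>)"
    have x: "x j \<in> carrier R" for j using insert.prems by (simp add: free_module_def)
    have "finite {j. y j \<noteq> \<zero>\<^bsub>R\<^esub>}"
      by (rule finite_subset[OF _ insert.hyps(1)]) (use insert.prems in \<open>auto simp: y_def\<close>)
    then have "y \<in> carrier (free_module R I)" using insert.prems(1) by (auto simp: free_module_def y_def)
    moreover have "{j. y j \<noteq> \<zero>\<^bsub>R\<^esub>} \<subseteq> A" using insert.prems by (auto simp: y_def)
    ultimately have "y \<in> L" by (rule insert.IH)
    show ?case
    proof (cases "i \<in> I")
      case True
      have "x = y \<oplus>\<^bsub>free_module R I\<^esub> (x i \<odot>\<^bsub>free_module R I\<^esub> unit_vector R i)"
        using x by (auto simp: free_module_def y_def unit_vector_def fun_eq_iff)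
      then show ?thesis
        using submoduleD(3,4)[OF L] \<open>y \<in> L\<close> units[OF True] x by metis
    next
      case False
      then have "x = y" using insert.prems by (auto simp: y_def free_module_def)
      then show ?thesis using \<open>y \<in> L\<close> by simp
    qed
  qed
  then show ?thesis using submoduleD(1)[OF L] by (auto simp: free_module_def)
qed

lemma finitely_generated_free_module:
  assumes "ring R" "finite I" shows "finitely_generated_module R (free_module R I)"
  unfolding finitely_generated_module_def
proof (intro exI[of _ "unit_vector R ` I"] conjI allI impI)
  show "unit_vector R ` I \<subseteq> carrier (free_module R I)" using unit_vector_closed[OF assms(1)] by auto
  show "L = carrier (free_module R I)" if "submodule L R (free_module R I)" "unit_vector R ` I \<subseteq> L" for L
    using that by (intro submodule_free_module_eq[OF assms(1)]) auto
qed (use assms in simp)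

lemma free_module_hom_eq:
  assumes "left_module R N" and f: "f \<in> left_module_hom R (free_module R I) N" and g: "g \<in> left_module_hom R (free_module R I) N"
    and "\<And>i. i \<in> I \<Longrightarrow> f (unit_vector R i) = g (unit_vector R i)" and x: "x \<in> carrier (free_module R I)"
  shows "f x = g x"
proof -
  interpret N: left_module R N by fact
  have "{x \<in> carrier (free_module R I). f x = g x} = carrier (free_module R I)"
    using assms unit_vector_closed[OF N.R.ring_axioms]
    by (intro submodule_free_module_eq[OF N.R.ring_axioms]
         submodule_equalizer[OF left_module_free_module[OF N.R.ring_axioms] assms(1) f g]) auto
  then show ?thesis using x by blast
qed

lemma free_module_lift:
  fixes R :: "('r, 'm) ring_scheme" and I :: "'i set"
  assumes "left_module R M" and b: "\<And>i. i \<in> I \<Longrightarrow> b i \<in> carrier M"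
  obtains f where "f \<in> left_module_hom R (free_module R I) M" and "\<And>i. i \<in> I \<Longrightarrow> f (unit_vector R i) = b i"
proof -
  interpret M: left_module R M by fact
  let ?F = "free_module R I"
  define supp where "supp x = {i. x i \<noteq> \<zero>\<^bsub>R\<^esub>}" for x :: "'i \<Rightarrow> 'r"
  define f where "f x = (\<Oplus>\<^bsub>M\<^esub>i\<in>supp x. x i \<odot>\<^bsub>M\<^esub> b i)" for x
  have F: "x i \<in> carrier R" "supp x \<subseteq> I" "finite (supp x)" if "x \<in> carrier ?F" for x i
    using that by (auto simp: free_module_def supp_def)
  have sm: "(\<lambda>i. x i \<odot>\<^bsub>M\<^esub> b i) \<in> A \<rightarrow> carrier M" if "x \<in> carrier ?F" "A \<subseteq> I" for x A
    using that b F(1) by (auto intro!: M.smult_closed)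
  have f: "f x = (\<Oplus>\<^bsub>M\<^esub>i\<in>A. x i \<odot>\<^bsub>M\<^esub> b i)" if "x \<in> carrier ?F" "finite A" "supp x \<subseteq> A" "A \<subseteq> I" for x A
    unfolding f_def using that sm[OF that(1,4)] b
    by (intro M.M.add.finprod_mono_neutral_cong_left) (auto simp: supp_def)
  show thesis
  proof (rule that[of f])
    show "f \<in> left_module_hom R ?F M"
    proof (rule left_module_homI)
      fix x assume x: "x \<in> carrier ?F"
      show "f x \<in> carrier M" unfolding f_def using sm[OF x] F[OF x] by (intro M.finsum_closed) auto
    next
      fix x y assume x: "x \<in> carrier ?F" and y: "y \<in> carrier ?F"
      interpret F: left_module R ?F using M.R.ring_axioms by (rule left_module_free_module)
      let ?A = "supp x \<union> supp y"
      have A: "finite ?A" "?A \<subseteq> I" using F[OF x] F[OF y] by auto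
      have xy: "x \<oplus>\<^bsub>?F\<^esub> y \<in> carrier ?F" "supp (x \<oplus>\<^bsub>?F\<^esub> y) \<subseteq> ?A"
        using F.M.a_closed[OF x y] by (auto simp: supp_def free_module_def)
      have "f (x \<oplus>\<^bsub>?F\<^esub> y) = (\<Oplus>\<^bsub>M\<^esub>i\<in>?A. (x \<oplus>\<^bsub>?F\<^esub> y) i \<odot>\<^bsub>M\<^esub> b i)" by (rule f[OF xy(1) A(1) xy(2) A(2)])
      also have "\<dots> = (\<Oplus>\<^bsub>M\<^esub>i\<in>?A. x i \<odot>\<^bsub>M\<^esub> b i \<oplus>\<^bsub>M\<^esub> y i \<odot>\<^bsub>M\<^esub> b i)"
      proof (rule M.M.finsum_cong'[OF refl])
        have bi: "b i \<in> carrier M" if "i \<in> ?A" for i using that A(2) b by blast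
        show "(\<lambda>i. x i \<odot>\<^bsub>M\<^esub> b i \<oplus>\<^bsub>M\<^esub> y i \<odot>\<^bsub>M\<^esub> b i) \<in> ?A \<rightarrow> carrier M"
          using bi F(1)[OF x] F(1)[OF y] by (auto intro!: M.M.a_closed M.smult_closed)
        show "(x \<oplus>\<^bsub>?F\<^esub> y) i \<odot>\<^bsub>M\<^esub> b i = x i \<odot>\<^bsub>M\<^esub> b i \<oplus>\<^bsub>M\<^esub> y i \<odot>\<^bsub>M\<^esub> b i" if "i \<in> ?A" for i
          using bi[OF that] F(1)[OF x] F(1)[OF y] by (simp add: free_module_def M.smult_l_distr)
      qed
      also have "\<dots> = f x \<oplus>\<^bsub>M\<^esub> f y"
        using sm[OF x A(2)] sm[OF y A(2)] by (simp add: M.M.finsum_addf f[OF x A(1) _ A(2)] f[OF y A(1) _ A(2)])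
      finally show "f (x \<oplus>\<^bsub>?F\<^esub> y) = f x \<oplus>\<^bsub>M\<^esub> f y" .
    next
      fix a x assume a: "a \<in> carrier R" and x: "x \<in> carrier ?F"
      interpret F: left_module R ?F using M.R.ring_axioms by (rule left_module_free_module)
      have ax: "a \<odot>\<^bsub>?F\<^esub> x \<in> carrier ?F" "supp (a \<odot>\<^bsub>?F\<^esub> x) \<subseteq> supp x"
        using F.smult_closed[OF a x] a by (auto simp: supp_def free_module_def)
      have dist: "a \<odot>\<^bsub>M\<^esub> (\<Oplus>\<^bsub>M\<^esub>i\<in>A. x i \<odot>\<^bsub>M\<^esub> b i) = (\<Oplus>\<^bsub>M\<^esub>i\<in>A. a \<odot>\<^bsub>M\<^esub> (x i \<odot>\<^bsub>M\<^esub> b i))"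
        if "finite A" "A \<subseteq> I" for A
        using that
      proof (induction A rule: finite_induct)
        case (insert i A)
        have 1: "(\<lambda>i. x i \<odot>\<^bsub>M\<^esub> b i) \<in> A \<rightarrow> carrier M" "x i \<odot>\<^bsub>M\<^esub> b i \<in> carrier M"
          using sm[OF x, of "insert i A"] insert.prems by auto
        moreover from 1 have "(\<lambda>i. a \<odot>\<^bsub>M\<^esub> (x i \<odot>\<^bsub>M\<^esub> b i)) \<in> A \<rightarrow> carrier M"
          using M.smult_closed[OF a] by auto
        ultimately show ?case
          using insert a by (simp add: M.M.finsum_insert M.smult_r_distr M.M.finsum_closed M.smult_closed)
      qed (simp add: a)
      have "f (a \<odot>\<^bsub>?F\<^esub> x) = (\<Oplus>\<^bsub>M\<^esub>i\<in>supp x. (a \<odot>\<^bsub>?F\<^esub> x) i \<odot>\<^bsub>M\<^esub> b i)"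
        using F[OF x] by (intro f ax) auto
      also have "\<dots> = (\<Oplus>\<^bsub>M\<^esub>i\<in>supp x. a \<odot>\<^bsub>M\<^esub> (x i \<odot>\<^bsub>M\<^esub> b i))"
      proof (rule M.M.finsum_cong'[OF refl])
        have bi: "b i \<in> carrier M" if "i \<in> supp x" for i using that F(2)[OF x] b by blast
        show "(\<lambda>i. a \<odot>\<^bsub>M\<^esub> (x i \<odot>\<^bsub>M\<^esub> b i)) \<in> supp x \<rightarrow> carrier M"
          using bi F(1)[OF x] a by (auto intro!: M.smult_closed)
        show "(a \<odot>\<^bsub>?F\<^esub> x) i \<odot>\<^bsub>M\<^esub> b i = a \<odot>\<^bsub>M\<^esub> (x i \<odot>\<^bsub>M\<^esub> b i)" if "i \<in> supp x" for i
          using bi[OF that] F(1)[OF x] a by (simp add: free_module_def M.smult_assoc)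
      qed
      also have "\<dots> = a \<odot>\<^bsub>M\<^esub> f x" using dist[OF F(3)[OF x] F(2)[OF x]] by (simp add: f_def)
      finally show "f (a \<odot>\<^bsub>?F\<^esub> x) = a \<odot>\<^bsub>M\<^esub> f x" .
    qed
  next
    fix i assume i: "i \<in> I"
    have "f (unit_vector R i) = (\<Oplus>\<^bsub>M\<^esub>j\<in>{i}. unit_vector R i j \<odot>\<^bsub>M\<^esub> b j)"
      using i by (intro f unit_vector_closed M.R.ring_axioms) (auto simp: supp_def unit_vector_def)
    then show "f (unit_vector R i) = b i"
      using b[OF i] by (simp add: unit_vector_def M.M.finsum_insert M.smult_one)
  qed
qed

text \<open>
  Let \<open>P\<close> be isomorphic to a summand \<open>A\<close> of a free module with complement \<open>B\<close>. Extend \<open>\<phi>\<close> to the free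
  module through the projection \<open>\<pi>\<close> along \<open>B\<close>, lift the images of the basis vectors, and restrict to \<open>A\<close>.
\<close>

lemma projective_lift:
  fixes P :: "('r, 'a, 'n) module_scheme"
  assumes P: "projective_module R P" and X: "left_module R X" and Y: "left_module R Y"
    and \<phi>: "\<phi> \<in> left_module_hom R P Y" and \<psi>: "\<psi> \<in> left_module_hom R X Y"
    and sub: "\<phi> ` carrier P \<subseteq> \<psi> ` carrier X"
  obtains g where "g \<in> left_module_hom R P X" and "\<And>p. p \<in> carrier P \<Longrightarrow> \<psi> (g p) = \<phi> p"
proof -
  interpret P: left_module R P using P by (simp add: projective_module_def)
  interpret Y: left_module R Y by fact
  obtain I :: "'a set" and A B f where A: "submodule A R (free_module R I)" and B: "submodule B R (free_module R I)"
    and AB: "A \<inter> B = {\<zero>\<^bsub>free_module R I\<^esub>}" "A <+>\<^bsub>free_module R I\<^esub> B = carrier (free_module R I)"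
    and f: "f \<in> left_module_hom R P ((free_module R I)\<lparr>carrier := A\<rparr>)" and bij: "bij_betw f (carrier P) A"
    using P by (auto simp: projective_module_def)
  let ?F = "free_module R I"
  interpret F: left_module R ?F using P.R.ring_axioms by (rule left_module_free_module)
  note A' = submoduleD[OF A] and B' = submoduleD[OF B]
  define f' where "f' = inv_into (carrier P) f"
  have f': "f' a \<in> carrier P" "f (f' a) = a" if "a \<in> A" for a
    using bij that by (auto simp: f'_def bij_betw_def inv_into_into f_inv_into_f)
  have f'_eq: "f' (f p) = p" if "p \<in> carrier P" for p
    using bij that by (simp add: f'_def bij_betw_def)
  have fA: "f p \<in> A" if "p \<in> carrier P" for p using bij that by (auto simp: bij_betw_def)
  have uniq: "a = a'" if "a \<in> A" "a' \<in> A" "b \<in> B" "b' \<in> B" "a \<oplus>\<^bsub>?F\<^esub> b = a' \<oplus>\<^bsub>?F\<^esub> b'" for a a' b b'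
  proof -
    have neg: "\<ominus>\<^bsub>?F\<^esub> x \<in> C" if "submodule C R ?F" "x \<in> C" for x C
      using submoduleD(4)[OF that(1) P.R.a_inv_closed[OF P.R.one_closed] that(2)]
        F.smult_minus_one[OF submoduleD(1)[OF that]] by simp
    have c: "a \<in> carrier ?F" "a' \<in> carrier ?F" "b \<in> carrier ?F" "b' \<in> carrier ?F"
      using that A'(1) B'(1) by auto
    have "a = (a \<oplus>\<^bsub>?F\<^esub> b) \<ominus>\<^bsub>?F\<^esub> b" using c by (simp add: a_minus_def F.a_assoc F.r_neg)
    also have "\<dots> = (b' \<ominus>\<^bsub>?F\<^esub> b) \<oplus>\<^bsub>?F\<^esub> a'" unfolding that(5) using c by (simp add: a_minus_def F.a_ac)
    finally have "a \<ominus>\<^bsub>?F\<^esub> a' = ((b' \<ominus>\<^bsub>?F\<^esub> b) \<oplus>\<^bsub>?F\<^esub> a') \<ominus>\<^bsub>?F\<^esub> a'" by (rule arg_cong)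
    also have "\<dots> = b' \<ominus>\<^bsub>?F\<^esub> b" using c by (simp add: a_minus_def F.a_assoc F.r_neg)
    finally have eq: "a \<ominus>\<^bsub>?F\<^esub> a' = b' \<ominus>\<^bsub>?F\<^esub> b" .
    have "a \<ominus>\<^bsub>?F\<^esub> a' \<in> A" using that A'(3) neg[OF A] by (simp add: a_minus_def)
    moreover have "b' \<ominus>\<^bsub>?F\<^esub> b \<in> B" using that B'(3) neg[OF B] by (simp add: a_minus_def)
    ultimately have "a \<ominus>\<^bsub>?F\<^esub> a' = \<zero>\<^bsub>?F\<^esub>" using AB(1) eq by auto
    moreover have "a = (a \<ominus>\<^bsub>?F\<^esub> a') \<oplus>\<^bsub>?F\<^esub> a'" using c by (simp add: a_minus_def F.a_assoc F.l_neg)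
    ultimately show ?thesis using c by simp
  qed
  define \<pi> where "\<pi> x = (THE a. a \<in> A \<and> (\<exists>b\<in>B. x = a \<oplus>\<^bsub>?F\<^esub> b))" for x
  have \<pi>_eq: "\<pi> (a \<oplus>\<^bsub>?F\<^esub> b) = a" if "a \<in> A" "b \<in> B" for a b
    unfolding \<pi>_def using that uniq by (intro the_equality) blast+
  have decomp: "\<exists>a\<in>A. \<exists>b\<in>B. x = a \<oplus>\<^bsub>?F\<^esub> b" if "x \<in> carrier ?F" for x
    using that unfolding AB(2)[symmetric] set_add_def' by blast
  have hom: "(\<lambda>x. \<phi> (f' (\<pi> x))) \<in> left_module_hom R ?F Y"
  proof -
    have f'_hom: "f' (a \<oplus>\<^bsub>?F\<^esub> a') = f' a \<oplus>\<^bsub>P\<^esub> f' a'" if "a \<in> A" "a' \<in> A" for a a'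
      using left_module_homD(2)[OF f f'(1) f'(1), OF that] f'[OF that(1)] f'[OF that(2)]
        f'_eq[of "f' a \<oplus>\<^bsub>P\<^esub> f' a'"] by simp
    have f'_smult: "f' (r \<odot>\<^bsub>?F\<^esub> a) = r \<odot>\<^bsub>P\<^esub> f' a" if "r \<in> carrier R" "a \<in> A" for r a
      using left_module_homD(3)[OF f that(1) f'(1)[OF that(2)]] f'[OF that(2)]
        f'_eq[of "r \<odot>\<^bsub>P\<^esub> f' a"] that P.smult_closed by simp
    show ?thesis
    proof (rule left_module_homI)
      fix x assume "x \<in> carrier ?F"
      then obtain a b where "a \<in> A" "b \<in> B" "x = a \<oplus>\<^bsub>?F\<^esub> b" using decomp by blast
      then show "\<phi> (f' (\<pi> x)) \<in> carrier Y" using f' left_module_homD(1)[OF \<phi>] by (simp add: \<pi>_eq)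
    next
      fix x y assume "x \<in> carrier ?F" "y \<in> carrier ?F"
      then obtain a b a' b' where *: "a \<in> A" "b \<in> B" "x = a \<oplus>\<^bsub>?F\<^esub> b" "a' \<in> A" "b' \<in> B" "y = a' \<oplus>\<^bsub>?F\<^esub> b'"
        using decomp by meson
      then have "x \<oplus>\<^bsub>?F\<^esub> y = (a \<oplus>\<^bsub>?F\<^esub> a') \<oplus>\<^bsub>?F\<^esub> (b \<oplus>\<^bsub>?F\<^esub> b')"
        using A'(1) B'(1) by (simp add: F.a_ac)
      then have "\<pi> (x \<oplus>\<^bsub>?F\<^esub> y) = a \<oplus>\<^bsub>?F\<^esub> a'" using * A'(3) B'(3) by (simp add: \<pi>_eq)
      then show "\<phi> (f' (\<pi> (x \<oplus>\<^bsub>?F\<^esub> y))) = \<phi> (f' (\<pi> x)) \<oplus>\<^bsub>Y\<^esub> \<phi> (f' (\<pi> y))"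
        using * f' left_module_homD(2)[OF \<phi>] by (simp add: \<pi>_eq f'_hom)
    next
      fix r x assume r: "r \<in> carrier R" and "x \<in> carrier ?F"
      then obtain a b where *: "a \<in> A" "b \<in> B" "x = a \<oplus>\<^bsub>?F\<^esub> b" using decomp by blast
      then have "r \<odot>\<^bsub>?F\<^esub> x = (r \<odot>\<^bsub>?F\<^esub> a) \<oplus>\<^bsub>?F\<^esub> (r \<odot>\<^bsub>?F\<^esub> b)"
        using r A'(1) B'(1) by (simp add: F.smult_r_distr)
      then have "\<pi> (r \<odot>\<^bsub>?F\<^esub> x) = r \<odot>\<^bsub>?F\<^esub> a" using * r A'(4) B'(4) by (simp add: \<pi>_eq)
      then show "\<phi> (f' (\<pi> (r \<odot>\<^bsub>?F\<^esub> x))) = r \<odot>\<^bsub>Y\<^esub> \<phi> (f' (\<pi> x))"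
        using * r f' left_module_homD(3)[OF \<phi>] by (simp add: \<pi>_eq f'_smult)
    qed
  qed
  have \<pi>A: "\<pi> a = a" if "a \<in> A" for a using \<pi>_eq[OF that B'(2)] A'(1)[OF that] by simp
  have "\<exists>x\<in>carrier X. \<psi> x = \<phi> (f' (\<pi> (unit_vector R i)))" if i: "i \<in> I" for i
  proof -
    obtain a b where "a \<in> A" "b \<in> B" "unit_vector R i = a \<oplus>\<^bsub>?F\<^esub> b"
      using decomp unit_vector_closed[OF P.R.ring_axioms i] by blast
    then have "f' (\<pi> (unit_vector R i)) \<in> carrier P" using f' by (simp add: \<pi>_eq)
    then show ?thesis using sub by force
  qed
  then obtain c where c: "\<And>i. i \<in> I \<Longrightarrow> c i \<in> carrier X"
      "\<And>i. i \<in> I \<Longrightarrow> \<psi> (c i) = \<phi> (f' (\<pi> (unit_vector R i)))" by metis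
  obtain g where g: "g \<in> left_module_hom R ?F X" "\<And>i. i \<in> I \<Longrightarrow> g (unit_vector R i) = c i"
    using free_module_lift[where I=I and b=c, OF X c(1)] by blast
  have \<psi>g: "\<psi> (g x) = \<phi> (f' (\<pi> x))" if "x \<in> carrier ?F" for x
    using free_module_hom_eq[OF Y left_module_hom_comp[OF g(1) \<psi>] hom _ that] g(2) c(2) by simp
  show thesis
  proof (rule that)
    have "f \<in> left_module_hom R P ?F"
      using left_module_homD[OF f] A'(1) by (intro left_module_homI) auto
    then show "(\<lambda>p. g (f p)) \<in> left_module_hom R P X" using g(1) by (rule left_module_hom_comp)
    show "\<psi> (g (f p)) = \<phi> p" if "p \<in> carrier P" for p
      using \<psi>g[OF A'(1)[OF fA[OF that]]] by (simp add: \<pi>A fA f'_eq that)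
  qed
qed

text \<open>
  A form of Schanuel's lemma. The top row \<open>P2 \<rightarrow> P1 \<rightarrow> P0\<close> is exact, and \<open>f\<close>, \<open>g\<close> compare it with
  \<open>C1 \<rightarrow> C0\<close>, where \<open>h\<close> is a homotopy from \<open>g0 \<circ> f0\<close> to the identity. Let \<open>q = id - g1 f1 - h c\<close>, which
  maps all of \<open>C1\<close> into the cycles. A cycle \<open>z\<close> satisfies \<open>z = g1 (f1 z) + q z\<close>, and \<open>f1 z\<close> is a cycle of
  \<open>P1\<close>, so it lies in the image of \<open>P2\<close>. Hence the cycles are the sum of an image of \<open>P2\<close> and the image
  \<open>q C1\<close>, both of which are finitely generated.
\<close>

lemma finitely_generated_cycles:
  assumes P1: "left_module R P1" and P0: "left_module R P0" and C1: "left_module R C1" and C0: "left_module R C0"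
    and P2: "left_module R P2" "finitely_generated_module R P2" and fgC: "finitely_generated_module R C1"
    and \<delta>: "\<delta> \<in> left_module_hom R P2 P1" and d: "d \<in> left_module_hom R P1 P0"
    and exact: "\<delta> ` carrier P2 = {x \<in> carrier P1. d x = \<zero>\<^bsub>P0\<^esub>}"
    and c: "c \<in> left_module_hom R C1 C0"
    and f0: "f0 \<in> left_module_hom R C0 P0" and f1: "f1 \<in> left_module_hom R C1 P1"
    and f: "\<And>x. x \<in> carrier C1 \<Longrightarrow> d (f1 x) = f0 (c x)"
    and g0: "g0 \<in> left_module_hom R P0 C0" and g1: "g1 \<in> left_module_hom R P1 C1"
    and g: "\<And>x. x \<in> carrier P1 \<Longrightarrow> c (g1 x) = g0 (d x)"
    and h: "h \<in> left_module_hom R C0 C1"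
    and homotopy: "\<And>y. y \<in> carrier C0 \<Longrightarrow> c (h y) \<oplus>\<^bsub>C0\<^esub> g0 (f0 y) = y"
  obtains Z where "finite Z" "Z \<subseteq> carrier C1" "\<And>z. z \<in> Z \<Longrightarrow> c z = \<zero>\<^bsub>C0\<^esub>"
    and "\<And>L z. submodule L R C1 \<Longrightarrow> Z \<subseteq> L \<Longrightarrow> z \<in> carrier C1 \<Longrightarrow> c z = \<zero>\<^bsub>C0\<^esub> \<Longrightarrow> z \<in> L"
proof -
  interpret P1: left_module R P1 by fact
  interpret P0: left_module R P0 by fact
  interpret C1: left_module R C1 by fact
  interpret C0: left_module R C0 by fact
  define q where "q x = x \<ominus>\<^bsub>C1\<^esub> (g1 (f1 x) \<oplus>\<^bsub>C1\<^esub> h (c x))" for x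
  have id: "(\<lambda>x. x) \<in> left_module_hom R C1 C1" by (rule left_module_homI) auto
  have q: "q \<in> left_module_hom R C1 C1"
    unfolding q_def
    by (intro left_module_hom_minus[OF C1 id] left_module_hom_add[OF C1]
         left_module_hom_comp[OF f1 g1] left_module_hom_comp[OF c h])
  have k: "(\<lambda>x. g1 (\<delta> x)) \<in> left_module_hom R P2 C1" by (rule left_module_hom_comp[OF \<delta> g1])
  obtain S2 where S2: "finite S2" "S2 \<subseteq> carrier P2" "\<And>L. submodule L R P2 \<Longrightarrow> S2 \<subseteq> L \<Longrightarrow> L = carrier P2"
    using P2(2) by (auto simp: finitely_generated_module_def)
  obtain S1 where S1: "finite S1" "S1 \<subseteq> carrier C1" "\<And>L. submodule L R C1 \<Longrightarrow> S1 \<subseteq> L \<Longrightarrow> L = carrier C1"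
    using fgC by (auto simp: finitely_generated_module_def)
  have c_minus: "c (x \<ominus>\<^bsub>C1\<^esub> y) = c x \<ominus>\<^bsub>C0\<^esub> c y" if "x \<in> carrier C1" "y \<in> carrier C1" for x y
  proof -
    have "c (x \<ominus>\<^bsub>C1\<^esub> y) \<oplus>\<^bsub>C0\<^esub> c y = c (x \<ominus>\<^bsub>C1\<^esub> y \<oplus>\<^bsub>C1\<^esub> y)"
      using that left_module_homD(2)[OF c, of "x \<ominus>\<^bsub>C1\<^esub> y" y] by simp
    also have "x \<ominus>\<^bsub>C1\<^esub> y \<oplus>\<^bsub>C1\<^esub> y = x" using that by (simp add: a_minus_def C1.a_assoc C1.l_neg)
    finally have "c x = c (x \<ominus>\<^bsub>C1\<^esub> y) \<oplus>\<^bsub>C0\<^esub> c y" ..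
    then show ?thesis
      using that left_module_homD(1)[OF c] by (simp add: a_minus_def C0.a_assoc C0.r_neg)
  qed
  note c' = left_module_homD(1,2)[OF c] and f1' = left_module_homD(1)[OF f1] and f0' = left_module_homD(1)[OF f0]
    and g1' = left_module_homD(1)[OF g1] and g0' = left_module_homD(1)[OF g0] and h' = left_module_homD(1)[OF h]
  have cq: "c (q x) = \<zero>\<^bsub>C0\<^esub>" if x: "x \<in> carrier C1" for x
  proof -
    have y: "c x \<in> carrier C0" "g0 (f0 (c x)) \<in> carrier C0" using x c' f0' g0' by auto
    have "c (q x) = c x \<ominus>\<^bsub>C0\<^esub> (c (g1 (f1 x)) \<oplus>\<^bsub>C0\<^esub> c (h (c x)))"
      unfolding q_def using x f1' g1' h' c' by (simp add: c_minus)
    also have "c (g1 (f1 x)) = g0 (f0 (c x))" using x f1' f g by simp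
    also have "g0 (f0 (c x)) \<oplus>\<^bsub>C0\<^esub> c (h (c x)) = c x"
      using C0.a_comm[OF y(2), of "c (h (c x))"] homotopy[OF y(1)] c'(1)[OF h'[OF y(1)]] by (simp only:)
    also have "c x \<ominus>\<^bsub>C0\<^esub> c x = \<zero>\<^bsub>C0\<^esub>" using y by (simp add: a_minus_def C0.r_neg)
    finally show ?thesis .
  qed
  define Z where "Z = (\<lambda>x. g1 (\<delta> x)) ` S2 \<union> q ` S1"
  show thesis
  proof (rule that[of Z])
    show "finite Z" using S1 S2 by (simp add: Z_def)
    show "Z \<subseteq> carrier C1" using S1(2) S2(2) left_module_homD(1)[OF q] left_module_homD(1)[OF k] by (auto simp: Z_def)
    show "c z = \<zero>\<^bsub>C0\<^esub>" if "z \<in> Z" for z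
    proof -
      have "c (g1 (\<delta> x)) = \<zero>\<^bsub>C0\<^esub>" if "x \<in> carrier P2" for x
      proof -
        have "\<delta> x \<in> {x \<in> carrier P1. d x = \<zero>\<^bsub>P0\<^esub>}" using that exact by blast
        then show ?thesis using g left_module_hom_zero[OF P0 C0 g0] by simp
      qed
      then show ?thesis using that S1(2) S2(2) cq by (auto simp: Z_def)
    qed
  next
    fix L z assume L: "submodule L R C1" and ZL: "Z \<subseteq> L" and z: "z \<in> carrier C1" "c z = \<zero>\<^bsub>C0\<^esub>"
    have "{x \<in> carrier P2. g1 (\<delta> x) \<in> L} = carrier P2"
      by (intro S2(3) submodule_vimage[OF P2(1) C1 k L]) (use S2(2) ZL in \<open>auto simp: Z_def\<close>)
    then have 1: "g1 (\<delta> x) \<in> L" if "x \<in> carrier P2" for x using that by blast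
    have "{x \<in> carrier C1. q x \<in> L} = carrier C1"
      by (intro S1(3) submodule_vimage[OF C1 C1 q L]) (use S1(2) ZL in \<open>auto simp: Z_def\<close>)
    then have 2: "q z \<in> L" using z(1) by blast
    have "d (f1 z) = \<zero>\<^bsub>P0\<^esub>" using f[OF z(1)] z(2) left_module_hom_zero[OF C0 P0 f0] by simp
    then obtain x where "x \<in> carrier P2" "f1 z = \<delta> x" using exact f1'[OF z(1)] by (metis (mono_tags, lifting) imageE mem_Collect_eq)
    then have 3: "g1 (f1 z) \<in> L" using 1 by simp
    have "h (c z) = \<zero>\<^bsub>C1\<^esub>" using left_module_hom_zero[OF C0 C1 h] z(2) by simp
    then have "q z = z \<ominus>\<^bsub>C1\<^esub> g1 (f1 z)" using z f1' g1' by (simp add: q_def)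
    then have "q z \<oplus>\<^bsub>C1\<^esub> g1 (f1 z) = z" using z f1' g1' by (simp add: a_minus_def C1.a_assoc C1.l_neg)
    then show "z \<in> L" using submoduleD(3)[OF L 2 3] by simp
  qed
qed

definition regular_module :: "('r, 'm) ring_scheme \<Rightarrow> ('r, 'r) module" where
  "regular_module R =
     \<lparr>carrier = carrier R, monoid.mult = undefined, one = undefined,
      zero = \<zero>\<^bsub>R\<^esub>, add = (\<oplus>\<^bsub>R\<^esub>), smult = (\<otimes>\<^bsub>R\<^esub>)\<rparr>"

lemma regular_module_simps [simp]:
  "carrier (regular_module R) = carrier R" "\<zero>\<^bsub>regular_module R\<^esub> = \<zero>\<^bsub>R\<^esub>"
  "x \<oplus>\<^bsub>regular_module R\<^esub> y = x \<oplus>\<^bsub>R\<^esub> y" "x \<odot>\<^bsub>regular_module R\<^esub> y = x \<otimes>\<^bsub>R\<^esub> y"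
  by (simp_all add: regular_module_def)

lemma left_module_regular_module:
  assumes "ring R" shows "left_module R (regular_module R)"
proof -
  interpret R: ring R by fact
  have "abelian_group (regular_module R)"
  proof (rule abelian_groupI)
    fix x assume "x \<in> carrier (regular_module R)"
    then show "\<exists>y\<in>carrier (regular_module R). y \<oplus>\<^bsub>regular_module R\<^esub> x = \<zero>\<^bsub>regular_module R\<^esub>"
      by (intro bexI[of _ "\<ominus>\<^bsub>R\<^esub> x"]) (auto simp: R.l_neg)
  qed (auto simp: R.a_ac)
  then show ?thesis
    by (intro left_module.intro left_module_axioms.intro R.ring_axioms) (auto simp: R.l_distr R.r_distr R.m_assoc)
qed

lemma regular_module_hom:
  assumes "left_module R M" "x \<in> carrier M"
  shows "(\<lambda>r. r \<odot>\<^bsub>M\<^esub> x) \<in> left_module_hom R (regular_module R) M"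
proof -
  interpret left_module R M by fact
  show ?thesis using assms(2) by (intro left_module_homI) (auto simp: smult_closed smult_l_distr smult_assoc)
qed

lemma finitely_generated_regular_module:
  assumes "ring R" shows "finitely_generated_module R (regular_module R)"
proof -
  interpret R: ring R by fact
  have "L = carrier R" if L: "submodule L R (regular_module R)" "\<one>\<^bsub>R\<^esub> \<in> L" for L
    using submoduleD(1)[OF L(1)] submoduleD(4)[OF L(1) _ L(2)] by force
  then show ?thesis unfolding finitely_generated_module_def by (intro exI[of _ "{\<one>\<^bsub>R\<^esub>}"]) auto
qed

section \<open>Finite generation of groups of type \<open>FP\<^sub>2(\<rat>)\<close>\<close>

definition linear_extension :: "('g \<Rightarrow> 'k::comm_ring_1) \<Rightarrow> ('g \<Rightarrow>\<^sub>0 'k) \<Rightarrow> 'k" where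
  "linear_extension F u = (\<Sum>g\<in>Poly_Mapping.keys u. Poly_Mapping.lookup u g * F g)"

lemma linear_extension_superset:
  "finite A \<Longrightarrow> Poly_Mapping.keys u \<subseteq> A \<Longrightarrow> linear_extension F u = (\<Sum>g\<in>A. Poly_Mapping.lookup u g * F g)"
  unfolding linear_extension_def by (auto intro!: sum.mono_neutral_left simp: not_in_keys_iff_lookup_eq_zero)

lemma linear_extension_zero [simp]: "linear_extension F 0 = 0"
  by (simp add: linear_extension_def)

lemma linear_extension_single [simp]: "linear_extension F (Poly_Mapping.single g a) = a * F g"
  by (simp add: linear_extension_def)

lemma linear_extension_add: "linear_extension F (u + v) = linear_extension F u + linear_extension F v"
proof -
  let ?A = "Poly_Mapping.keys u \<union> Poly_Mapping.keys v"
  have "linear_extension F w = (\<Sum>g\<in>?A. Poly_Mapping.lookup w g * F g)" if "w \<in> {u, v, u + v}" for w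
    using that keys_add[of u v] by (intro linear_extension_superset) auto
  then show ?thesis by (simp add: lookup_add distrib_right sum.distrib)
qed

lemma linear_extension_diff: "linear_extension F (u - v) = linear_extension F u - linear_extension F v"
  using linear_extension_add[of F "u - v" v] by (simp add: eq_diff_eq)

lemma linear_extension_sum: "linear_extension F (\<Sum>i\<in>I. u i) = (\<Sum>i\<in>I. linear_extension F (u i))"
  by (induction I rule: infinite_finite_induct) (simp_all add: linear_extension_add)

lemma linear_extension_mult_left:
  "linear_extension F (Poly_Mapping.single h a \<otimes>\<^bsub>group_ring H\<^esub> u) = a * linear_extension (\<lambda>g. F (h \<otimes>\<^bsub>H\<^esub> g)) u"
proof -
  have "Poly_Mapping.keys u \<subseteq> UNIV" by simp
  then show ?thesis
    by (induction u rule: group_ring_induct)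
      (simp_all add: group_ring_zero group_ring_single group_ring_distr linear_extension_add distrib_left mult.assoc)
qed

lemma linear_extension_mult_right:
  "linear_extension F (u \<otimes>\<^bsub>group_ring H\<^esub> Poly_Mapping.single h a) = a * linear_extension (\<lambda>g. F (g \<otimes>\<^bsub>H\<^esub> h)) u"
proof -
  have "Poly_Mapping.keys u \<subseteq> UNIV" by simp
  then show ?thesis
    by (induction u rule: group_ring_induct)
      (simp_all add: group_ring_zero group_ring_single group_ring_distl linear_extension_add distrib_left mult_ac)
qed

lemma group_ring_simps [simp]:
  "carrier (group_ring H :: ('g \<Rightarrow>\<^sub>0 'k::comm_ring_1) ring) = {u. Poly_Mapping.keys u \<subseteq> carrier H}"
  "\<zero>\<^bsub>group_ring H :: ('g \<Rightarrow>\<^sub>0 'k) ring\<^esub> = 0" 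
  "\<one>\<^bsub>group_ring H :: ('g \<Rightarrow>\<^sub>0 'k) ring\<^esub> = Poly_Mapping.single \<one>\<^bsub>H\<^esub> 1"
  "(u :: 'g \<Rightarrow>\<^sub>0 'k) \<oplus>\<^bsub>group_ring H\<^esub> v = u + v"
  by (simp_all add: group_ring_def)

lemma trivial_module_simps [simp]:
  "carrier (trivial_module :: ('g \<Rightarrow>\<^sub>0 'k::comm_ring_1, 'k) module) = UNIV"
  "\<zero>\<^bsub>trivial_module :: ('g \<Rightarrow>\<^sub>0 'k, 'k) module\<^esub> = 0"
  "x \<oplus>\<^bsub>trivial_module :: ('g \<Rightarrow>\<^sub>0 'k, 'k) module\<^esub> y = x + y"
  "u \<odot>\<^bsub>trivial_module :: ('g \<Rightarrow>\<^sub>0 'k, 'k) module\<^esub> x = augmentation u * x"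
  by (simp_all add: trivial_module_def)

lemma augmentation_hom:
  assumes "group H"
  shows "(\<lambda>u. augmentation u) \<in> left_module_hom (group_ring H) (regular_module (group_ring H))
           (trivial_module :: ('g \<Rightarrow>\<^sub>0 'k::comm_ring_1, 'k) module)"
  using regular_module_hom[OF left_module_trivial_module[OF assms, where 'k='k], of 1] by simp

text \<open>
  The comparison in degree zero between a projective resolution and a free one that begins with the group
  ring itself.
\<close>

lemma resolution_start:
  fixes P\<^sub>0 :: "('g \<Rightarrow>\<^sub>0 rat, 'b) module"
  assumes H: "group H" and P: "projective_module (group_ring H) P\<^sub>0"
    and \<epsilon>: "\<epsilon> \<in> left_module_hom (group_ring H) P\<^sub>0 trivial_module"
    and surj: "\<epsilon> ` carrier P\<^sub>0 = carrier (trivial_module :: ('g \<Rightarrow>\<^sub>0 rat, rat) module)"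
  obtains f g where "f \<in> left_module_hom (group_ring H) (regular_module (group_ring H)) P\<^sub>0"
    and "\<And>u. u \<in> carrier (group_ring H) \<Longrightarrow> \<epsilon> (f u) = augmentation u"
    and "g \<in> left_module_hom (group_ring H) P\<^sub>0 (regular_module (group_ring H))"
    and "\<And>x. x \<in> carrier P\<^sub>0 \<Longrightarrow> augmentation (g x) = \<epsilon> x"
proof -
  let ?R = "group_ring H :: ('g \<Rightarrow>\<^sub>0 rat) ring"
  have R: "ring ?R" using H by (rule ring_group_ring)
  have P0: "left_module ?R P\<^sub>0" using P by (simp add: projective_module_def)
  have T: "left_module ?R (trivial_module :: ('g \<Rightarrow>\<^sub>0 rat, rat) module)"
    by (rule left_module_trivial_module[OF H])
  have "1 \<in> \<epsilon> ` carrier P\<^sub>0" by (simp add: surj)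
  then obtain x where x: "x \<in> carrier P\<^sub>0" "\<epsilon> x = 1" by auto
  have "q \<in> (\<lambda>u. augmentation u) ` carrier (regular_module ?R)" for q :: rat
    by (rule image_eqI[of _ _ "Poly_Mapping.single \<one>\<^bsub>H\<^esub> q"])
      (use group.is_monoid[OF H] in \<open>simp_all add: monoid.one_closed\<close>)
  then have sub: "\<epsilon> ` carrier P\<^sub>0 \<subseteq> (\<lambda>u. augmentation u) ` carrier (regular_module ?R)"
    by blast
  obtain g where "g \<in> left_module_hom ?R P\<^sub>0 (regular_module ?R)"
      "\<And>y. y \<in> carrier P\<^sub>0 \<Longrightarrow> augmentation (g y) = \<epsilon> y"
    using projective_lift[OF P left_module_regular_module[OF R] T \<epsilon> augmentation_hom[OF H] sub] by blast
  moreover have "\<epsilon> (u \<odot>\<^bsub>P\<^sub>0\<^esub> x) = augmentation u" if "u \<in> carrier ?R" for u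
    using left_module_homD(3)[OF \<epsilon> that x(1)] x(2) by simp
  ultimately show thesis
    using that[OF regular_module_hom[OF P0 x(1)]] by blast
qed

lemma group_ring_diff_closed:
  fixes u v :: "'g \<Rightarrow>\<^sub>0 'k::comm_ring_1"
  assumes "u \<in> carrier (group_ring H)" "v \<in> carrier (group_ring H)" shows "u - v \<in> carrier (group_ring H)"
  using assms keys_diff[of u v] by auto

lemma augmentation_diff: "augmentation (u - v) = augmentation u - augmentation (v :: 'g \<Rightarrow>\<^sub>0 'k::comm_ring_1)"
  using augmentation_add[of "u - v" v] by (simp add: eq_diff_eq)

text \<open>
  The augmentation ideal consists of the cycles in degree zero of a free resolution, so it is generated by
  a finite set \<open>Z\<close>. Let \<open>\<Delta>\<close> be generated by the group elements that occur in \<open>Z\<close>. Summation over any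
  coset of \<open>\<Delta>\<close> kills \<open>Z\<close>, hence it kills the augmentation ideal; applied to \<open>x - 1\<close> this shows \<open>x \<in> \<Delta>\<close>.
\<close>

lemma finitely_generated_if_FP2:
  assumes H: "group H" and FP: "type_FP2_rat H"
  obtains S where "finite S" "S \<subseteq> carrier H" "generate H S = carrier H"
proof -
  interpret H: group H by fact
  let ?R = "group_ring H :: ('a \<Rightarrow>\<^sub>0 rat) ring" and ?T = "trivial_module :: ('a \<Rightarrow>\<^sub>0 rat, rat) module"
  have R: "ring ?R" using H by (rule ring_group_ring)
  have T: "left_module ?R ?T" by (rule left_module_trivial_module[OF H])
  obtain P\<^sub>0 P\<^sub>1 :: "('a \<Rightarrow>\<^sub>0 rat, nat \<Rightarrow> 'a \<Rightarrow>\<^sub>0 rat) module" and d \<epsilon> where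
    P: "projective_module ?R P\<^sub>0" "projective_module ?R P\<^sub>1" "finitely_generated_module ?R P\<^sub>1"
    and d: "d \<in> left_module_hom ?R P\<^sub>1 P\<^sub>0" and \<epsilon>: "\<epsilon> \<in> left_module_hom ?R P\<^sub>0 ?T"
    and ex: "d ` carrier P\<^sub>1 = {x \<in> carrier P\<^sub>0. \<epsilon> x = \<zero>\<^bsub>?T\<^esub>}" "\<epsilon> ` carrier P\<^sub>0 = carrier ?T"
    using FP unfolding type_FP2_rat_def a_kernel_def kernel_def by auto
  have mod: "left_module ?R P\<^sub>0" "left_module ?R P\<^sub>1" using P by (auto simp: projective_module_def)
  obtain f g where f: "f \<in> left_module_hom ?R (regular_module ?R) P\<^sub>0"
     "\<And>u. u \<in> carrier ?R \<Longrightarrow> \<epsilon> (f u) = augmentation u"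
    and g: "g \<in> left_module_hom ?R P\<^sub>0 (regular_module ?R)" "\<And>x. x \<in> carrier P\<^sub>0 \<Longrightarrow> augmentation (g x) = \<epsilon> x"
    using resolution_start[OF H P(1) \<epsilon> ex(2)] by blast
  have idT: "(\<lambda>x. x) \<in> left_module_hom ?R ?T ?T" and zeroT: "(\<lambda>x. 0) \<in> left_module_hom ?R ?T (regular_module ?R)"
    by (auto intro!: left_module_homI simp: group_ring_zero)
  obtain Z where Z: "finite Z" "Z \<subseteq> carrier (regular_module ?R)" "\<And>z. z \<in> Z \<Longrightarrow> augmentation z = \<zero>\<^bsub>?T\<^esub>"
    and gen: "\<And>L z. submodule L ?R (regular_module ?R) \<Longrightarrow> Z \<subseteq> L \<Longrightarrow> z \<in> carrier (regular_module ?R) \<Longrightarrow> augmentation z = \<zero>\<^bsub>?T\<^esub> \<Longrightarrow> z \<in> L"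
    by (rule finitely_generated_cycles[OF mod(1) T left_module_regular_module[OF R] T mod(2) P(3)
          finitely_generated_regular_module[OF R] d \<epsilon> ex(1) augmentation_hom[OF H] idT f(1) _ idT g(1) _ zeroT])
       (use f(2) g(2) in auto)
  define S where "S = (\<Union>z\<in>Z. Poly_Mapping.keys z)"
  have S: "finite S" "S \<subseteq> carrier H" using Z by (auto simp: S_def)
  (* Functions on H that are constant on the left cosets of the subgroup generated by S. *)
  define inv_fun where "inv_fun F \<longleftrightarrow> (\<forall>x\<in>carrier H. \<forall>s\<in>generate H S. F (x \<otimes>\<^bsub>H\<^esub> s) = F x)" for F :: "'a \<Rightarrow> rat"
  define L where "L = {u \<in> carrier ?R. \<forall>F. inv_fun F \<longrightarrow> linear_extension F u = 0}"
  interpret M: left_module ?R "regular_module ?R" by (rule left_module_regular_module[OF R])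
  have "submodule L ?R (regular_module ?R)"
  proof (rule M.submoduleI)
    fix r u assume r: "r \<in> carrier ?R" and u: "u \<in> L"
    have "linear_extension F (r \<otimes>\<^bsub>?R\<^esub> u) = 0" if F: "inv_fun F" for F
    proof -
      have "Poly_Mapping.keys r \<subseteq> carrier H" using r by simp
      then show ?thesis
      proof (induction r rule: group_ring_induct)
        case (single h a)
        have "inv_fun (\<lambda>x. F (h \<otimes>\<^bsub>H\<^esub> x))"
          using F single S(2) H.generate_incl[of S] by (auto simp: inv_fun_def simp flip: H.m_assoc)
        then show ?case using u by (simp add: linear_extension_mult_left L_def)
      qed (simp_all add: group_ring_zero group_ring_distl linear_extension_add)
    qed
    then show "r \<odot>\<^bsub>regular_module ?R\<^esub> u \<in> L"
      using ring.ring_simprules(5)[OF R r, of u] u by (simp add: L_def)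
  next
    fix u v assume "u \<in> L" "v \<in> L"
    then show "u \<oplus>\<^bsub>regular_module ?R\<^esub> v \<in> L"
      using keys_add[of u v] by (auto simp: L_def linear_extension_add)
  qed (auto simp: L_def)
  moreover have "Z \<subseteq> L"
  proof
    fix z assume z: "z \<in> Z"
    have "linear_extension F z = 0" if F: "inv_fun F" for F
    proof -
      have "F g = F \<one>\<^bsub>H\<^esub>" if "g \<in> Poly_Mapping.keys z" for g
      proof -
        have "g \<in> generate H S" using that z by (auto simp: S_def intro: generate.incl)
        then have "F (\<one>\<^bsub>H\<^esub> \<otimes>\<^bsub>H\<^esub> g) = F \<one>\<^bsub>H\<^esub>" using F H.one_closed unfolding inv_fun_def by blast
        then show ?thesis using that z S(2) by (auto simp: S_def)
      qed
      then have "linear_extension F z = augmentation z * F \<one>\<^bsub>H\<^esub>"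
        by (simp add: linear_extension_def sum_distrib_right)
      then show ?thesis using Z(3)[OF z] by simp
    qed
    then show "z \<in> L" using z Z(2) by (auto simp: L_def)
  qed
  ultimately have gen: "u \<in> L" if "u \<in> carrier ?R" "augmentation u = 0" for u
    using gen[of L u] that by simp
  have "x \<in> generate H S" if x: "x \<in> carrier H" for x
  proof -
    let ?F = "\<lambda>y. of_bool (y \<in> generate H S) :: rat"
    have "Poly_Mapping.single x 1 - Poly_Mapping.single \<one>\<^bsub>H\<^esub> 1 \<in> L"
    proof (rule gen)
      show "Poly_Mapping.single x 1 - Poly_Mapping.single \<one>\<^bsub>H\<^esub> 1 \<in> carrier ?R"
        using x by (intro group_ring_diff_closed) auto
    qed (simp only: augmentation_diff augmentation_single diff_self)
    moreover have "inv_fun ?F"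
      unfolding inv_fun_def
    proof (intro ballI)
      fix x s assume "x \<in> carrier H" and s: "s \<in> generate H S"
      have sg: "subgroup (generate H S) H" using S(2) by (rule H.generate_is_subgroup)
      have "s \<in> carrier H" using s sg subgroup.mem_carrier by metis
      have "x \<in> generate H S" if "x \<otimes>\<^bsub>H\<^esub> s \<in> generate H S"
        using subgroup.m_closed[OF sg that subgroup.m_inv_closed[OF sg s]] \<open>x \<in> carrier H\<close> \<open>s \<in> carrier H\<close>
        by (simp add: H.m_assoc)
      then have "x \<otimes>\<^bsub>H\<^esub> s \<in> generate H S \<longleftrightarrow> x \<in> generate H S"
        using s sg subgroup.m_closed by metis
      then show "?F (x \<otimes>\<^bsub>H\<^esub> s) = ?F x" by simp
    qed
    ultimately have "linear_extension ?F (Poly_Mapping.single x 1 - Poly_Mapping.single \<one>\<^bsub>H\<^esub> 1) = 0"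
      unfolding L_def by blast
    then have "?F x - ?F \<one>\<^bsub>H\<^esub> = 0" by (simp only: linear_extension_diff linear_extension_single mult_1)
    then show ?thesis by (simp add: generate.one split: if_splits)
  qed
  moreover have "generate H S \<subseteq> carrier H" using S(2) by (rule H.generate_incl)
  ultimately show thesis using that S by blast
qed

section \<open>Rational homology of kernels of maps onto groups of type \<open>FP\<^sub>2(\<rat>)\<close>\<close>

text \<open>
  Let \<open>C\<close> be the free module on \<open>S\<close> over the rational group ring of \<open>\<Gamma>\<close>, with the boundary map \<open>bd\<close> that
  sends the basis vector of \<open>s\<close> to \<open>p s - 1\<close>; this is the chain complex of the Cayley graph of \<open>\<Gamma>\<close> on
  the generators \<open>p s\<close>. By \<open>finitely_generated_cycles\<close> its cycles are generated by a finite set \<open>B\<close>.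

  Choose a section \<open>\<sigma>\<close> of \<open>p\<close>. The edge from \<open>g\<close> with label \<open>s\<close> determines the element
  \<open>m g s = \<sigma>(g) s \<sigma>(g p(s))\<^sup>-\<^sup>1\<close> of the kernel, and \<open>Z\<close> collects these for the finitely many edges in the
  supports of the members of \<open>B\<close>. A homomorphism \<open>\<chi>\<close> on the kernel extends to the linear functional \<open>X \<omega>\<close>
  on chains with value \<open>\<omega> g s = \<chi> (m g s)\<close> on that edge. If \<open>\<chi>\<close> kills the conjugates of \<open>Z\<close>, then \<open>X \<omega>\<close>
  kills all translates of \<open>B\<close>: up to a conjugate of an element of \<open>Z\<close>, translating an edge changes \<open>\<omega>\<close> by
  a coboundary, which is zero on cycles. So \<open>X \<omega>\<close> kills all cycles. Writing an element \<open>k\<close> of the kernel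
  as a word in \<open>S\<close> yields a closed path in the Cayley graph, on which \<open>X \<omega>\<close> takes the value \<open>\<chi> k\<close> by
  telescoping.
\<close>

lemma finitely_many_rational_relations:
  fixes \<Gamma> :: "('g, 'm) monoid_scheme" and H :: "('h, 'n) monoid_scheme"
  assumes H: "group H" and \<Gamma>: "group \<Gamma>" and p: "p \<in> hom H \<Gamma>" "p ` carrier H = carrier \<Gamma>"
    and S: "finite S" "S \<subseteq> carrier H" "generate H S = carrier H"
    and FP: "type_FP2_rat \<Gamma>"
  obtains Z where "finite Z" "Z \<subseteq> kernel H \<Gamma> p"
    and "\<And>(\<chi> :: 'h \<Rightarrow> rat) m.
        (\<And>x y. x \<in> kernel H \<Gamma> p \<Longrightarrow> y \<in> kernel H \<Gamma> p \<Longrightarrow> \<chi> (x \<otimes>\<^bsub>H\<^esub> y) = \<chi> x + \<chi> y) \<Longrightarrow>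
        (\<And>h z. h \<in> carrier H \<Longrightarrow> z \<in> Z \<Longrightarrow> \<chi> (h \<otimes>\<^bsub>H\<^esub> z \<otimes>\<^bsub>H\<^esub> inv\<^bsub>H\<^esub> h) = 0) \<Longrightarrow>
        m \<in> kernel H \<Gamma> p \<Longrightarrow> \<chi> m = 0"
proof -
  interpret H: group H by fact
  interpret \<Gamma>: group \<Gamma> by fact
  have cancel: "inv\<^bsub>H\<^esub> a \<otimes>\<^bsub>H\<^esub> (a \<otimes>\<^bsub>H\<^esub> c) = c" "a \<otimes>\<^bsub>H\<^esub> (inv\<^bsub>H\<^esub> a \<otimes>\<^bsub>H\<^esub> c) = c"
    if "a \<in> carrier H" "c \<in> carrier H" for a c
    using that by (simp_all flip: H.m_assoc)
  interpret p: group_hom H \<Gamma> p by (simp add: group_hom_def group_hom_axioms_def H \<Gamma> p)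
  let ?R = "group_ring \<Gamma> :: ('g \<Rightarrow>\<^sub>0 rat) ring" and ?T = "trivial_module :: ('g \<Rightarrow>\<^sub>0 rat, rat) module"
  let ?s = "\<lambda>g. Poly_Mapping.single g (1::rat)"
  let ?C = "free_module ?R S"
  have R: "ring ?R" using \<Gamma> by (rule ring_group_ring)
  interpret R: ring ?R by fact
  interpret C: left_module ?R ?C by (rule left_module_free_module[OF R])
  have reg: "left_module ?R (regular_module ?R)" by (rule left_module_regular_module[OF R])
  have T: "left_module ?R ?T" by (rule left_module_trivial_module[OF \<Gamma>])
  have C_simps: "(a \<odot>\<^bsub>?C\<^esub> y) s = a \<otimes>\<^bsub>?R\<^esub> y s" "(y \<oplus>\<^bsub>?C\<^esub> y') s = y s + y' s" "\<zero>\<^bsub>?C\<^esub> s = 0" for a y y' s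
    by (simp_all add: free_module_def)
  have C_carrier: "y s \<in> carrier ?R" if "y \<in> carrier ?C" for y s using that by (auto simp: free_module_def)
  have ps: "p s \<in> carrier \<Gamma>" if "s \<in> S" for s using that S(2) by auto
  have sR: "?s g \<in> carrier ?R" if "g \<in> carrier \<Gamma>" for g using that by simp
  have diffR: "?s (p s) - ?s \<one>\<^bsub>\<Gamma>\<^esub> \<in> carrier ?R" if "s \<in> S" for s
    using sR ps[OF that] by (intro group_ring_diff_closed) auto
  have sumR: "(\<Sum>s\<in>A. v s) \<in> carrier ?R" if "\<And>s. s \<in> A \<Longrightarrow> v s \<in> carrier ?R" for A :: "'h set" and v
    using that
  proof (induction A rule: infinite_finite_induct)
    case (insert s A)
    then show ?case using R.a_closed[of "v s" "\<Sum>s\<in>A. v s"] by simp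
  qed auto
  define bd where "bd y = (\<Sum>s\<in>S. y s \<otimes>\<^bsub>?R\<^esub> (?s (p s) - ?s \<one>\<^bsub>\<Gamma>\<^esub>))" for y
  have bd: "bd \<in> left_module_hom ?R ?C (regular_module ?R)"
  proof (rule left_module_homI)
    fix y assume "y \<in> carrier ?C"
    then show "bd y \<in> carrier (regular_module ?R)"
      unfolding bd_def regular_module_simps using diffR C_carrier by (intro sumR R.m_closed) auto
  next
    fix y y'
    show "bd (y \<oplus>\<^bsub>?C\<^esub> y') = bd y \<oplus>\<^bsub>regular_module ?R\<^esub> bd y'"
      by (simp add: bd_def C_simps group_ring_distl sum.distrib)
  next
    fix a y assume a: "a \<in> carrier ?R" and y: "y \<in> carrier ?C"
    have dist: "a \<otimes>\<^bsub>?R\<^esub> (\<Sum>s\<in>A. v s) = (\<Sum>s\<in>A. a \<otimes>\<^bsub>?R\<^esub> v s)" for A :: "'h set" and v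
      by (induction A rule: infinite_finite_induct) (simp_all add: group_ring_zero group_ring_distr)
    show "bd (a \<odot>\<^bsub>?C\<^esub> y) = a \<odot>\<^bsub>regular_module ?R\<^esub> bd y"
      unfolding bd_def C_simps regular_module_simps dist
      using a C_carrier[OF y] diffR by (intro sum.cong[OF refl] R.m_assoc)
  qed
  have aug_bd: "augmentation (bd y) = 0" for y
  proof -
    have "augmentation (y s \<otimes>\<^bsub>?R\<^esub> (?s (p s) - ?s \<one>\<^bsub>\<Gamma>\<^esub>)) = 0" for s
      by (simp only: augmentation_mult augmentation_diff augmentation_single diff_self mult_zero_right)
    moreover have "augmentation (\<Sum>s\<in>A. v s) = (\<Sum>s\<in>A. augmentation (v s))" for A :: "'h set" and v :: "'h \<Rightarrow> 'g \<Rightarrow>\<^sub>0 rat"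
      by (induction A rule: infinite_finite_induct) (simp_all add: augmentation_add)
    ultimately show ?thesis unfolding bd_def by simp
  qed
  have bd_unit: "bd (unit_vector ?R s) = ?s (p s) - ?s \<one>\<^bsub>\<Gamma>\<^esub>" if "s \<in> S" for s
  proof -
    have "bd (unit_vector ?R s) = (\<Sum>s'\<in>{s}. unit_vector ?R s s' \<otimes>\<^bsub>?R\<^esub> (?s (p s') - ?s \<one>\<^bsub>\<Gamma>\<^esub>))"
      unfolding bd_def using S(1) that
      by (intro sum.mono_neutral_right) (auto simp: unit_vector_def group_ring_zero)
    also have "\<dots> = ?s (p s) - ?s \<one>\<^bsub>\<Gamma>\<^esub>"
      using R.l_one[OF diffR[OF that]] by (simp add: unit_vector_def)
    finally show ?thesis .
  qed
  define edge where "edge g s = ?s g \<odot>\<^bsub>?C\<^esub> unit_vector ?R s" for g s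
  have edge: "edge g s \<in> carrier ?C" "bd (edge g s) = ?s (g \<otimes>\<^bsub>\<Gamma>\<^esub> p s) - ?s g" if "g \<in> carrier \<Gamma>" "s \<in> S" for g s
  proof -
    show "edge g s \<in> carrier ?C"
      unfolding edge_def using sR[OF that(1)] unit_vector_closed[OF R that(2)] by (rule C.smult_closed)
    have "bd (edge g s) = ?s g \<otimes>\<^bsub>?R\<^esub> (?s (p s) - ?s \<one>\<^bsub>\<Gamma>\<^esub>)"
      unfolding edge_def left_module_homD(3)[OF bd sR[OF that(1)] unit_vector_closed[OF R that(2)]]
      by (simp add: bd_unit[OF that(2)])
    moreover have "?s g \<otimes>\<^bsub>?R\<^esub> (u - v) = ?s g \<otimes>\<^bsub>?R\<^esub> u - ?s g \<otimes>\<^bsub>?R\<^esub> v" for u v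
      using group_ring_distr[of \<Gamma> "?s g" "u - v" v] by (simp add: eq_diff_eq)
    ultimately show "bd (edge g s) = ?s (g \<otimes>\<^bsub>\<Gamma>\<^esub> p s) - ?s g"
      using that by (simp add: group_ring_single)
  qed
  define X where "X \<omega> y = (\<Sum>s\<in>S. linear_extension (\<lambda>g. \<omega> g s) (y s))" for \<omega> :: "'g \<Rightarrow> 'h \<Rightarrow> rat" and y
  have X_add: "X \<omega> (y \<oplus>\<^bsub>?C\<^esub> y') = X \<omega> y + X \<omega> y'" for \<omega> y y'
    by (simp add: X_def C_simps linear_extension_add sum.distrib)
  have X_edge: "X \<omega> (edge g s) = \<omega> g s" if "g \<in> carrier \<Gamma>" "s \<in> S" for \<omega> g s
  proof -
    have "X \<omega> (edge g s) = (\<Sum>s'\<in>{s}. linear_extension (\<lambda>g. \<omega> g s') (edge g s s'))"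
      unfolding X_def using S(1) that
      by (intro sum.mono_neutral_right) (auto simp: edge_def C_simps unit_vector_def group_ring_zero)
    then show ?thesis using that by (simp add: edge_def C_simps unit_vector_def group_ring_single)
  qed
  have X_neg: "X \<omega> (\<ominus>\<^bsub>?C\<^esub> y) = - X \<omega> y" if "y \<in> carrier ?C" for \<omega> y
  proof -
    have "X \<omega> (\<ominus>\<^bsub>?C\<^esub> y) + X \<omega> y = X \<omega> \<zero>\<^bsub>?C\<^esub>" using that by (simp flip: X_add add: C.l_neg)
    then show ?thesis by (simp add: X_def C_simps)
  qed
  have bd_neg: "bd (\<ominus>\<^bsub>?C\<^esub> y) = - bd y" if "y \<in> carrier ?C" for y
  proof -
    have "bd (\<ominus>\<^bsub>?C\<^esub> y) + bd y = bd \<zero>\<^bsub>?C\<^esub>"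
      using left_module_homD(2)[OF bd, of "\<ominus>\<^bsub>?C\<^esub> y" y] that by (simp add: C.l_neg)
    then show ?thesis using left_module_hom_zero[OF C.left_module_axioms reg bd] by (simp add: eq_neg_iff_add_eq_0)
  qed
  (* For each h there is a path from 1 to p h in the Cayley graph, on which the functional given by
     omega telescopes to the potential U h. Paths grow at their end, so generators are
     appended on the right. *)
  have path: "\<exists>y\<in>carrier ?C. bd y = ?s (p h) - ?s \<one>\<^bsub>\<Gamma>\<^esub> \<and> X \<omega> y = U h"
    if U: "U \<one>\<^bsub>H\<^esub> = 0" "\<And>h s. h \<in> carrier H \<Longrightarrow> s \<in> S \<Longrightarrow> U (h \<otimes>\<^bsub>H\<^esub> s) = U h + \<omega> (p h) s" and h: "h \<in> carrier H" for U h \<omega>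
  proof -
    define Q where "Q h \<longleftrightarrow> h \<in> carrier H \<and> (\<exists>y\<in>carrier ?C. bd y = ?s (p h) - ?s \<one>\<^bsub>\<Gamma>\<^esub> \<and> X \<omega> y = U h)" for h
    have "\<forall>h. Q h \<longrightarrow> Q (h \<otimes>\<^bsub>H\<^esub> k)" if "k \<in> generate H S" for k
      using that
    proof (induction rule: generate.induct)
      case one
      then show ?case by (auto simp: Q_def)
    next
      case (incl s)
      show ?case
      proof (intro allI impI)
        fix h assume "Q h"
        then obtain y where y: "h \<in> carrier H" "y \<in> carrier ?C" "bd y = ?s (p h) - ?s \<one>\<^bsub>\<Gamma>\<^esub>" "X \<omega> y = U h" by (auto simp: Q_def)
        have s: "s \<in> carrier H" "p h \<in> carrier \<Gamma>" using incl S(2) y(1) by auto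
        note e = edge[OF s(2) incl]
        have "bd (y \<oplus>\<^bsub>?C\<^esub> edge (p h) s) = ?s (p (h \<otimes>\<^bsub>H\<^esub> s)) - ?s \<one>\<^bsub>\<Gamma>\<^esub>"
          using left_module_homD(2)[OF bd y(2) e(1)] y s e(2) by simp
        moreover have "X \<omega> (y \<oplus>\<^bsub>?C\<^esub> edge (p h) s) = U (h \<otimes>\<^bsub>H\<^esub> s)"
          using y s U(2) incl by (simp add: X_add X_edge)
        moreover have "y \<oplus>\<^bsub>?C\<^esub> edge (p h) s \<in> carrier ?C" using y e by simp
        ultimately show "Q (h \<otimes>\<^bsub>H\<^esub> s)" using y s unfolding Q_def by blast
      qed
    next
      case (inv s)
      show ?case
      proof (intro allI impI)
        fix h assume "Q h"
        then obtain y where y: "h \<in> carrier H" "y \<in> carrier ?C" "bd y = ?s (p h) - ?s \<one>\<^bsub>\<Gamma>\<^esub>" "X \<omega> y = U h" by (auto simp: Q_def)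
        define k where "k = h \<otimes>\<^bsub>H\<^esub> inv\<^bsub>H\<^esub> s"
        have s: "s \<in> carrier H" "k \<in> carrier H" "p k \<in> carrier \<Gamma>" "k \<otimes>\<^bsub>H\<^esub> s = h"
          using inv S(2) y(1) by (auto simp: k_def H.m_assoc)
        note e = edge[OF s(3) inv]
        have pk: "p k \<otimes>\<^bsub>\<Gamma>\<^esub> p s = p h" using s by (simp flip: p.hom_mult)
        have "bd (y \<oplus>\<^bsub>?C\<^esub> (\<ominus>\<^bsub>?C\<^esub> edge (p k) s)) = ?s (p k) - ?s \<one>\<^bsub>\<Gamma>\<^esub>"
          using left_module_homD(2)[OF bd y(2) C.a_inv_closed[OF e(1)]] y e pk by (simp add: bd_neg)
        moreover have "X \<omega> (y \<oplus>\<^bsub>?C\<^esub> (\<ominus>\<^bsub>?C\<^esub> edge (p k) s)) = U k"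
          using y s U(2)[OF s(2) inv] inv e by (simp add: X_add X_neg X_edge)
        moreover have "y \<oplus>\<^bsub>?C\<^esub> (\<ominus>\<^bsub>?C\<^esub> edge (p k) s) \<in> carrier ?C" using y e by simp
        ultimately show "Q (h \<otimes>\<^bsub>H\<^esub> inv\<^bsub>H\<^esub> s)" using s unfolding Q_def k_def[symmetric] by blast
      qed
    next
      case (eng k k')
      have "k \<in> carrier H" "k' \<in> carrier H" using eng(1,2) S by auto
      then show ?case using eng(3,4) by (metis H.m_assoc Q_def)
    qed
    moreover have "Q \<one>\<^bsub>H\<^esub>"
      unfolding Q_def using U(1) left_module_hom_zero[OF C.left_module_axioms reg bd]
      by (auto intro!: bexI[of _ "\<zero>\<^bsub>?C\<^esub>"] simp: X_def C_simps)
    ultimately have "Q (\<one>\<^bsub>H\<^esub> \<otimes>\<^bsub>H\<^esub> h)" using h S(3) by blast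
    then show ?thesis using h by (simp add: Q_def)
  qed
  (* The Cayley graph is connected, so its augmented chain complex is exact in degree zero. *)
  have exact: "u \<in> bd ` carrier ?C" if u: "u \<in> carrier ?R" "augmentation u = 0" for u
  proof -
    have "Poly_Mapping.keys u \<subseteq> carrier \<Gamma>" using u by simp
    then have "\<exists>y\<in>carrier ?C. bd y = u - Poly_Mapping.single \<one>\<^bsub>\<Gamma>\<^esub> (augmentation u)"
    proof (induction u rule: group_ring_induct)
      case zero
      then show ?case using left_module_hom_zero[OF C.left_module_axioms reg bd] by (auto intro!: bexI[of _ "\<zero>\<^bsub>?C\<^esub>"])
    next
      case (single g a)
      then obtain h where "h \<in> carrier H" "p h = g" using p(2) by (metis imageE)
      then obtain y where y: "y \<in> carrier ?C" "bd y = ?s g - ?s \<one>\<^bsub>\<Gamma>\<^esub>" using path[of "\<lambda>_. 0" "\<lambda>_ _. 0" h] by auto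
      let ?a = "Poly_Mapping.single \<one>\<^bsub>\<Gamma>\<^esub> a"
      have a: "?a \<in> carrier ?R" by simp
      have "?a \<otimes>\<^bsub>?R\<^esub> (u - v) = ?a \<otimes>\<^bsub>?R\<^esub> u - ?a \<otimes>\<^bsub>?R\<^esub> v" for u v
        using group_ring_distr[of \<Gamma> ?a "u - v" v] by (simp add: eq_diff_eq)
      then have "bd (?a \<odot>\<^bsub>?C\<^esub> y) = Poly_Mapping.single g a - Poly_Mapping.single \<one>\<^bsub>\<Gamma>\<^esub> a"
        using left_module_homD(3)[OF bd a y(1)] y(2) single by (simp add: group_ring_single)
      then show ?case using C.smult_closed[OF a y(1)] unfolding augmentation_single by blast
    next
      case (add u v)
      then obtain y y' where "y \<in> carrier ?C" "y' \<in> carrier ?C"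
        "bd y = u - Poly_Mapping.single \<one>\<^bsub>\<Gamma>\<^esub> (augmentation u)"
        "bd y' = v - Poly_Mapping.single \<one>\<^bsub>\<Gamma>\<^esub> (augmentation v)" by blast
      then show ?case unfolding augmentation_add single_add
        using left_module_homD(2)[OF bd, of y y'] by (intro bexI[of _ "y \<oplus>\<^bsub>?C\<^esub> y'"]) auto
    qed
    then show ?thesis using u(2) by auto
  qed
  obtain P\<^sub>0 P\<^sub>1 P\<^sub>2 :: "('g \<Rightarrow>\<^sub>0 rat, nat \<Rightarrow> 'g \<Rightarrow>\<^sub>0 rat) module" and d\<^sub>2 d\<^sub>1 \<epsilon> where
    P: "projective_module ?R P\<^sub>0" "projective_module ?R P\<^sub>1" "projective_module ?R P\<^sub>2" "finitely_generated_module ?R P\<^sub>2"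
    and d: "d\<^sub>2 \<in> left_module_hom ?R P\<^sub>2 P\<^sub>1" "d\<^sub>1 \<in> left_module_hom ?R P\<^sub>1 P\<^sub>0" and \<epsilon>: "\<epsilon> \<in> left_module_hom ?R P\<^sub>0 ?T"
    and ex: "d\<^sub>2 ` carrier P\<^sub>2 = {x \<in> carrier P\<^sub>1. d\<^sub>1 x = \<zero>\<^bsub>P\<^sub>0\<^esub>}" "d\<^sub>1 ` carrier P\<^sub>1 = {x \<in> carrier P\<^sub>0. \<epsilon> x = \<zero>\<^bsub>?T\<^esub>}"
      "\<epsilon> ` carrier P\<^sub>0 = carrier ?T"
    using FP unfolding type_FP2_rat_def a_kernel_def kernel_def by auto
  have mod: "left_module ?R P\<^sub>0" "left_module ?R P\<^sub>1" "left_module ?R P\<^sub>2" using P by (auto simp: projective_module_def)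
  obtain f\<^sub>0 g\<^sub>0 where f\<^sub>0: "f\<^sub>0 \<in> left_module_hom ?R (regular_module ?R) P\<^sub>0"
     "\<And>u. u \<in> carrier ?R \<Longrightarrow> \<epsilon> (f\<^sub>0 u) = augmentation u"
    and g\<^sub>0: "g\<^sub>0 \<in> left_module_hom ?R P\<^sub>0 (regular_module ?R)" "\<And>x. x \<in> carrier P\<^sub>0 \<Longrightarrow> augmentation (g\<^sub>0 x) = \<epsilon> x"
    using resolution_start[OF \<Gamma> P(1) \<epsilon> ex(3)] by blast
  have bdR: "bd y \<in> carrier ?R" if "y \<in> carrier ?C" for y using left_module_homD(1)[OF bd that] by simp
  have "\<exists>x\<in>carrier P\<^sub>1. d\<^sub>1 x = f\<^sub>0 (bd (unit_vector ?R s))" if "s \<in> S" for s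
  proof -
    have "bd (unit_vector ?R s) \<in> carrier ?R" using unit_vector_closed[OF R that] by (rule bdR)
    then have "f\<^sub>0 (bd (unit_vector ?R s)) \<in> d\<^sub>1 ` carrier P\<^sub>1"
      unfolding ex(2) using f\<^sub>0 left_module_homD(1)[OF f\<^sub>0(1)] aug_bd by simp
    then show ?thesis by auto
  qed
  then obtain b where b: "\<And>s. s \<in> S \<Longrightarrow> b s \<in> carrier P\<^sub>1" "\<And>s. s \<in> S \<Longrightarrow> d\<^sub>1 (b s) = f\<^sub>0 (bd (unit_vector ?R s))"
    by metis
  obtain f\<^sub>1 where f\<^sub>1: "f\<^sub>1 \<in> left_module_hom ?R ?C P\<^sub>1" "\<And>s. s \<in> S \<Longrightarrow> f\<^sub>1 (unit_vector ?R s) = b s"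
    using free_module_lift[where I=S and b=b, OF mod(2) b(1)] by blast
  have df: "d\<^sub>1 (f\<^sub>1 y) = f\<^sub>0 (bd y)" if "y \<in> carrier ?C" for y
    using free_module_hom_eq[OF mod(1) left_module_hom_comp[OF f\<^sub>1(1) d(2)] left_module_hom_comp[OF bd f\<^sub>0(1)] _ that]
      f\<^sub>1(2) b(2) by simp
  have "(\<lambda>x. g\<^sub>0 (d\<^sub>1 x)) ` carrier P\<^sub>1 \<subseteq> bd ` carrier ?C"
  proof (intro image_subsetI exact)
    fix x assume x: "x \<in> carrier P\<^sub>1"
    then have "d\<^sub>1 x \<in> {x \<in> carrier P\<^sub>0. \<epsilon> x = \<zero>\<^bsub>?T\<^esub>}" unfolding ex(2)[symmetric] by blast
    then show "g\<^sub>0 (d\<^sub>1 x) \<in> carrier ?R" "augmentation (g\<^sub>0 (d\<^sub>1 x)) = 0"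
      using left_module_homD(1)[OF g\<^sub>0(1)] g\<^sub>0(2) by auto
  qed
  then obtain g\<^sub>1 where g\<^sub>1: "g\<^sub>1 \<in> left_module_hom ?R P\<^sub>1 ?C" "\<And>x. x \<in> carrier P\<^sub>1 \<Longrightarrow> bd (g\<^sub>1 x) = g\<^sub>0 (d\<^sub>1 x)"
    using projective_lift[OF P(2) C.left_module_axioms reg left_module_hom_comp[OF d(2) g\<^sub>0(1)] bd] by blast
  have o: "?s \<one>\<^bsub>\<Gamma>\<^esub> \<in> carrier ?R" by simp
  have gf: "g\<^sub>0 (f\<^sub>0 u) \<in> carrier ?R" if "u \<in> carrier ?R" for u
    using left_module_homD(1)[OF g\<^sub>0(1)] left_module_homD(1)[OF f\<^sub>0(1)] that by simp
  have "?s \<one>\<^bsub>\<Gamma>\<^esub> - g\<^sub>0 (f\<^sub>0 (?s \<one>\<^bsub>\<Gamma>\<^esub>)) \<in> bd ` carrier ?C"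
  proof (rule exact)
    show "?s \<one>\<^bsub>\<Gamma>\<^esub> - g\<^sub>0 (f\<^sub>0 (?s \<one>\<^bsub>\<Gamma>\<^esub>)) \<in> carrier ?R" using o gf[OF o] by (rule group_ring_diff_closed)
    have "f\<^sub>0 (?s \<one>\<^bsub>\<Gamma>\<^esub>) \<in> carrier P\<^sub>0" using left_module_homD(1)[OF f\<^sub>0(1)] o by simp
    then show "augmentation (?s \<one>\<^bsub>\<Gamma>\<^esub> - g\<^sub>0 (f\<^sub>0 (?s \<one>\<^bsub>\<Gamma>\<^esub>))) = 0"
      unfolding augmentation_diff g\<^sub>0(2)[OF \<open>f\<^sub>0 (?s \<one>\<^bsub>\<Gamma>\<^esub>) \<in> carrier P\<^sub>0\<close>] f\<^sub>0(2)[OF o] by simp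
  qed
  then obtain c where c: "c \<in> carrier ?C" "?s \<one>\<^bsub>\<Gamma>\<^esub> - g\<^sub>0 (f\<^sub>0 (?s \<one>\<^bsub>\<Gamma>\<^esub>)) = bd c" by blast
  then have c_eq: "bd c + g\<^sub>0 (f\<^sub>0 (?s \<one>\<^bsub>\<Gamma>\<^esub>)) = ?s \<one>\<^bsub>\<Gamma>\<^esub>" by (simp add: diff_eq_eq)
  have homotopy: "bd (u \<odot>\<^bsub>?C\<^esub> c) \<oplus>\<^bsub>regular_module ?R\<^esub> g\<^sub>0 (f\<^sub>0 u) = u" if u: "u \<in> carrier (regular_module ?R)" for u
  proof -
    have "bd (u \<odot>\<^bsub>?C\<^esub> c) = u \<otimes>\<^bsub>?R\<^esub> bd c" using left_module_homD(3)[OF bd _ c(1), of u] u by simp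
    moreover have "g\<^sub>0 (f\<^sub>0 u) = u \<otimes>\<^bsub>?R\<^esub> g\<^sub>0 (f\<^sub>0 (?s \<one>\<^bsub>\<Gamma>\<^esub>))"
      using left_module_homD(3)[OF left_module_hom_comp[OF f\<^sub>0(1) g\<^sub>0(1)], of u "?s \<one>\<^bsub>\<Gamma>\<^esub>"] u o R.r_one[of u] by simp
    ultimately show ?thesis
      using c_eq u R.r_one[of u] by (simp flip: group_ring_distr)
  qed
  obtain B where B: "finite B" "B \<subseteq> carrier ?C" "\<And>z. z \<in> B \<Longrightarrow> bd z = 0"
    and gen: "\<And>L z. submodule L ?R ?C \<Longrightarrow> B \<subseteq> L \<Longrightarrow> z \<in> carrier ?C \<Longrightarrow> bd z = 0 \<Longrightarrow> z \<in> L"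
  proof (rule finitely_generated_cycles[OF mod(2,1) C.left_module_axioms reg mod(3) P(4)
        finitely_generated_free_module[OF R S(1)] d ex(1) bd f\<^sub>0(1) f\<^sub>1(1) _ g\<^sub>0(1) g\<^sub>1(1) _
        regular_module_hom[OF C.left_module_axioms c(1)]])
  qed (rule df, assumption, rule g\<^sub>1(2), assumption, rule homotopy, assumption, auto)
  (* The section is normalised at 1, so that the telescoping sums start and end without a correction. *)
  have "\<exists>h\<in>carrier H. p h = g \<and> (g = \<one>\<^bsub>\<Gamma>\<^esub> \<longrightarrow> h = \<one>\<^bsub>H\<^esub>)" if "g \<in> carrier \<Gamma>" for g
  proof (cases "g = \<one>\<^bsub>\<Gamma>\<^esub>")
    case False
    then show ?thesis using that p(2) by (metis imageE)
  qed auto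
  then obtain \<sigma> where \<sigma>: "\<And>g. g \<in> carrier \<Gamma> \<Longrightarrow> \<sigma> g \<in> carrier H" "\<And>g. g \<in> carrier \<Gamma> \<Longrightarrow> p (\<sigma> g) = g"
    and \<sigma>1: "\<sigma> \<one>\<^bsub>\<Gamma>\<^esub> = \<one>\<^bsub>H\<^esub>" by (metis \<Gamma>.one_closed)
  define m where "m g s = \<sigma> g \<otimes>\<^bsub>H\<^esub> s \<otimes>\<^bsub>H\<^esub> inv\<^bsub>H\<^esub> \<sigma> (g \<otimes>\<^bsub>\<Gamma>\<^esub> p s)" for g s
  have m: "m g s \<in> kernel H \<Gamma> p" if "g \<in> carrier \<Gamma>" "s \<in> S" for g s
    using that S(2) \<sigma> ps[OF that(2)] by (auto simp: m_def kernel_def subset_iff)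
  define Z where "Z = (\<Union>b\<in>B. \<Union>s\<in>S. (\<lambda>g. m g s) ` Poly_Mapping.keys (b s))"
  have key: "g \<in> carrier \<Gamma>" if "b \<in> B" "g \<in> Poly_Mapping.keys (b s)" for b s g
    using that B(2) C_carrier[of b s] by auto
  show thesis
  proof (rule that[of Z])
    show "finite Z" using B(1) S(1) by (simp add: Z_def)
    show "Z \<subseteq> kernel H \<Gamma> p" using m key by (auto simp: Z_def)
  next
    fix \<chi> :: "'h \<Rightarrow> rat" and k
    assume \<chi>: "\<And>x y. x \<in> kernel H \<Gamma> p \<Longrightarrow> y \<in> kernel H \<Gamma> p \<Longrightarrow> \<chi> (x \<otimes>\<^bsub>H\<^esub> y) = \<chi> x + \<chi> y"
      and \<chi>Z: "\<And>h z. h \<in> carrier H \<Longrightarrow> z \<in> Z \<Longrightarrow> \<chi> (h \<otimes>\<^bsub>H\<^esub> z \<otimes>\<^bsub>H\<^esub> inv\<^bsub>H\<^esub> h) = 0" and k: "k \<in> kernel H \<Gamma> p"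
    have ker: "subgroup (kernel H \<Gamma> p) H" by (rule p.subgroup_kernel)
    have \<chi>1: "\<chi> \<one>\<^bsub>H\<^esub> = 0" using \<chi>[of "\<one>\<^bsub>H\<^esub>" "\<one>\<^bsub>H\<^esub>"] subgroup.one_closed[OF ker] by simp
    have \<chi>inv: "\<chi> (inv\<^bsub>H\<^esub> x) = - \<chi> x" if "x \<in> kernel H \<Gamma> p" for x
    proof -
      have "x \<in> carrier H" "inv\<^bsub>H\<^esub> x \<in> kernel H \<Gamma> p" using that ker by (auto simp: subgroup.m_inv_closed dest: subgroup.mem_carrier)
      then show ?thesis using \<chi>[of x "inv\<^bsub>H\<^esub> x"] that \<chi>1 by simp
    qed
    define \<omega> where "\<omega> g s = \<chi> (m g s)" for g s
    have cycle: "X \<omega> (Poly_Mapping.single g a \<odot>\<^bsub>?C\<^esub> b) = 0" if g: "g \<in> carrier \<Gamma>" and b: "b \<in> B" for g a b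
    proof -
      define \<kappa> where "\<kappa> g' = \<chi> (\<sigma> g \<otimes>\<^bsub>H\<^esub> \<sigma> g' \<otimes>\<^bsub>H\<^esub> inv\<^bsub>H\<^esub> \<sigma> (g \<otimes>\<^bsub>\<Gamma>\<^esub> g'))" for g'
      have \<omega>_eq: "\<omega> (g \<otimes>\<^bsub>\<Gamma>\<^esub> g') s = \<kappa> (g' \<otimes>\<^bsub>\<Gamma>\<^esub> p s) - \<kappa> g'" if s: "s \<in> S" and g': "g' \<in> Poly_Mapping.keys (b s)" for s g'
      proof -
        have g'\<Gamma>: "g' \<in> carrier \<Gamma>" using key b g' by blast
        define x where "x = \<sigma> g \<otimes>\<^bsub>H\<^esub> \<sigma> g' \<otimes>\<^bsub>H\<^esub> inv\<^bsub>H\<^esub> \<sigma> (g \<otimes>\<^bsub>\<Gamma>\<^esub> g')"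
        define y where "y = \<sigma> g \<otimes>\<^bsub>H\<^esub> \<sigma> (g' \<otimes>\<^bsub>\<Gamma>\<^esub> p s) \<otimes>\<^bsub>H\<^esub> inv\<^bsub>H\<^esub> \<sigma> (g \<otimes>\<^bsub>\<Gamma>\<^esub> (g' \<otimes>\<^bsub>\<Gamma>\<^esub> p s))"
        define z where "z = \<sigma> g \<otimes>\<^bsub>H\<^esub> m g' s \<otimes>\<^bsub>H\<^esub> inv\<^bsub>H\<^esub> \<sigma> g"
        have c: "s \<in> carrier H" "\<sigma> g \<in> carrier H" "\<sigma> g' \<in> carrier H" "p s \<in> carrier \<Gamma>"
            "\<sigma> (g \<otimes>\<^bsub>\<Gamma>\<^esub> g') \<in> carrier H" "\<sigma> (g' \<otimes>\<^bsub>\<Gamma>\<^esub> p s) \<in> carrier H" "\<sigma> (g \<otimes>\<^bsub>\<Gamma>\<^esub> (g' \<otimes>\<^bsub>\<Gamma>\<^esub> p s)) \<in> carrier H"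
          using \<sigma>(1) g g'\<Gamma> s S(2) ps by auto
        have xy: "x \<in> kernel H \<Gamma> p" "y \<in> kernel H \<Gamma> p"
          using c g g'\<Gamma> \<sigma> by (simp_all add: x_def y_def kernel_def)
        have z: "z \<in> kernel H \<Gamma> p"
          using c g m[OF g'\<Gamma> s] \<sigma> by (simp add: z_def kernel_def)
        have "x \<otimes>\<^bsub>H\<^esub> m (g \<otimes>\<^bsub>\<Gamma>\<^esub> g') s = z \<otimes>\<^bsub>H\<^esub> y"
          using c g g'\<Gamma> unfolding x_def y_def z_def m_def
          by (simp add: H.m_assoc \<Gamma>.m_assoc cancel)
        moreover have "m (g \<otimes>\<^bsub>\<Gamma>\<^esub> g') s \<in> kernel H \<Gamma> p" using m s g g'\<Gamma> by simp
        ultimately have "\<chi> x + \<omega> (g \<otimes>\<^bsub>\<Gamma>\<^esub> g') s = \<chi> z + \<chi> y"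
          using xy z by (simp add: \<omega>_def flip: \<chi>)
        moreover have "\<chi> z = 0" unfolding z_def using c s g' b by (intro \<chi>Z) (auto simp: Z_def)
        ultimately show ?thesis by (simp add: \<kappa>_def x_def y_def)
      qed
      have "linear_extension (\<lambda>g'. \<omega> (g \<otimes>\<^bsub>\<Gamma>\<^esub> g') s) (b s)
          = linear_extension \<kappa> (b s \<otimes>\<^bsub>?R\<^esub> (?s (p s) - ?s \<one>\<^bsub>\<Gamma>\<^esub>))" if s: "s \<in> S" for s
      proof -
        have "b s \<otimes>\<^bsub>?R\<^esub> (u - v) = b s \<otimes>\<^bsub>?R\<^esub> u - b s \<otimes>\<^bsub>?R\<^esub> v" for u v
          using group_ring_distr[of \<Gamma> "b s" "u - v" v] by (simp add: eq_diff_eq)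
        moreover have "b s \<otimes>\<^bsub>?R\<^esub> ?s \<one>\<^bsub>\<Gamma>\<^esub> = b s" using R.r_one[OF C_carrier, of b s] B(2) b by auto
        ultimately have "linear_extension \<kappa> (b s \<otimes>\<^bsub>?R\<^esub> (?s (p s) - ?s \<one>\<^bsub>\<Gamma>\<^esub>))
            = linear_extension (\<lambda>g'. \<kappa> (g' \<otimes>\<^bsub>\<Gamma>\<^esub> p s)) (b s) - linear_extension \<kappa> (b s)"
          by (simp add: linear_extension_diff linear_extension_mult_right)
        also have "\<dots> = linear_extension (\<lambda>g'. \<kappa> (g' \<otimes>\<^bsub>\<Gamma>\<^esub> p s) - \<kappa> g') (b s)"
          by (simp add: linear_extension_def right_diff_distrib sum_subtractf)
        also have "\<dots> = linear_extension (\<lambda>g'. \<omega> (g \<otimes>\<^bsub>\<Gamma>\<^esub> g') s) (b s)"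
          unfolding linear_extension_def using \<omega>_eq[OF s] by (intro sum.cong) auto
        finally show ?thesis ..
      qed
      then have "(\<Sum>s\<in>S. linear_extension (\<lambda>g'. \<omega> (g \<otimes>\<^bsub>\<Gamma>\<^esub> g') s) (b s)) = linear_extension \<kappa> (bd b)"
        by (simp add: bd_def linear_extension_sum)
      then show ?thesis
        by (simp add: X_def C_simps linear_extension_mult_left B(3)[OF b] flip: sum_distrib_left)
    qed
    (* Quantifying over all multiples makes L a submodule, although the functional is only rationally linear. *)
    define L where "L = {y \<in> carrier ?C. \<forall>r\<in>carrier ?R. X \<omega> (r \<odot>\<^bsub>?C\<^esub> y) = 0}"
    have "submodule L ?R ?C"
    proof (rule C.submoduleI)
      show "\<zero>\<^bsub>?C\<^esub> \<in> L" by (simp add: L_def C.smult_zero_right) (simp add: X_def C_simps)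
    next
      fix x y assume "x \<in> L" "y \<in> L"
      then show "x \<oplus>\<^bsub>?C\<^esub> y \<in> L" by (auto simp: L_def C.smult_r_distr X_add)
    next
      fix a x assume a: "a \<in> carrier ?R" and x: "x \<in> L"
      have "X \<omega> (r \<odot>\<^bsub>?C\<^esub> (a \<odot>\<^bsub>?C\<^esub> x)) = 0" if r: "r \<in> carrier ?R" for r
        using x R.m_closed[OF r a] C.smult_assoc[OF r a] unfolding L_def by auto
      then show "a \<odot>\<^bsub>?C\<^esub> x \<in> L" using x C.smult_closed[OF a] by (auto simp: L_def)
    qed (auto simp: L_def)
    moreover have "B \<subseteq> L"
    proof
      fix b assume b: "b \<in> B"
      have "X \<omega> (r \<odot>\<^bsub>?C\<^esub> b) = 0" if "r \<in> carrier ?R" for r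
      proof -
        have "Poly_Mapping.keys r \<subseteq> carrier \<Gamma>" using that by simp
        then show ?thesis
        proof (induction r rule: group_ring_induct)
          case (add u v)
          then show ?case by (simp add: X_def C_simps group_ring_distl linear_extension_add sum.distrib)
        qed (use cycle b in \<open>simp_all add: X_def C_simps group_ring_zero\<close>)
      qed
      then show "b \<in> L" using b B(2) by (auto simp: L_def)
    qed
    ultimately have L: "y \<in> L" if "y \<in> carrier ?C" "bd y = 0" for y using gen that by blast
    have vanish: "X \<omega> y = 0" if "y \<in> carrier ?C" "bd y = 0" for y
    proof -
      have "X \<omega> (?s \<one>\<^bsub>\<Gamma>\<^esub> \<odot>\<^bsub>?C\<^esub> y) = 0" using L[OF that] o unfolding L_def by blast
      then show ?thesis using C.smult_one[OF that(1)] by simp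
    qed
    define U where "U h = \<chi> (h \<otimes>\<^bsub>H\<^esub> inv\<^bsub>H\<^esub> \<sigma> (p h))" for h
    have "U \<one>\<^bsub>H\<^esub> = 0" by (simp add: U_def \<sigma>1 \<chi>1)
    moreover have "U (h \<otimes>\<^bsub>H\<^esub> s) = U h + \<omega> (p h) s" if h: "h \<in> carrier H" and s: "s \<in> S" for h s
    proof -
      have c: "s \<in> carrier H" "p h \<in> carrier \<Gamma>" "\<sigma> (p h) \<in> carrier H" "p s \<in> carrier \<Gamma>" "\<sigma> (p h \<otimes>\<^bsub>\<Gamma>\<^esub> p s) \<in> carrier H"
        using h s S(2) \<sigma> ps by auto
      have "h \<otimes>\<^bsub>H\<^esub> s \<otimes>\<^bsub>H\<^esub> inv\<^bsub>H\<^esub> \<sigma> (p (h \<otimes>\<^bsub>H\<^esub> s)) = (h \<otimes>\<^bsub>H\<^esub> inv\<^bsub>H\<^esub> \<sigma> (p h)) \<otimes>\<^bsub>H\<^esub> m (p h) s"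
        using c h by (simp add: m_def H.m_assoc cancel)
      moreover have "h \<otimes>\<^bsub>H\<^esub> inv\<^bsub>H\<^esub> \<sigma> (p h) \<in> kernel H \<Gamma> p" using c h \<sigma>(2) by (simp add: kernel_def)
      ultimately show ?thesis using m[OF c(2) s] by (simp add: U_def \<omega>_def \<chi>)
    qed
    moreover have kH: "k \<in> carrier H" "p k = \<one>\<^bsub>\<Gamma>\<^esub>" using k by (auto simp: kernel_def)
    ultimately obtain y where "y \<in> carrier ?C" "bd y = ?s (p k) - ?s \<one>\<^bsub>\<Gamma>\<^esub>" "X \<omega> y = U k"
      using path[of U \<omega> k] by blast
    then have "U k = 0" using vanish kH(2) by simp
    then show "\<chi> k = 0" using kH by (simp add: U_def \<sigma>1)
  qed
qed

section \<open>Subgroups of quotients by free normal subgroups\<close>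

lemma (in group) generate_finite_support:
  assumes "x \<in> generate G A" obtains F where "finite F" "F \<subseteq> A" "x \<in> generate G F"
proof -
  have "\<exists>F. finite F \<and> F \<subseteq> A \<and> x \<in> generate G F"
    using assms
  proof (induction rule: generate.induct)
    case one
    then show ?case using generate.one by blast
  next
    case (incl h)
    then show ?case by (intro exI[of _ "{h}"]) (auto intro: generate.incl)
  next
    case (inv h)
    then show ?case by (intro exI[of _ "{h}"]) (auto intro: generate.inv)
  next
    case (eng h k)
    then obtain F F' where "finite F" "F \<subseteq> A" "h \<in> generate G F" "finite F'" "F' \<subseteq> A" "k \<in> generate G F'" by blast
    moreover from this have "h \<in> generate G (F \<union> F')" "k \<in> generate G (F \<union> F')"
      using mono_generate[of F "F \<union> F'"] mono_generate[of F' "F \<union> F'"] by auto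
    ultimately show ?case by (intro exI[of _ "F \<union> F'"]) (auto intro: generate.eng)
  qed
  then show thesis using that by blast
qed

lemma (in group) finite_generate_finite_support:
  assumes "finite Z" "Z \<subseteq> generate G A" obtains F where "finite F" "F \<subseteq> A" "Z \<subseteq> generate G F"
proof -
  have "\<forall>z\<in>Z. \<exists>F. finite F \<and> F \<subseteq> A \<and> z \<in> generate G F"
    using assms(2) generate_finite_support by (metis subsetD)
  then obtain f where f: "\<And>z. z \<in> Z \<Longrightarrow> finite (f z) \<and> f z \<subseteq> A \<and> z \<in> generate G (f z)" by metis
  have "z \<in> generate G (\<Union>(f ` Z))" if "z \<in> Z" for z
    using f[OF that] mono_generate[of "f z" "\<Union>(f ` Z)"] that by blast
  moreover have "finite (\<Union>(f ` Z))" "\<Union>(f ` Z) \<subseteq> A" using f assms(1) by auto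
  ultimately show thesis using that[of "\<Union>(f ` Z)"] by blast
qed

context free_on_generators
begin

lemma N_generated: "N = generate G (t ` T)"
proof
  have c: "t ` T \<subseteq> N" using gen_N by blast
  then show "generate G (t ` T) \<subseteq> N" using subgroup_N by (rule generate_subgroup_incl)
  have "subgroup (generate G (t ` T)) G" using c N_carrier by (intro generate_is_subgroup) auto
  then show "N \<subseteq> generate G (t ` T)" by (rule subset_if_gens) (auto intro: generate.incl)
qed

text \<open>
  The condition \<open>conj\<close> says that \<open>G\<close> permutes the \<open>N\<close>-conjugacy classes of basis elements and their
  inverses. It places the generators of \<open>\<Lambda>\<close> below among the loops of the Schreier graph of
  \<open>M = H2 \<inter> N\<close>. Enlarging \<open>H1\<close> to \<open>H2\<close> does not create homomorphisms: as \<open>M\<close> is the product of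
  \<open>H1 \<inter> N\<close> and \<open>\<Lambda>\<close>, a homomorphism on \<open>M\<close> that kills \<open>\<Lambda>\<close> is determined on \<open>H1 \<inter> N\<close>, where it kills
  the conjugates of \<open>Z \<subseteq> \<Lambda>\<close>.
\<close>

lemma subgroup_of_quotient_finitely_presented:
  assumes coherent: "coherent_group G" and normal: "N \<lhd> G"
    and conj: "\<And>h K. h \<in> carrier G \<Longrightarrow> K \<in> T \<Longrightarrow> \<exists>x\<in>N. \<exists>l\<in>letters. h \<otimes> t K \<otimes> inv h = x \<otimes> l \<otimes> inv x"
    and Q: "subgroup Q (G Mod N)" and FP: "type_FP2_rat ((G Mod N)\<lparr>carrier := Q\<rparr>)"
  shows "finitely_presented_group ((G Mod N)\<lparr>carrier := Q\<rparr>)"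
proof -
  interpret N: normal N G by fact
  interpret GN: group "G Mod N" by (rule N.factorgroup_is_group)
  define \<Gamma> where "\<Gamma> = (G Mod N)\<lparr>carrier := Q\<rparr>"
  have \<Gamma>: "group \<Gamma>" unfolding \<Gamma>_def using Q by (rule GN.subgroup_imp_group)
  have \<Gamma>_simps: "carrier \<Gamma> = Q" "(\<otimes>\<^bsub>\<Gamma>\<^esub>) = (\<otimes>\<^bsub>G Mod N\<^esub>)" "\<one>\<^bsub>\<Gamma>\<^esub> = N" by (simp_all add: \<Gamma>_def FactGroup_def)
  have FP: "type_FP2_rat \<Gamma>" using FP by (simp add: \<Gamma>_def)
  define \<pi> where "\<pi> x = N #> x" for x
  interpret \<pi>: group_hom G "G Mod N" \<pi>
    using N.r_coset_hom_Mod by (simp add: group_hom_def group_hom_axioms_def group_axioms GN.group_axioms \<pi>_def[abs_def])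
  have \<pi>_ker: "\<pi> x = N \<longleftrightarrow> x \<in> N" if "x \<in> carrier G" for x
    unfolding \<pi>_def using that coset_join1[OF _ that N.subgroup_axioms] coset_join2[OF that N.subgroup_axioms] by blast
  obtain S\<Gamma> where S\<Gamma>: "finite S\<Gamma>" "S\<Gamma> \<subseteq> carrier \<Gamma>" "generate \<Gamma> S\<Gamma> = carrier \<Gamma>"
    by (rule finitely_generated_if_FP2[OF \<Gamma> FP])
  have "carrier \<Gamma> \<subseteq> \<pi> ` carrier G"
    using subgroup.subset[OF Q] by (auto simp: \<Gamma>_simps FactGroup_def RCOSETS_def \<pi>_def)
  then obtain S where S: "finite S" "S \<subseteq> carrier G" "\<pi> ` S = S\<Gamma>"
    using S\<Gamma> by (metis finite_subset_image subset_trans)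
  define H1 where "H1 = generate G S"
  have H1: "subgroup H1 G" unfolding H1_def using S(2) by (rule generate_is_subgroup)
  have \<pi>H1: "\<pi> ` H1 = Q"
  proof -
    have "\<pi> ` H1 = generate (G Mod N) S\<Gamma>" unfolding H1_def using \<pi>.generate_img[OF S(2)] S(3) by simp
    also have "\<dots> = generate \<Gamma> S\<Gamma>"
      using GN.generate_consistent[of S\<Gamma> Q] S\<Gamma>(2) Q by (simp add: \<Gamma>_simps) (simp add: \<Gamma>_def)
    finally show ?thesis using S\<Gamma>(3) by (simp add: \<Gamma>_simps)
  qed
  have \<pi>_hom: "\<pi> \<in> hom (G\<lparr>carrier := H\<rparr>) \<Gamma>" "kernel (G\<lparr>carrier := H\<rparr>) \<Gamma> \<pi> = H \<inter> N"
    if H: "subgroup H G" and "\<pi> ` H \<subseteq> Q" for H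
  proof -
    have HG: "H \<subseteq> carrier G" using H by (rule subgroup.subset)
    then show "\<pi> \<in> hom (G\<lparr>carrier := H\<rparr>) \<Gamma>"
      using that(2) by (intro homI) (auto simp: \<Gamma>_simps subset_iff)
    show "kernel (G\<lparr>carrier := H\<rparr>) \<Gamma> \<pi> = H \<inter> N" using HG \<pi>_ker by (auto simp: kernel_def \<Gamma>_simps)
  qed
  have gen_sub: "generate (G\<lparr>carrier := H\<rparr>) A = generate G A" if "subgroup H G" "A \<subseteq> H" for A H
    using generate_consistent[OF that(2,1)] by simp
  have SH1: "S \<subseteq> H1" by (auto simp: H1_def intro: generate.incl)
  obtain Z where Z: "finite Z" "Z \<subseteq> H1 \<inter> N"
    and rel: "\<And>(\<chi> :: 'a \<Rightarrow> rat) m.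
        (\<And>x y. x \<in> H1 \<inter> N \<Longrightarrow> y \<in> H1 \<inter> N \<Longrightarrow> \<chi> (x \<otimes> y) = \<chi> x + \<chi> y) \<Longrightarrow>
        (\<And>h z. h \<in> H1 \<Longrightarrow> z \<in> Z \<Longrightarrow> \<chi> (h \<otimes> z \<otimes> inv h) = 0) \<Longrightarrow> m \<in> H1 \<inter> N \<Longrightarrow> \<chi> m = 0"
  proof -
    have h: "\<pi> ` carrier (G\<lparr>carrier := H1\<rparr>) = carrier \<Gamma>" using \<pi>H1 by (simp add: \<Gamma>_simps)
    have k: "kernel (G\<lparr>carrier := H1\<rparr>) \<Gamma> \<pi> = H1 \<inter> N" and hom: "\<pi> \<in> hom (G\<lparr>carrier := H1\<rparr>) \<Gamma>"
      using \<pi>_hom[OF H1] \<pi>H1 by auto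
    have s: "S \<subseteq> carrier (G\<lparr>carrier := H1\<rparr>)" "generate (G\<lparr>carrier := H1\<rparr>) S = carrier (G\<lparr>carrier := H1\<rparr>)"
      using SH1 gen_sub[OF H1 SH1] by (simp_all add: H1_def)
    show thesis
    proof (rule finitely_many_rational_relations[OF subgroup_imp_group[OF H1] \<Gamma> hom h S(1) s FP])
      fix Z assume Z: "finite Z" "Z \<subseteq> kernel (G\<lparr>carrier := H1\<rparr>) \<Gamma> \<pi>"
      and rel: "\<And>(\<chi> :: 'a \<Rightarrow> rat) m.
        (\<And>x y. x \<in> kernel (G\<lparr>carrier := H1\<rparr>) \<Gamma> \<pi> \<Longrightarrow> y \<in> kernel (G\<lparr>carrier := H1\<rparr>) \<Gamma> \<pi> \<Longrightarrow>
           \<chi> (x \<otimes>\<^bsub>G\<lparr>carrier := H1\<rparr>\<^esub> y) = \<chi> x + \<chi> y) \<Longrightarrow>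
        (\<And>h z. h \<in> carrier (G\<lparr>carrier := H1\<rparr>) \<Longrightarrow> z \<in> Z \<Longrightarrow>
           \<chi> (h \<otimes>\<^bsub>G\<lparr>carrier := H1\<rparr>\<^esub> z \<otimes>\<^bsub>G\<lparr>carrier := H1\<rparr>\<^esub> inv\<^bsub>G\<lparr>carrier := H1\<rparr>\<^esub> h) = 0) \<Longrightarrow>
        m \<in> kernel (G\<lparr>carrier := H1\<rparr>) \<Gamma> \<pi> \<Longrightarrow> \<chi> m = 0"
    have rel': "\<chi> m = 0"
      if "\<And>x y. x \<in> H1 \<inter> N \<Longrightarrow> y \<in> H1 \<inter> N \<Longrightarrow> \<chi> (x \<otimes> y) = \<chi> x + \<chi> y"
        "\<And>h z. h \<in> H1 \<Longrightarrow> z \<in> Z \<Longrightarrow> \<chi> (h \<otimes> z \<otimes> inv h) = 0" "m \<in> H1 \<inter> N" for \<chi> :: "'a \<Rightarrow> rat" and m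
      by (rule rel) (use that m_inv_consistent[OF H1] k in simp_all)
      show thesis using Z(1) Z(2)[unfolded k] rel' by (rule that)
    qed
  qed
  have "Z \<subseteq> generate G (t ` T)" using Z(2) N_generated by blast
  then obtain F where "finite F" "F \<subseteq> t ` T" and ZF: "Z \<subseteq> generate G F"
    using finite_generate_finite_support[OF Z(1)] by blast
  then obtain T1 where T1: "T1 \<subseteq> T" "finite T1" "F = t ` T1" using finite_subset_image by metis
  have tT1: "t ` T1 \<subseteq> N" "t ` T1 \<subseteq> carrier G" using T1(1) gen_N gen_carrier by auto
  define H2 where "H2 = generate G (S \<union> t ` T1)"
  have H2: "subgroup H2 G" unfolding H2_def using S(2) tT1(2) by (intro generate_is_subgroup) auto
  interpret H2: group "G\<lparr>carrier := H2\<rparr>" using H2 by (rule subgroup_imp_group)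
  have SH2: "S \<union> t ` T1 \<subseteq> H2" by (auto simp: H2_def intro: generate.incl)
  have H12: "H1 \<subseteq> H2" unfolding H1_def H2_def by (rule mono_generate) auto
  have H2c: "x \<in> carrier G" if "x \<in> H2" for x using subgroup.mem_carrier[OF H2 that] .
  have \<pi>H2: "\<pi> ` H2 = Q"
  proof
    have "\<pi> ` (S \<union> t ` T1) \<subseteq> Q"
    proof -
      have "\<pi> x = \<one>\<^bsub>G Mod N\<^esub>" if "x \<in> t ` T1" for x using that tT1 \<pi>_ker by (auto simp: FactGroup_def)
      moreover have "\<one>\<^bsub>G Mod N\<^esub> \<in> Q" using Q by (rule subgroup.one_closed)
      ultimately show ?thesis using S(3) S\<Gamma>(2) by (auto simp: \<Gamma>_simps)
    qed
    then have "generate (G Mod N) (\<pi> ` (S \<union> t ` T1)) \<subseteq> Q" using Q by (rule GN.generate_subgroup_incl)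
    then show "\<pi> ` H2 \<subseteq> Q" unfolding H2_def using \<pi>.generate_img[of "S \<union> t ` T1"] S(2) tT1(2) by simp
    show "Q \<subseteq> \<pi> ` H2" using H12 \<pi>H1 by blast
  qed
  define M where "M = H2 \<inter> N"
  have M: "subgroup M G" unfolding M_def using H2 subgroup_N by (rule subgroups_Inter_pair)
  define L where "L = {h \<otimes> t K \<otimes> inv h | h K. h \<in> H2 \<and> K \<in> T1}"
  define \<Lambda> where "\<Lambda> = generate G L"
  have LM: "L \<subseteq> M"
    using SH2 tT1(1) H2c H2 N.inv_op_closed2 by (auto simp: L_def M_def intro!: subgroup.m_closed[OF H2] subgroup.m_inv_closed[OF H2])
  have LG: "L \<subseteq> carrier G" using LM subgroup.subset[OF M] by blast
  have \<Lambda>: "subgroup \<Lambda> G" unfolding \<Lambda>_def using LG by (rule generate_is_subgroup)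
  have \<Lambda>M: "\<Lambda> \<subseteq> M" unfolding \<Lambda>_def using LM M by (rule generate_subgroup_incl)
  have tL: "t ` T1 \<subseteq> L"
  proof
    fix x assume "x \<in> t ` T1"
    then obtain K where K: "K \<in> T1" "x = t K" by blast
    then have "x = \<one> \<otimes> t K \<otimes> inv \<one>" using tT1(2) by auto
    then show "x \<in> L" using K(1) subgroup.one_closed[OF H2] unfolding L_def by blast
  qed
  have H2inv: "inv\<^bsub>G\<lparr>carrier := H2\<rparr>\<^esub> h = inv h" if "h \<in> H2" for h using m_inv_consistent[OF H2 that] .
  have \<Lambda>_gen: "\<Lambda> = generate (G\<lparr>carrier := H2\<rparr>) L"
    unfolding \<Lambda>_def using gen_sub[OF H2] LM by (auto simp: M_def)
  have \<Lambda>_normal: "\<Lambda> \<lhd> G\<lparr>carrier := H2\<rparr>"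
    unfolding \<Lambda>_gen
  proof (rule H2.normal_generateI)
    show "L \<subseteq> carrier (G\<lparr>carrier := H2\<rparr>)" using LM by (auto simp: M_def)
    fix a g assume "a \<in> L" and g: "g \<in> carrier (G\<lparr>carrier := H2\<rparr>)"
    then obtain h K where a: "a = h \<otimes> t K \<otimes> inv h" "h \<in> H2" "K \<in> T1" by (auto simp: L_def)
    have "g \<in> H2" using g by simp
    have "g \<otimes> a \<otimes> inv g = (g \<otimes> h) \<otimes> t K \<otimes> inv (g \<otimes> h)"
      using a \<open>g \<in> H2\<close> H2c tT1(2) by (simp add: inv_mult_group m_assoc image_subset_iff)
    moreover have "g \<otimes> h \<in> H2" using \<open>g \<in> H2\<close> a(2) by (rule subgroup.m_closed[OF H2])
    ultimately have "g \<otimes> a \<otimes> inv g \<in> L" using a(3) unfolding L_def by blast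
    then show "g \<otimes>\<^bsub>G\<lparr>carrier := H2\<rparr>\<^esub> a \<otimes>\<^bsub>G\<lparr>carrier := H2\<rparr>\<^esub> inv\<^bsub>G\<lparr>carrier := H2\<rparr>\<^esub> g \<in> L"
      using H2inv[OF \<open>g \<in> H2\<close>] by simp
  qed
  have \<Lambda>_conj: "h \<otimes> a \<otimes> inv h \<in> \<Lambda>" if "h \<in> H2" "a \<in> \<Lambda>" for h a
    using \<Lambda>_normal that H2inv[OF that(1)] by (auto simp: H2.normal_inv_iff)
  have ZL: "Z \<subseteq> \<Lambda>"
    using ZF generate_subgroup_incl[OF _ \<Lambda>, of "t ` T1"] tL generate.incl[of _ L G] by (auto simp: T1(3) \<Lambda>_def)
  (* H2 normalises Lambda, so the set of products is a subgroup, and it contains the generators of H2. *)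
  have split: "\<exists>h\<in>H1. \<exists>a\<in>\<Lambda>. x = h \<otimes> a" if "x \<in> H2" for x
  proof -
    define P where "P = {h \<otimes> a | h a. h \<in> H1 \<and> a \<in> \<Lambda>}"
    have Pc: "h \<in> carrier G \<and> h \<in> H2 \<and> a \<in> carrier G" if "h \<in> H1" "a \<in> \<Lambda>" for h a
      using that H12 H2c subgroup.mem_carrier[OF \<Lambda>] by blast
    have "subgroup P G"
    proof
      show "P \<subseteq> carrier G" using Pc by (auto simp: P_def)
      have "\<one> = \<one> \<otimes> \<one>" by simp
      then show "\<one> \<in> P" using subgroup.one_closed[OF H1] subgroup.one_closed[OF \<Lambda>] unfolding P_def by blast
    next
      fix x y assume "x \<in> P" "y \<in> P"
      then obtain h a h' a' where *: "x = h \<otimes> a" "y = h' \<otimes> a'" "h \<in> H1" "a \<in> \<Lambda>" "h' \<in> H1" "a' \<in> \<Lambda>" by (auto simp: P_def)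
      note c = Pc[OF *(3,4)] Pc[OF *(5,6)]
      have "inv h' \<in> H2" using c subgroup.m_inv_closed[OF H2] by blast
      then have "inv h' \<otimes> a \<otimes> h' \<in> \<Lambda>" using \<Lambda>_conj[of "inv h'" a] * c by simp
      then have "(inv h' \<otimes> a \<otimes> h') \<otimes> a' \<in> \<Lambda>" by (rule subgroup.m_closed[OF \<Lambda> _ *(6)])
      moreover have "x \<otimes> y = (h \<otimes> h') \<otimes> ((inv h' \<otimes> a \<otimes> h') \<otimes> a')"
      proof -
        have "h' \<otimes> (inv h' \<otimes> a \<otimes> h' \<otimes> a') = a \<otimes> (h' \<otimes> a')" using c by (simp add: m_assoc[symmetric])
        then show ?thesis using * c by (simp add: m_assoc)
      qed
      moreover have "h \<otimes> h' \<in> H1" using * by (intro subgroup.m_closed[OF H1])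
      ultimately show "x \<otimes> y \<in> P" unfolding P_def by blast
    next
      fix x assume "x \<in> P"
      then obtain h a where *: "x = h \<otimes> a" "h \<in> H1" "a \<in> \<Lambda>" by (auto simp: P_def)
      note c = Pc[OF *(2,3)]
      have "h \<otimes> inv a \<otimes> inv h \<in> \<Lambda>" using \<Lambda>_conj c * subgroup.m_inv_closed[OF \<Lambda>] by blast
      moreover have "inv x = inv h \<otimes> (h \<otimes> inv a \<otimes> inv h)" using * c by (simp add: inv_mult_group m_assoc[symmetric])
      moreover have "inv h \<in> H1" using * by (intro subgroup.m_inv_closed[OF H1])
      ultimately show "inv x \<in> P" unfolding P_def by blast
    qed
    moreover have "S \<union> t ` T1 \<subseteq> P"
    proof
      fix x assume x: "x \<in> S \<union> t ` T1"
      then have "x = x \<otimes> \<one>" "x = \<one> \<otimes> x" using SH2 H2c by auto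
      moreover have "x \<in> H1 \<or> x \<in> \<Lambda>" using x SH1 tL by (auto simp: \<Lambda>_def intro: generate.incl)
      ultimately show "x \<in> P"
        using subgroup.one_closed[OF H1] subgroup.one_closed[OF \<Lambda>] unfolding P_def by blast
    qed
    ultimately have "H2 \<subseteq> P" unfolding H2_def by (intro generate_subgroup_incl)
    then show ?thesis using that unfolding P_def by blast
  qed
  have "M = \<Lambda>"
  proof (rule subgroup_eq_if_homs_vanish[OF M _ \<Lambda> \<Lambda>M _ \<Lambda>_def])
    show "M \<subseteq> N" by (simp add: M_def)
    show "m \<otimes> a \<otimes> inv m \<in> \<Lambda>" if "m \<in> M" "a \<in> \<Lambda>" for m a using \<Lambda>_conj that by (simp add: M_def)
    show "\<exists>x\<in>N. \<exists>l\<in>letters. a = x \<otimes> l \<otimes> inv x" if "a \<in> L" for a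
      using that conj H2c T1(1) unfolding L_def by blast
  next
    fix \<chi> :: "'a \<Rightarrow> int" and m
    assume \<chi>: "\<And>x y. x \<in> M \<Longrightarrow> y \<in> M \<Longrightarrow> \<chi> (x \<otimes> y) = \<chi> x + \<chi> y" and \<chi>L: "\<And>a. a \<in> L \<Longrightarrow> \<chi> a = 0" and m: "m \<in> M"
    have \<chi>1: "\<chi> \<one> = 0" using \<chi>[of \<one> \<one>] subgroup.one_closed[OF M] by simp
    have "subgroup {x \<in> M. \<chi> x = 0} G"
    proof
      show "{x \<in> M. \<chi> x = 0} \<subseteq> carrier G" using subgroup.subset[OF M] by blast
      show "\<one> \<in> {x \<in> M. \<chi> x = 0}" using \<chi>1 subgroup.one_closed[OF M] by simp
    next
      fix x y assume "x \<in> {x \<in> M. \<chi> x = 0}" "y \<in> {x \<in> M. \<chi> x = 0}"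
      then show "x \<otimes> y \<in> {x \<in> M. \<chi> x = 0}" using \<chi> subgroup.m_closed[OF M] by simp
    next
      fix x assume x: "x \<in> {x \<in> M. \<chi> x = 0}"
      then have "inv x \<in> M" "x \<otimes> inv x = \<one>" using subgroup.m_inv_closed[OF M] subgroup.mem_carrier[OF M] by auto
      then show "inv x \<in> {x \<in> M. \<chi> x = 0}" using \<chi>[of x "inv x"] x \<chi>1 by simp
    qed
    moreover have "L \<subseteq> {x \<in> M. \<chi> x = 0}" using LM \<chi>L by blast
    ultimately have \<chi>\<Lambda>: "\<chi> a = 0" if "a \<in> \<Lambda>" for a
      using that generate_subgroup_incl[of L "{x \<in> M. \<chi> x = 0}"] unfolding \<Lambda>_def by blast
    have \<chi>H1: "\<chi> x = 0" if x: "x \<in> H1 \<inter> N" for x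
    proof -
      have "rat_of_int (\<chi> x) = 0"
      proof (rule rel[of "\<lambda>x. rat_of_int (\<chi> x)", OF _ _ x])
        fix x y assume "x \<in> H1 \<inter> N" "y \<in> H1 \<inter> N"
        then have "x \<in> M" "y \<in> M" using H12 by (auto simp: M_def)
        then show "rat_of_int (\<chi> (x \<otimes> y)) = rat_of_int (\<chi> x) + rat_of_int (\<chi> y)" by (simp add: \<chi>)
      next
        fix h z assume "h \<in> H1" "z \<in> Z"
        then have "h \<otimes> z \<otimes> inv h \<in> \<Lambda>" using \<Lambda>_conj ZL H12 by blast
        then show "rat_of_int (\<chi> (h \<otimes> z \<otimes> inv h)) = 0" by (simp add: \<chi>\<Lambda>)
      qed
      then show ?thesis by simp
    qed
    obtain h a where ha: "h \<in> H1" "a \<in> \<Lambda>" "m = h \<otimes> a" using split[of m] m unfolding M_def by blast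
    have aN: "a \<in> N" "a \<in> M" using ha(2) \<Lambda>M by (auto simp: M_def)
    have "h = m \<otimes> inv a" using ha subgroup.mem_carrier[OF H1 ha(1)] N_carrier[OF aN(1)] by (simp add: m_assoc)
    then have "h \<in> N" using m aN(1) by (simp add: M_def)
    then have "h \<in> M" "\<chi> h = 0" using ha(1) H12 \<chi>H1 by (auto simp: M_def)
    then show "\<chi> m = 0" using \<chi> aN(2) \<chi>\<Lambda>[OF ha(2)] ha(3) by simp
  qed
  have "\<Lambda> = normal_closure (G\<lparr>carrier := H2\<rparr>) (t ` T1)"
  proof
    have sub: "t ` T1 \<subseteq> carrier (G\<lparr>carrier := H2\<rparr>)" using SH2 by simp
    note nc = normal_closure_normal[OF H2.group_axioms sub]
    have "L \<subseteq> normal_closure (G\<lparr>carrier := H2\<rparr>) (t ` T1)"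
    proof
      fix a assume "a \<in> L"
      then obtain h K where a: "a = h \<otimes> t K \<otimes> inv h" "h \<in> H2" "K \<in> T1" by (auto simp: L_def)
      have "t K \<in> normal_closure (G\<lparr>carrier := H2\<rparr>) (t ` T1)" using nc(2) a(3) by blast
      then show "a \<in> normal_closure (G\<lparr>carrier := H2\<rparr>) (t ` T1)"
        using nc(1) a H2inv[OF a(2)] by (auto simp: H2.normal_inv_iff)
    qed
    then show "\<Lambda> \<subseteq> normal_closure (G\<lparr>carrier := H2\<rparr>) (t ` T1)"
      unfolding \<Lambda>_gen by (rule H2.generate_subgroup_incl) (rule normal_imp_subgroup[OF nc(1)])
    show "normal_closure (G\<lparr>carrier := H2\<rparr>) (t ` T1) \<subseteq> \<Lambda>"
      using \<Lambda>_normal tL by (intro normal_closure_least) (auto simp: \<Lambda>_def intro: generate.incl)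
  qed
  moreover have "kernel (G\<lparr>carrier := H2\<rparr>) \<Gamma> \<pi> = M" using \<pi>_hom(2)[OF H2] \<pi>H2 by (simp add: M_def)
  ultimately have ker: "kernel (G\<lparr>carrier := H2\<rparr>) \<Gamma> \<pi> = normal_closure (G\<lparr>carrier := H2\<rparr>) (t ` T1)"
    using \<open>M = \<Lambda>\<close> by simp
  have "finitely_generated_group (G\<lparr>carrier := H2\<rparr>)"
    unfolding finitely_generated_group_def
    using H2.group_axioms S(1) T1(2) SH2 gen_sub[OF H2 SH2] by (auto simp: H2_def[symmetric] intro!: exI[of _ "S \<union> t ` T1"])
  then have "finitely_presented_group (G\<lparr>carrier := H2\<rparr>)"
    using coherent H2 by (simp add: coherent_group_def)
  then have "finitely_presented_group \<Gamma>"
    using \<Gamma> \<pi>_hom(1)[OF H2] \<pi>H2 T1(2) SH2 ker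
    by (intro finitely_presented_quotient[of "G\<lparr>carrier := H2\<rparr>" \<Gamma> \<pi> "t ` T1"]) (auto simp: \<Gamma>_simps)
  then show ?thesis by (simp add: \<Gamma>_def)
qed

end

section \<open>Cohen--Lyndon pairs with infinite cyclic stabilisers\<close>

lemma conjugate_set_eq:
  assumes "group G" "g \<in> carrier G" "K \<subseteq> carrier G"
  shows "conjugate_set G g K = (\<lambda>k. g \<otimes>\<^bsub>G\<^esub> k \<otimes>\<^bsub>G\<^esub> inv\<^bsub>G\<^esub> g) ` K"
  by (auto simp: conjugate_set_def l_coset_def r_coset_def)

lemma (in group_action) conjugate_stabilizer:
  assumes g: "g \<in> carrier G" and x: "x \<in> E"
  shows "conjugate_set G g (stabilizer G \<phi> x) = stabilizer G \<phi> (\<phi> g x)"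
proof -
  interpret G: group G using group_hom group_hom.axioms(1) by blast
  have gx: "\<phi> g x \<in> E" using element_image[OF g x] by simp
  have fwd: "g' \<otimes>\<^bsub>G\<^esub> k \<otimes>\<^bsub>G\<^esub> inv\<^bsub>G\<^esub> g' \<in> stabilizer G \<phi> (\<phi> g' y)"
    if "g' \<in> carrier G" "y \<in> E" "k \<in> stabilizer G \<phi> y" for g' y k
  proof -
    have k: "k \<in> carrier G" "\<phi> k y = y" using that(3) by (auto simp: stabilizer_def)
    have "\<phi> g' y \<in> E" using element_image[OF that(1,2)] by simp
    then have "\<phi> (g' \<otimes>\<^bsub>G\<^esub> k \<otimes>\<^bsub>G\<^esub> inv\<^bsub>G\<^esub> g') (\<phi> g' y) = \<phi> (g' \<otimes>\<^bsub>G\<^esub> k \<otimes>\<^bsub>G\<^esub> inv\<^bsub>G\<^esub> g' \<otimes>\<^bsub>G\<^esub> g') y"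
      using composition_rule[of y "g' \<otimes>\<^bsub>G\<^esub> k \<otimes>\<^bsub>G\<^esub> inv\<^bsub>G\<^esub> g'" g'] that k by simp
    also have "g' \<otimes>\<^bsub>G\<^esub> k \<otimes>\<^bsub>G\<^esub> inv\<^bsub>G\<^esub> g' \<otimes>\<^bsub>G\<^esub> g' = g' \<otimes>\<^bsub>G\<^esub> k" using that k by (simp add: G.m_assoc)
    also have "\<phi> (g' \<otimes>\<^bsub>G\<^esub> k) y = \<phi> g' y" using composition_rule[OF that(2,1) k(1)] k(2) by simp
    finally show ?thesis using that k by (simp add: stabilizer_def)
  qed
  have "h \<in> (\<lambda>k. g \<otimes>\<^bsub>G\<^esub> k \<otimes>\<^bsub>G\<^esub> inv\<^bsub>G\<^esub> g) ` stabilizer G \<phi> x" if h: "h \<in> stabilizer G \<phi> (\<phi> g x)" for h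
  proof (rule image_eqI)
    have hG: "h \<in> carrier G" using h by (simp add: stabilizer_def)
    show "inv\<^bsub>G\<^esub> g \<otimes>\<^bsub>G\<^esub> h \<otimes>\<^bsub>G\<^esub> inv\<^bsub>G\<^esub> (inv\<^bsub>G\<^esub> g) \<in> stabilizer G \<phi> x"
      using fwd[OF G.inv_closed[OF g] gx h] orbit_sym_aux[OF g x refl] by simp
    have "g \<otimes>\<^bsub>G\<^esub> (inv\<^bsub>G\<^esub> g \<otimes>\<^bsub>G\<^esub> h) = h" using g hG by (simp flip: G.m_assoc)
    then show "h = g \<otimes>\<^bsub>G\<^esub> (inv\<^bsub>G\<^esub> g \<otimes>\<^bsub>G\<^esub> h \<otimes>\<^bsub>G\<^esub> inv\<^bsub>G\<^esub> (inv\<^bsub>G\<^esub> g)) \<otimes>\<^bsub>G\<^esub> inv\<^bsub>G\<^esub> g"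
      using g hG by (simp add: G.m_assoc)
  qed
  moreover have "stabilizer G \<phi> x \<subseteq> carrier G" by (auto simp: stabilizer_def)
  ultimately show ?thesis using fwd[OF g x] conjugate_set_eq[OF G.group_axioms g] by auto
qed

text \<open>
  Conjugation is an isomorphism \<open>K \<rightarrow> K'\<close>, so it maps a generator to a generator, and an infinite cyclic
  group has only two of them.
\<close>

lemma (in free_on_generators) conjugate_gen_eq:
  assumes K: "K \<in> T" "K' \<in> T" and h: "h \<in> carrier G" and im: "conjugate_set G h K = K'"
  shows "h \<otimes> t K \<otimes> inv h \<in> {t K', inv t K'}"
proof -
  define y where "y = h \<otimes> t K \<otimes> inv h"
  note tK = gen_carrier[OF K(1)] gen_carrier[OF K(2)]
  have y: "y \<in> carrier G" using tK h by (simp add: y_def)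
  have sub: "K \<subseteq> carrier G" using subgroup_factor[OF K(1)] by (rule subgroup.subset)
  have hom: "(\<lambda>k. h \<otimes> k \<otimes> inv h) \<in> hom G G"
  proof (rule homI)
    fix a b assume "a \<in> carrier G" "b \<in> carrier G"
    moreover from this have "inv h \<otimes> (h \<otimes> (b \<otimes> inv h)) = b \<otimes> inv h" using h by (simp flip: m_assoc)
    ultimately show "h \<otimes> (a \<otimes> b) \<otimes> inv h = h \<otimes> a \<otimes> inv h \<otimes> (h \<otimes> b \<otimes> inv h)"
      using h by (simp add: m_assoc)
  qed (use h in simp)
  have pow: "h \<otimes> (t K [^] i) \<otimes> inv h = y [^] i" for i :: int
    using hom_int_pow[OF hom tK(1) group_axioms group_axioms, of i] by (simp add: y_def)
  have K'_eq: "K' = (\<lambda>k. h \<otimes> k \<otimes> inv h) ` K"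
    using conjugate_set_eq[OF group_axioms h sub] im by simp
  have "y \<in> K'" unfolding K'_eq y_def using gen_factor[OF K(1)] by blast
  then obtain j :: int where j: "y = t K' [^] j" using factor_power[OF K(2)] by blast
  have "t K' \<in> (\<lambda>k. h \<otimes> k \<otimes> inv h) ` K" using gen_factor[OF K(2)] K'_eq by simp
  then obtain k where "k \<in> K" "t K' = h \<otimes> k \<otimes> inv h" by blast
  moreover from this(1) obtain i :: int where "k = t K [^] i" using factor_power[OF K(1)] by blast
  ultimately have "t K' = y [^] i" using pow by simp
  then have "t K' [^] (1::int) = t K' [^] (j * i)" using j tK by (simp add: int_pow_pow)
  moreover have "infinite (range (\<lambda>n::int. t K' [^] n))" using powers[OF K(2)] infinite_factors[OF K(2)] by simp
  ultimately have "1 = j * i" using infinite_cyclic_powers_inject[OF tK(2)] by blast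
  then have "j = 1 \<or> j = -1" by (metis zmult_eq_1_iff)
  then show ?thesis using j tK by (auto simp: int_pow_neg y_def[symmetric])
qed

theorem theorem1p3:
  fixes G :: "('a, 'm) monoid_scheme" and E :: "'x set" and \<phi> :: "'a \<Rightarrow> 'x \<Rightarrow> 'x"
    and Q :: "'a set set"
  assumes "coherent_group G"
    and "group_pair G E \<phi>"
    and "cohen_lyndon G E \<phi>"
    and "\<And>x. x \<in> E \<Longrightarrow> infinite_cyclic_group (G\<lparr>carrier := stabilizer G \<phi> x\<rparr>)"
    and "subgroup Q (G Mod stabilizers_span G E \<phi>)"
    and "type_FP2_rat ((G Mod stabilizers_span G E \<phi>)\<lparr>carrier := Q\<rparr>)"
  shows "finitely_presented_group ((G Mod stabilizers_span G E \<phi>)\<lparr>carrier := Q\<rparr>)"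
proof -
  interpret G: group G using assms(1) by (simp add: coherent_group_def)
  interpret \<phi>: group_action G E \<phi> using assms(2) by (simp add: group_pair_def)
  define N where "N = stabilizers_span G E \<phi>"
  obtain T where T: "T \<subseteq> stabilizers G E \<phi>"
    and rep: "\<And>C. C \<in> orbits (G\<lparr>carrier := N\<rparr>) (stabilizers G E \<phi>) (conjugate_set G) \<Longrightarrow> \<exists>!K. K \<in> T \<and> K \<in> C"
    and int: "internal_free_product G T N"
    using assms(3) by (auto simp: cohen_lyndon_def N_def)
  have stab: "subgroup K G" "infinite_cyclic_group (G\<lparr>carrier := K\<rparr>)" if "K \<in> stabilizers G E \<phi>" for K
    using that assms(4) \<phi>.stabilizer_subgroup by (auto simp: stabilizers_def)
  have "\<exists>x\<in>K. range (\<lambda>n::int. x [^]\<^bsub>G\<^esub> n) = K" if "K \<in> T" for K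
  proof -
    have K: "subgroup K G" "cyclic_group (G\<lparr>carrier := K\<rparr>)"
      using stab[of K] T that by (auto simp: infinite_cyclic_group_def)
    interpret K: group "G\<lparr>carrier := K\<rparr>" using K(1) by (rule G.subgroup_imp_group)
    obtain x where "x \<in> K" "K = range (\<lambda>n::int. x [^]\<^bsub>G\<lparr>carrier := K\<rparr>\<^esub> n)"
      using K(2) K.cyclic_group by auto
    then show ?thesis using G.int_pow_consistent[OF K(1)] by auto
  qed
  then obtain t where t: "\<And>K. K \<in> T \<Longrightarrow> t K \<in> K" "\<And>K. K \<in> T \<Longrightarrow> range (\<lambda>n::int. t K [^]\<^bsub>G\<^esub> n) = K" by metis
  interpret free_on_generators G T N t
  proof unfold_locales
    show "internal_free_product G T N" by (rule int)
    fix K assume K: "K \<in> T"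
    show "range (\<lambda>n::int. t K [^]\<^bsub>G\<^esub> n) = K" by (rule t(2)[OF K])
    show "infinite K" using stab(2)[of K] T K by (auto simp: infinite_cyclic_group_def)
    show "t K \<in> carrier G" using subgroup.mem_carrier[OF stab(1) t(1)[OF K]] T K by blast
  qed
  have stab_conj: "conjugate_set G g K \<in> stabilizers G E \<phi>" if "g \<in> carrier G" "K \<in> stabilizers G E \<phi>" for g K
    using that \<phi>.conjugate_stabilizer \<phi>.element_image unfolding stabilizers_def by blast
  have normal: "N \<lhd> G"
    unfolding N_def stabilizers_span_def
  proof (rule G.normal_generateI)
    show "(\<Union>x\<in>E. stabilizer G \<phi> x) \<subseteq> carrier G" by (auto simp: stabilizer_def)
    fix h g assume "h \<in> (\<Union>x\<in>E. stabilizer G \<phi> x)" and g: "g \<in> carrier G"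
    then obtain x where x: "x \<in> E" "h \<in> stabilizer G \<phi> x" by blast
    have "stabilizer G \<phi> x \<subseteq> carrier G" by (auto simp: stabilizer_def)
    then have "g \<otimes>\<^bsub>G\<^esub> h \<otimes>\<^bsub>G\<^esub> inv\<^bsub>G\<^esub> g \<in> conjugate_set G g (stabilizer G \<phi> x)"
      using conjugate_set_eq[OF G.group_axioms g] x(2) by simp
    then show "g \<otimes>\<^bsub>G\<^esub> h \<otimes>\<^bsub>G\<^esub> inv\<^bsub>G\<^esub> g \<in> (\<Union>x\<in>E. stabilizer G \<phi> x)"
      using \<phi>.conjugate_stabilizer[OF g x(1)] \<phi>.element_image[OF g x(1)] by auto
  qed
  have "\<exists>x\<in>N. \<exists>l\<in>letters. h \<otimes>\<^bsub>G\<^esub> t K \<otimes>\<^bsub>G\<^esub> inv\<^bsub>G\<^esub> h = x \<otimes>\<^bsub>G\<^esub> l \<otimes>\<^bsub>G\<^esub> inv\<^bsub>G\<^esub> x"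
    if h: "h \<in> carrier G" and K: "K \<in> T" for h K
  proof -
    have KS: "K \<in> stabilizers G E \<phi>" "K \<subseteq> carrier G"
      using K T subgroup.subset[OF subgroup_factor[OF K]] by auto
    (* The conjugate of K by h is a stabiliser, hence it is conjugate in N to some member of T. *)
    have "orbit (G\<lparr>carrier := N\<rparr>) (conjugate_set G) (conjugate_set G h K)
        \<in> orbits (G\<lparr>carrier := N\<rparr>) (stabilizers G E \<phi>) (conjugate_set G)"
      using stab_conj[OF h KS(1)] by (auto simp: orbits_def)
    from rep[OF this] obtain K' n where K': "K' \<in> T" and n: "n \<in> N"
      and K'_eq: "K' = conjugate_set G n (conjugate_set G h K)" by (auto simp: orbit_def)
    have nG: "n \<in> carrier G" using n by (rule N_carrier)
    have "conjugate_set G n (conjugate_set G h K) = conjugate_set G (n \<otimes>\<^bsub>G\<^esub> h) K"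
    proof -
      have "(\<lambda>k. h \<otimes>\<^bsub>G\<^esub> k \<otimes>\<^bsub>G\<^esub> inv\<^bsub>G\<^esub> h) ` K \<subseteq> carrier G" using h KS(2) by auto
      then have "conjugate_set G n (conjugate_set G h K)
          = (\<lambda>k. n \<otimes>\<^bsub>G\<^esub> (h \<otimes>\<^bsub>G\<^esub> k \<otimes>\<^bsub>G\<^esub> inv\<^bsub>G\<^esub> h) \<otimes>\<^bsub>G\<^esub> inv\<^bsub>G\<^esub> n) ` K"
        by (simp add: conjugate_set_eq[OF G.group_axioms] h nG KS(2) image_image)
      also have "\<dots> = (\<lambda>k. (n \<otimes>\<^bsub>G\<^esub> h) \<otimes>\<^bsub>G\<^esub> k \<otimes>\<^bsub>G\<^esub> inv\<^bsub>G\<^esub> (n \<otimes>\<^bsub>G\<^esub> h)) ` K"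
      proof (rule image_cong[OF refl])
        fix k assume "k \<in> K"
        then have "k \<in> carrier G" using KS(2) by blast
        then show "n \<otimes>\<^bsub>G\<^esub> (h \<otimes>\<^bsub>G\<^esub> k \<otimes>\<^bsub>G\<^esub> inv\<^bsub>G\<^esub> h) \<otimes>\<^bsub>G\<^esub> inv\<^bsub>G\<^esub> n
            = (n \<otimes>\<^bsub>G\<^esub> h) \<otimes>\<^bsub>G\<^esub> k \<otimes>\<^bsub>G\<^esub> inv\<^bsub>G\<^esub> (n \<otimes>\<^bsub>G\<^esub> h)"
          using h nG by (simp add: G.inv_mult_group G.m_assoc)
      qed
      also have "\<dots> = conjugate_set G (n \<otimes>\<^bsub>G\<^esub> h) K"
        using h nG by (simp add: conjugate_set_eq[OF G.group_axioms _ KS(2)])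
      finally show ?thesis .
    qed
    then have l: "(n \<otimes>\<^bsub>G\<^esub> h) \<otimes>\<^bsub>G\<^esub> t K \<otimes>\<^bsub>G\<^esub> inv\<^bsub>G\<^esub> (n \<otimes>\<^bsub>G\<^esub> h) \<in> {t K', inv\<^bsub>G\<^esub> t K'}" (is "?l \<in> _")
      using conjugate_gen_eq[OF K K'] K'_eq h nG by simp
    have "?l \<in> letters" using l K' by (auto simp: letters_def)
    moreover have "h \<otimes>\<^bsub>G\<^esub> t K \<otimes>\<^bsub>G\<^esub> inv\<^bsub>G\<^esub> h = inv\<^bsub>G\<^esub> n \<otimes>\<^bsub>G\<^esub> ?l \<otimes>\<^bsub>G\<^esub> inv\<^bsub>G\<^esub> (inv\<^bsub>G\<^esub> n)"
    proof -
      have tK: "t K \<in> carrier G" by (rule gen_carrier[OF K])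
      have "inv\<^bsub>G\<^esub> n \<otimes>\<^bsub>G\<^esub> ?l = h \<otimes>\<^bsub>G\<^esub> t K \<otimes>\<^bsub>G\<^esub> inv\<^bsub>G\<^esub> (n \<otimes>\<^bsub>G\<^esub> h)" using h nG tK by (simp flip: G.m_assoc)
      then show ?thesis using h nG tK by (simp add: G.inv_mult_group G.m_assoc)
    qed
    ultimately show ?thesis using N_closed(2)[OF n] by blast
  qed
  then show ?thesis
    using subgroup_of_quotient_finitely_presented[OF assms(1) normal _ assms(5,6)[folded N_def]] by (simp add: N_def)
qed

end
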